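(* Let $(\mathcal G,\mathcal O,\mathfrak l)$ be a plabic graph with perfect orientation $\mathcal O$ having source set $I=\{i_1<\dots<i_k\}$ and gauge ray direction $\mathfrak l$, let $w_e>0$ be arbitrary positive weights on its edges, $\mathcal N$ the resulting network, and let $\epsilon$ be the geometric signature of $(\mathcal G,\mathcal O,\mathfrak l)$ (given by the explicit formulas in the context). Let $E_1,\dots,E_n$ be the canonical basis of $\mathbb R^n$ and let $(E_e)_e$ be the edge vectors of $(\mathcal N,\mathcal O,\mathfrak l)$ with boundary vectors $E_j$, $j\in\bar I$ (see context). Define half-edge vectors at internal vertices by: if $U$ is black with unique outgoing edge $e_m$, then $z_{U,e_m}=E_{e_m}$ and $z_{U,e}=(-1)^{\mathrm{int}(e)+\mathrm{wind}(e,e_m)}w_e^{-1}E_e$ for every other edge $e$ at $U$; if $U$ is white with unique incoming edge $e_1$, then $z_{U,e_1}=(-1)^{\mathrm{int}(e_1)}w_{e_1}^{-1}E_{e_1}$ and $z_{U,e}=(-1)^{1+\mathrm{wind}(e,e_1)}E_e$ for every other edge $e$ at $U$; at boundary sinks put $z_{b_j,e}=E_j$ and at boundary sources put $z_{b_i,e}=-E_e$. Then: (1) these half-edge vectors satisfy Lam's system of relations for $\mathcal N$ with signature $\epsilon$ (i.e. the linear relations satisfied by the edge vectors are exactly Lam's relations for the geometric signature); (2) Lam's system of relations for the geometric signature has full rank for every choice of positive weights; (3) with the canonical basis vectors $z_{b_j,e}=E_j$ assigned at the boundary sinks, the solution at each boundary source $b_{i_r}$ is $z_{b_{i_r},e}=E_{i_r}-A[r]$,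 $r\in[k]$, where $A[r]$ is the $r$-th row of Postnikov's boundary measurement matrix $A$ of $\mathcal N$ with respect to the base $I$; thus the solution produces the boundary measurement matrix; (4) if $\hat\epsilon$ is a geometric signature equivalent to $\epsilon$ via the gauge function $\eta$, then the solution $\hat z$ of Lam's system for $\hat\epsilon$ with the same boundary values at the sinks is $\hat z_{U,e}=(-1)^{\eta(U)}z_{U,e}$ at internal vertices $U$ and $\hat z_{U,e}=z_{U,e}$ at boundary source vertices $U$.
   Context: A plabic graph $\mathcal G$ is a finite planar directed graph embedded in a closed disc, none of whose connected components is disjoint from the boundary circle, such that: it has $n$ boundary vertices $b_1,\dots,b_n$ on the boundary circle, labelled clockwise, all lying on a common arc of the circle, each of degree $1$; all other (internal) vertices lie in the open disc and have degree $2$ or $3$; the orientation is perfect: each internal vertex has exactly one incoming edge (then coloured white) or exactly one outgoing edge (then coloured black), bivalent vertices being assigned one of the two colours. Edges are straight segments. A boundary vertex is a source if its edge is outgoing, a sink otherwise; $I$ is the set of source indices, $k=|I|$, $\bar I=[n]\setminus I$. Signatures, Lam's relations, full rank, equivalence: a signature assigns $\epsilon_e=\epsilon_{U,V}=\epsilon_{V,U}\in\{0,1\}$ to each edge. Lam's system for half-edge vectors $z_{U,e}\in\mathbb R^n$: (i) $z_{U,e}=(-1)^{\epsilon_{U,V}}w_e z_{V,e}$ for each edge $e$ directed from $U$ to $V$; (ii) $\sum_e z_{V,e}=0$ over edges at each internal white $V$; (iii) $z_{V,e}=z_{V,e'}$ for all edges at each internal black $V$. Full rank: unique solution for any prescribed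 half-edge vectors at the boundary sinks. Signatures $\epsilon,\hat\epsilon$ are equivalent via $\eta:\{\text{internal vertices}\}\to\{0,1\}$ if $\hat\epsilon_{U,V}\equiv\epsilon_{U,V}+\eta(U)+\eta(V)$ on edges between internal vertices and $\hat\epsilon_{U,V}\equiv\epsilon_{U,V}+\eta(U)$ on an edge from internal $U$ to boundary $V$ (mod 2). Gauge ray direction and indices: a gauge ray direction is a direction $\mathfrak l$ such that rays from boundary vertices in direction $\mathfrak l$ enter the disc, no edge is parallel to $\mathfrak l$, and no such ray passes through an internal vertex. For nonzero vectors $f,g$, $s(f,g)=1,0,-1$ according as $\det(f,g)>0,=0,<0$. For an ordered pair $(e,f)$ of oriented edges (as vectors), $\mathrm{wind}(e,f)=1$ if $s(e,f)=s(e,\mathfrak l)=s(\mathfrak l,f)=1$, $-1$ if these are all $-1$, $0$ otherwise. For $i\in I$ let $\mathfrak l_i$ be the ray from $b_i$ in direction $\mathfrak l$; $\mathrm{int}(e)$ is the number of intersection points of $e$ with the rays $\mathfrak l_i$, $i\in I$, times $s(\mathfrak l,e)$. Geometric signature (values mod 2): for $e$ from internal $V$ to a sink: $\mathrm{int}(e)$ if $V$ black, $1+\mathrm{int}(e)+\mathrm{wind}(e_1,e)$ if $V$ white with incoming edge $e_1$; for $e$ from a source to internal $V$: $1+\mathrm{int}(e)+\mathrm{wind}(e,e')$ if $V$ black with outgoing edge $e'$, $1+\mathrm{int}(e)$ if $V$ white; for $e$ from internal $U$ to internal $V$: $\mathrm{int}(e)$ if $U$ black, $V$ white; $1+\mathrm{int}(e)+\mathrm{wind}(e_1,e)$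 if $U,V$ white, $e_1$ incoming at $U$; $1+\mathrm{int}(e)+\mathrm{wind}(e_1,e)+\mathrm{wind}(e,e_5)$ if $U$ white, $V$ black, $e_1$ incoming at $U$, $e_5$ outgoing at $V$; $\mathrm{int}(e)+\mathrm{wind}(e,e_5)$ if $U,V$ black, $e_5$ outgoing at $V$. A signature is geometric if it is equivalent to this one. Edge vectors: the edge vectors $(E_e)$ with boundary vectors $E_j$ ($j\in\bar I$) are the unique solution (it is known to exist and be unique for positive weights) of the linear system: $E_e=(-1)^{\mathrm{int}(e)}w_eE_j$ if $e$ ends at the sink $b_j$; at a bivalent vertex with incoming $e$ and outgoing $f$, $E_e=(-1)^{\mathrm{int}(e)+\mathrm{wind}(e,f)}w_eE_f$; at a trivalent black vertex with incoming $e_2,e_3$ and outgoing $e_1$, $E_{e_a}=(-1)^{\mathrm{int}(e_a)+\mathrm{wind}(e_a,e_1)}w_{e_a}E_{e_1}$ for $a=2,3$; at a trivalent white vertex with incoming $e_3$ and outgoing $e_1,e_2$, $E_{e_3}=(-1)^{\mathrm{int}(e_3)+\mathrm{wind}(e_3,e_1)}w_{e_3}E_{e_1}+(-1)^{\mathrm{int}(e_3)+\mathrm{wind}(e_3,e_2)}w_{e_3}E_{e_2}$. (Equivalently, $E_e$ is the signed sum over directed paths $P$ from $e$ to sinks $b_j$ of $(-1)^{\sum\mathrm{wind}+\sum\mathrm{int}}w(P)E_j$.) Boundary measurement matrix: for $i\in I$, $j\in\bar I$, Postnikov's boundary measurement $M_{ij}$ is the sum over directed walks $P$ from $b_i$ to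 $b_j$ of $(-1)^{\mathrm{Wind}(P)}w(P)$, where $w(P)$ is the product of edge weights (with multiplicity) and $\mathrm{Wind}(P)$ is Postnikov's topological winding index of $P$; it is a subtraction-free rational function of the weights. The boundary measurement matrix $A$ is the $k\times n$ matrix whose columns indexed by $I$ form the identity matrix and whose other entries are $A^r_j=(-1)^{\sigma(i_r,j)}M_{i_rj}$, $\sigma(i_r,j)$ being the number of elements of $I$ strictly between $i_r$ and $j$; it represents a point of the totally non-negative Grassmannian. *)

theory Defs
  imports
    "HOL-Library.Poly_Mapping"
    "Graph_Theory.Pair_Digraph"
    "Graph_Theory.Digraph_Component"
    "HOL-Analysis.Analysis"
begin

section \<open>Plabic graphs\<close>

text \<open>
  The plane is \<^typ>\<open>complex\<close>. Vertices are points and an edge directed from \<open>U\<close> to \<open>V\<close> is the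
  pair \<open>(U, V)\<close>, drawn as the straight segment from \<open>U\<close> to \<open>V\<close>; the orientation is part of the
  digraph. The index set \<open>[n]\<close> is a finite linearly ordered type \<open>'n\<close>. \<open>white\<close> is only
  meaningful on internal vertices; internal vertices outside it are black.
\<close>

record 'n plabic =
  net :: "complex pair_pre_digraph"
  centre :: complex
  radius :: real
  bdry :: "'n \<Rightarrow> complex"
  white :: "complex set"

abbreviation dg :: "'n plabic \<Rightarrow> (complex, complex \<times> complex) pre_digraph" where
  "dg G \<equiv> with_proj (net G)"

abbreviation edges :: "'n plabic \<Rightarrow> (complex \<times> complex) set" where
  "edges G \<equiv> arcs (dg G)"

definition internal :: "'n plabic \<Rightarrow> complex set" where
  "internal G = verts (dg G) - range (bdry G)"

definition degree :: "'n plabic \<Rightarrow> complex \<Rightarrow> nat" where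
  "degree G v = in_degree (dg G) v + out_degree (dg G) v"

text \<open>
  Labels run clockwise along a common arc. As the rays of a gauge ray direction have to enter the
  disc at every boundary vertex, that arc is taken to be shorter than a half circle. If longer arcs
  were allowed, a cyclic shift of the labels along the arc would be admitted as well, and then the
  numbers \<open>\<sigma>(i, j)\<close> would no longer count boundary sources lying between \<open>b\<^sub>i\<close> and \<open>b\<^sub>j\<close>.

  In \<open>embedded\<close>, two different edges meet at most in common end points. This excludes
  parallel and antiparallel edges, and vertices in the interior of an edge.
\<close>

locale plabic_graph =
  fixes G :: "'n::{finite,linorder} plabic"
  assumes finite_loopfree: "pair_digraph (net G)"
    and radius_pos: "0 < radius G"
    and boundary_verts: "range (bdry G) \<subseteq> verts (dg G)"
    and boundary_clockwise: "\<exists>\<theta> :: 'n \<Rightarrow> real.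
        (\<forall>i. bdry G i = centre G + of_real (radius G) * cis (\<theta> i)) \<and>
        (\<forall>i j. i < j \<longrightarrow> \<theta> j < \<theta> i \<and> \<theta> i - \<theta> j < pi)"
    and boundary_degree: "\<And>i. degree G (bdry G i) = 1"
    and internal_in_disc: "internal G \<subseteq> ball (centre G) (radius G)"
    and internal_degree: "\<And>v. v \<in> internal G \<Longrightarrow> degree G v = 2 \<or> degree G v = 3"
    and perfect_white: "\<And>v. v \<in> internal G \<Longrightarrow> v \<in> white G \<Longrightarrow> in_degree (dg G) v = 1"
    and perfect_black: "\<And>v. v \<in> internal G \<Longrightarrow> v \<notin> white G \<Longrightarrow> out_degree (dg G) v = 1"
    and connected_to_boundary:
      "\<And>v. v \<in> verts (dg G) \<Longrightarrow> \<exists>i. v \<rightarrow>\<^sup>*\<^bsub>with_proj (mk_symmetric (dg G))\<^esub> bdry G i"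
    and embedded: "\<And>e f. e \<in> edges G \<Longrightarrow> f \<in> edges G \<Longrightarrow> e \<noteq> f \<Longrightarrow>
        closed_segment (fst e) (snd e) \<inter> closed_segment (fst f) (snd f)
          \<subseteq> {fst e, snd e} \<inter> {fst f, snd f}"

definition sources :: "'n plabic \<Rightarrow> 'n set" where
  "sources G = {i. \<exists>e\<in>edges G. fst e = bdry G i}"

definition label :: "'n plabic \<Rightarrow> complex \<Rightarrow> 'n" where
  "label G v = inv (bdry G) v"

text \<open>The unique incoming edge at a white vertex, the unique outgoing edge at a black vertex.\<close>

definition in_edge :: "'n plabic \<Rightarrow> complex \<Rightarrow> complex \<times> complex" where
  "in_edge G v = the_elem (in_arcs (dg G) v)"

definition out_edge :: "'n plabic \<Rightarrow> complex \<Rightarrow> complex \<times> complex" where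
  "out_edge G v = the_elem (out_arcs (dg G) v)"


section \<open>Signatures and Lam's relations\<close>

text \<open>
  There is at most one edge between two vertices, so a signature is a function of the edge.
  A family of half-edge vectors is \<open>z U e\<close>, only meaningful when \<open>U\<close> is an end point of \<open>e\<close>.
\<close>

definition is_signature :: "'n plabic \<Rightarrow> (complex \<times> complex \<Rightarrow> nat) \<Rightarrow> bool" where
  "is_signature G \<epsilon> \<longleftrightarrow> (\<forall>e\<in>edges G. \<epsilon> e \<in> {0, 1})"

definition edges_at :: "'n plabic \<Rightarrow> complex \<Rightarrow> (complex \<times> complex) set" where
  "edges_at G v = in_arcs (dg G) v \<union> out_arcs (dg G) v"

definition lam_system ::
  "'n::finite plabic \<Rightarrow> (complex \<times> complex \<Rightarrow> real) \<Rightarrow> (complex \<times> complex \<Rightarrow> nat) \<Rightarrow>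
   (complex \<Rightarrow> complex \<times> complex \<Rightarrow> real ^ 'n) \<Rightarrow> bool" where
  "lam_system G w \<epsilon> z \<longleftrightarrow>
     (\<forall>(U, V)\<in>edges G. z U (U, V) = ((-1) ^ \<epsilon> (U, V) * w (U, V)) *\<^sub>R z V (U, V)) \<and>
     (\<forall>v\<in>internal G. v \<in> white G \<longrightarrow> (\<Sum>e\<in>edges_at G v. z v e) = 0) \<and>
     (\<forall>v\<in>internal G. v \<notin> white G \<longrightarrow> (\<forall>e\<in>edges_at G v. \<forall>e'\<in>edges_at G v. z v e = z v e'))"

definition sink_values ::
  "'n plabic \<Rightarrow> ('n \<Rightarrow> real ^ 'n) \<Rightarrow> (complex \<Rightarrow> complex \<times> complex \<Rightarrow> real ^ 'n) \<Rightarrow> bool" where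
  "sink_values G b z \<longleftrightarrow>
     (\<forall>j. j \<notin> sources G \<longrightarrow> (\<forall>e\<in>edges_at G (bdry G j). z (bdry G j) e = b j))"

definition full_rank ::
  "'n::finite plabic \<Rightarrow> (complex \<times> complex \<Rightarrow> real) \<Rightarrow> (complex \<times> complex \<Rightarrow> nat) \<Rightarrow> bool" where
  "full_rank G w \<epsilon> \<longleftrightarrow>
     (\<forall>b :: 'n \<Rightarrow> real ^ 'n. \<exists>z. lam_system G w \<epsilon> z \<and> sink_values G b z \<and>
        (\<forall>z'. lam_system G w \<epsilon> z' \<and> sink_values G b z' \<longrightarrow>
           (\<forall>U\<in>verts (dg G). \<forall>e\<in>edges_at G U. z' U e = z U e)))"

definition equivalent_via ::
  "'n plabic \<Rightarrow> (complex \<times> complex \<Rightarrow> nat) \<Rightarrow> (complex \<times> complex \<Rightarrow> nat) \<Rightarrow> (complex \<Rightarrow> nat) \<Rightarrow> bool"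
where
  "equivalent_via G \<epsilon> \<epsilon>' \<eta> \<longleftrightarrow>
     (\<forall>v\<in>internal G. \<eta> v \<in> {0, 1}) \<and>
     (\<forall>(U, V)\<in>edges G. \<epsilon>' (U, V) mod 2 =
        (\<epsilon> (U, V) + (if U \<in> internal G then \<eta> U else 0)
                  + (if V \<in> internal G then \<eta> V else 0)) mod 2)"


section \<open>Gauge ray direction, indices, geometric signature\<close>

definition det2 :: "complex \<Rightarrow> complex \<Rightarrow> real" where
  "det2 f g = Re f * Im g - Im f * Re g"

definition s_index :: "complex \<Rightarrow> complex \<Rightarrow> int" where
  "s_index f g = (if det2 f g > 0 then 1 else if det2 f g = 0 then 0 else -1)"

definition evec :: "complex \<times> complex \<Rightarrow> complex" where
  "evec e = snd e - fst e"

text \<open>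
  The gauge ray at a vertex does not contain its starting point, so that the edge at a source
  \<open>b\<^sub>i\<close> is not counted as crossing the ray that starts at \<open>b\<^sub>i\<close>.
\<close>

definition gauge_ray :: "complex \<Rightarrow> complex \<Rightarrow> complex set" where
  "gauge_ray l b = {b + of_real t * l |t. t > 0}"

definition gauge_direction :: "'n plabic \<Rightarrow> complex \<Rightarrow> bool" where
  "gauge_direction G l \<longleftrightarrow> l \<noteq> 0 \<and>
     (\<forall>i. gauge_ray l (bdry G i) \<inter> ball (centre G) (radius G) \<noteq> {}) \<and>
     (\<forall>e\<in>edges G. det2 l (evec e) \<noteq> 0) \<and>
     (\<forall>i. gauge_ray l (bdry G i) \<inter> internal G = {})"

definition wind :: "complex \<Rightarrow> complex \<times> complex \<Rightarrow> complex \<times> complex \<Rightarrow> int" where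
  "wind l e f =
     (if s_index (evec e) (evec f) = 1 \<and> s_index (evec e) l = 1 \<and> s_index l (evec f) = 1 then 1
      else if s_index (evec e) (evec f) = -1 \<and> s_index (evec e) l = -1 \<and> s_index l (evec f) = -1
      then -1 else 0)"

definition int_index :: "'n plabic \<Rightarrow> complex \<Rightarrow> complex \<times> complex \<Rightarrow> int" where
  "int_index G l e =
     s_index l (evec e) *
     int (card (closed_segment (fst e) (snd e) \<inter> (\<Union>i\<in>sources G. gauge_ray l (bdry G i))))"

text \<open>
  The values for edges with at least one internal end point are the usual ones. An edge from a
  source directly to a sink gets \<open>1 + int(e)\<close>, the value for an edge from a source to a white
  vertex (equivalently, the sign forced by \<open>z = - E\<^sub>e\<close> at the source and \<open>z = E\<^sub>j\<close> at the sink).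
\<close>

definition geometric_signature :: "'n plabic \<Rightarrow> complex \<Rightarrow> complex \<times> complex \<Rightarrow> nat" where
  "geometric_signature G l e =
    (let U = fst e; V = snd e; i = int_index G l e in nat ((
      if U \<in> internal G \<and> V \<notin> internal G then
        (if U \<notin> white G then i
         else 1 + i + wind l (in_edge G U) e)
      else if U \<notin> internal G \<and> V \<in> internal G then
        (if V \<notin> white G then 1 + i + wind l e (out_edge G V)
         else 1 + i)
      else if U \<in> internal G \<and> V \<in> internal G then
        (if U \<notin> white G \<and> V \<in> white G then i
         else if U \<in> white G \<and> V \<in> white G then 1 + i + wind l (in_edge G U) e
         else if U \<in> white G \<and> V \<notin> white G
           then 1 + i + wind l (in_edge G U) e + wind l e (out_edge G V)
         else i + wind l e (out_edge G V))
      else 1 + i) mod 2))"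


section \<open>Edge vectors and the associated half-edge vectors\<close>

definition edge_vector_system ::
  "'n::finite plabic \<Rightarrow> complex \<Rightarrow> (complex \<times> complex \<Rightarrow> real) \<Rightarrow>
   (complex \<times> complex \<Rightarrow> real ^ 'n) \<Rightarrow> bool" where
  "edge_vector_system G l w F \<longleftrightarrow>
     (\<forall>j. \<forall>e\<in>in_arcs (dg G) (bdry G j). F e = ((-1) powi int_index G l e * w e) *\<^sub>R axis j 1) \<and>
     (\<forall>v\<in>internal G. degree G v = 2 \<longrightarrow>
        (\<forall>e\<in>in_arcs (dg G) v. \<forall>f\<in>out_arcs (dg G) v.
           F e = ((-1) powi (int_index G l e + wind l e f) * w e) *\<^sub>R F f)) \<and>
     (\<forall>v\<in>internal G. degree G v = 3 \<and> v \<notin> white G \<longrightarrow>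
        (\<forall>e\<in>in_arcs (dg G) v.
           F e = ((-1) powi (int_index G l e + wind l e (out_edge G v)) * w e) *\<^sub>R F (out_edge G v))) \<and>
     (\<forall>v\<in>internal G. degree G v = 3 \<and> v \<in> white G \<longrightarrow>
        F (in_edge G v) = (\<Sum>f\<in>out_arcs (dg G) v.
           ((-1) powi (int_index G l (in_edge G v) + wind l (in_edge G v) f) * w (in_edge G v)) *\<^sub>R F f))"

text \<open>The solution of the system is unique on the edges; elsewhere it is set to zero.\<close>

definition edge_vectors ::
  "'n::finite plabic \<Rightarrow> complex \<Rightarrow> (complex \<times> complex \<Rightarrow> real) \<Rightarrow>
   complex \<times> complex \<Rightarrow> real ^ 'n" where
  "edge_vectors G l w = (THE F. edge_vector_system G l w F \<and> (\<forall>e. e \<notin> edges G \<longrightarrow> F e = 0))"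

definition half_edge_vectors ::
  "'n::finite plabic \<Rightarrow> complex \<Rightarrow> (complex \<times> complex \<Rightarrow> real) \<Rightarrow>
   (complex \<times> complex \<Rightarrow> real ^ 'n) \<Rightarrow> complex \<Rightarrow> complex \<times> complex \<Rightarrow> real ^ 'n" where
  "half_edge_vectors G l w F U e =
     (if U \<in> internal G then
        if U \<notin> white G then
          (if e = out_edge G U then F e
           else ((-1) powi (int_index G l e + wind l e (out_edge G U)) * inverse (w e)) *\<^sub>R F e)
        else
          (if e = in_edge G U then ((-1) powi int_index G l e * inverse (w e)) *\<^sub>R F e
           else ((-1) powi (1 + wind l e (in_edge G U))) *\<^sub>R F e)
      else if label G U \<in> sources G then - F e
      else axis (label G U) 1)"


section \<open>Postnikov's boundary measurement matrix\<close>

text \<open>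
  The winding index of a walk from \<open>b\<^sub>i\<close> to \<open>b\<^sub>j\<close> is the number of full counterclockwise turns of its
  tangent vector after smoothing the corners (each by a turn of less than a half circle). For this
  to be an integer the two end directions have to agree: the ends are bent, again by less than a
  half circle, so that the walk leaves \<open>b\<^sub>i\<close> and arrives at \<open>b\<^sub>j\<close> in the direction \<open>b\<^sub>j - b\<^sub>i\<close>.
  Such a bending stays inside the disc, since all these directions point inwards at \<open>b\<^sub>i\<close> and
  outwards at \<open>b\<^sub>j\<close>. The quotient below is an integer already, and \<open>round\<close> only changes its type.
\<close>

definition total_turning :: "complex list \<Rightarrow> real" where
  "total_turning ds = (\<Sum>k<length ds - 1. Arg (ds ! Suc k / ds ! k))"

definition winding_index :: "'n plabic \<Rightarrow> 'n \<Rightarrow> 'n \<Rightarrow> (complex \<times> complex) list \<Rightarrow> int" where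
  "winding_index G i j p =
     (let c = bdry G j - bdry G i in round (total_turning ([c] @ map evec p @ [c]) / (2 * pi)))"

text \<open>
  The sum of \<open>(-1)\<^bsup>Wind(P)\<^esup> w(P)\<close> over all walks is a formal power series in the edge weights (it need
  not converge on a graph with directed cycles), which is the expansion of a rational function of
  the weights; the boundary measurement is the value of that rational function. Monomials
  in the weights are multisets of edges; a walk \<open>p\<close> contributes to the monomial \<open>mset p\<close>.
\<close>

definition formal_measurement ::
  "'n plabic \<Rightarrow> 'n \<Rightarrow> 'n \<Rightarrow> (complex \<times> complex) multiset \<Rightarrow> real" where
  "formal_measurement G i j m =
     (\<Sum>p | pre_digraph.awalk (dg G) (bdry G i) p (bdry G j) \<and> mset p = m.
        (-1) powi winding_index G i j p)"

definition poly_value :: "('e \<Rightarrow> real) \<Rightarrow> ('e multiset \<Rightarrow>\<^sub>0 real) \<Rightarrow> real" where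
  "poly_value w P = (\<Sum>m\<in>Poly_Mapping.keys P. Poly_Mapping.lookup P m * (\<Prod>e\<in>#m. w e))"

text \<open>\<open>x\<close> is the value at \<open>w\<close> of \<open>P / Q\<close>, where \<open>Q \<cdot> F = P\<close> as formal power series.\<close>

definition has_rational_value :: "('e \<Rightarrow> real) \<Rightarrow> ('e multiset \<Rightarrow> real) \<Rightarrow> real \<Rightarrow> bool" where
  "has_rational_value w F x \<longleftrightarrow> (\<exists>P Q.
     (\<forall>m. (\<Sum>a | a \<subseteq># m. Poly_Mapping.lookup Q a * F (m - a)) = Poly_Mapping.lookup P m) \<and>
     poly_value w Q \<noteq> 0 \<and> x = poly_value w P / poly_value w Q)"

definition boundary_measurement ::
  "'n plabic \<Rightarrow> (complex \<times> complex \<Rightarrow> real) \<Rightarrow> 'n \<Rightarrow> 'n \<Rightarrow> real" where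
  "boundary_measurement G w i j = (THE x. has_rational_value w (formal_measurement G i j) x)"

text \<open>The \<open>r\<close>-th smallest source \<open>i\<^sub>r\<close>, for \<open>r\<close> between \<open>1\<close> and \<open>k\<close>.\<close>

definition nth_source :: "'n::{finite,linorder} plabic \<Rightarrow> nat \<Rightarrow> 'n" where
  "nth_source G r = sorted_list_of_set (sources G) ! (r - 1)"

definition sigma :: "'n::{finite,linorder} plabic \<Rightarrow> 'n \<Rightarrow> 'n \<Rightarrow> nat" where
  "sigma G i j = card {m \<in> sources G. min i j < m \<and> m < max i j}"

definition boundary_measurement_row ::
  "'n::{finite,linorder} plabic \<Rightarrow> (complex \<times> complex \<Rightarrow> real) \<Rightarrow> nat \<Rightarrow> real ^ 'n::{finite,linorder}" where
  "boundary_measurement_row G w r =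
     (\<chi> j. if j \<in> sources G then (if j = nth_source G r then 1 else 0)
           else (-1) ^ sigma G (nth_source G r) j * boundary_measurement G w (nth_source G r) j)"

end

theory Submission
  imports "HOL-Combinatorics.Cycles" "Jordan_Normal_Form.Determinant" Defs
begin

text \<open>
  Put \<open>y\<^sub>V\<close> for the common vector of the half-edges at a black vertex \<open>V\<close>, for the vector of the incoming
  half-edge at a white one, for the given vector at a sink and for minus the vector at a source.
  Lam's relations then say \<open>y\<^sub>U = \<Sum> \<tau>(U,V) w(U,V) y\<^sub>V\<close>, where \<open>\<tau>\<close> combines the intersection index of the edge
  with the winding at its white tail and at its black head; the product of \<open>\<tau>\<close> along a walk is the
  sign \<open>(-1)\<^bsup>\<Sum>int + \<Sum>wind\<^esup>\<close>.

  A segment meets the ray at \<open>b\<^sub>m\<close> exactly if its end points lie on opposite sides of the line through \<open>b\<^sub>m\<close>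
  in direction \<open>l\<close>. So the intersection indices are a coboundary on internal vertices and disappear
  from every closed walk, and between boundary vertices they give \<open>\<sigma>(i,j)\<close>. The total winding of a
  simple polygon is odd, so every simple cycle has sign \<open>-1\<close>; expanding \<open>det(1 - \<tau>w)\<close> over permutations, all
  terms are non-negative and the identity contributes at least 1. Hence the system is uniquely
  solvable, and Cramer's rule holds simultaneously for the values at \<open>w\<close> and for the formal power
  series that count walks.
\<close>

section \<open>The winding of a simple polygon is odd\<close>

text \<open>A permutation cycle of length m \<ge> 2 brings (-1)^(m-1) from its sign, (-1)^m from the
  negated matrix entries and -1 from the geometry. The product is +1, so nothing can cancel in the
  determinant. The delicate point at the boundary is that Postnikov's winding index closes up a walk
  by the direction of its chord, which adds two corners. The last one never passes through
  \<open>l\<close>, because both directions leave the disc at the sink while \<open>l\<close> enters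
  it there. The first one passes through \<open>l\<close> exactly if the first edge and the chord
  lie on different sides of \<open>l\<close>. This is the parity contributed by the ray of the
  walk's own source, so the two cancel and only the rays of sources strictly between the ends
  remain. With directed cycles the signed sum over walks may diverge at the given weights. Therefore
  the adjugate and the determinant are kept as polynomials in the weights: they act on formal series
  on one side and are evaluated on the other, and the positive determinant permits the final
  division.\<close>

text \<open>
  The direction \<open>l\<close> is normalised to \<open>1\<close>. As in Hopf's proof of the Umlaufsatz, one follows the pairs of
  points of the polygon at equal height with the second one to the right of the first. Over a pair
  of edges such pairs form at most one segment, so the four sides of the cell contain an even number
  of its ends, except that over two consecutive edges the corner hides one end if the turn there
  passes through \<open>l\<close>.
\<close>

definition crosses :: "complex \<Rightarrow> complex \<Rightarrow> complex \<Rightarrow> bool" where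
  "crosses p A B \<longleftrightarrow> (Im A < Im p) \<noteq> (Im B < Im p)"

definition crossing_pos :: "complex \<Rightarrow> complex \<Rightarrow> real \<Rightarrow> real" where
  "crossing_pos A B y = Re A + (y - Im A) / (Im B - Im A) * (Re B - Re A)"

text \<open>\<open>crosses\<close> is half open: a segment whose lower end is level with
  \<open>p\<close> does not count. Hence every contribution of a lowest vertex vanishes.\<close>

definition left_of :: "complex \<Rightarrow> complex \<Rightarrow> complex \<Rightarrow> bool" where
  "left_of p A B \<longleftrightarrow> crosses p A B \<and> Re p < crossing_pos A B (Im p)"

definition right_of :: "complex \<Rightarrow> complex \<Rightarrow> complex \<Rightarrow> bool" where
  "right_of p A B \<longleftrightarrow> crosses p A B \<and> crossing_pos A B (Im p) < Re p"

lemma crossing_pos_ends: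
  "crossing_pos A B (Im A) = Re A" "Im A \<noteq> Im B \<Longrightarrow> crossing_pos A B (Im B) = Re B"
  by (auto simp: crossing_pos_def)

lemma not_left_right_of_ends [simp]:
  "\<not> left_of A A B" "\<not> left_of B A B" "\<not> right_of A A B" "\<not> right_of B A B"
  using crossing_pos_ends by (auto simp: left_of_def right_of_def crosses_def)

lemma crossing_pos_commute: "Im A \<noteq> Im B \<Longrightarrow> crossing_pos A B y = crossing_pos B A y"
  by (simp add: crossing_pos_def divide_simps) (simp add: algebra_simps)

lemma crosses_commute: "crosses p A B = crosses p B A"
  by (auto simp: crosses_def)

lemma left_right_of_commute:
  assumes "Im A \<noteq> Im B"
  shows "left_of p A B = left_of p B A" "right_of p A B = right_of p B A"
  using assms by (simp_all add: left_of_def right_of_def crosses_commute crossing_pos_commute)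

lemma crossing_pos_in_segment:
  assumes "Im A < Im B" "Im A \<le> y" "y \<le> Im B"
  shows "Complex (crossing_pos A B y) y \<in> closed_segment A B"
proof -
  let ?u = "(y - Im A) / (Im B - Im A)"
  have "0 \<le> ?u" "?u \<le> 1" using assms by (auto simp: divide_simps)
  moreover have "Complex (crossing_pos A B y) y = (1 - ?u) *\<^sub>R A + ?u *\<^sub>R B"
    using assms by (auto simp: complex_eq_iff crossing_pos_def divide_simps) (simp_all add: algebra_simps)
  ultimately show ?thesis by (auto simp: in_segment)
qed

lemma nonvanishing_same_sign:
  fixes g :: "real \<Rightarrow> real"
  assumes "continuous_on {y1..y2} g" "y1 \<le> y2" and nz: "\<And>y. y1 \<le> y \<Longrightarrow> y \<le> y2 \<Longrightarrow> g y \<noteq> 0"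
  shows "0 < g y1 \<longleftrightarrow> 0 < g y2"
proof (rule ccontr)
  assume "\<not> ?thesis"
  then consider "0 < g y1" "g y2 \<le> 0" | "g y1 \<le> 0" "0 < g y2" by linarith
  then show False
  proof cases
    case 1
    then show False using IVT2'[of g y2 0 y1] assms by force
  next
    case 2
    then show False using IVT'[of g y1 0 y2] assms by force
  qed
qed

text \<open>The horizontal gap \<open>g\<close> has no zero on the interval of common heights, so it
  is positive at both ends of that interval or at neither. Each end is the height of exactly one of
  the four end points, and only these end points can contribute; thus zero or two indicators are
  1.\<close>

lemma disjoint_cell_upward:
  assumes AB: "Im A < Im B" and CD: "Im C < Im D"
    and ne: "Im A \<noteq> Im C" "Im A \<noteq> Im D" "Im B \<noteq> Im C" "Im B \<noteq> Im D"
    and disj: "closed_segment A B \<inter> closed_segment C D = {}"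
  shows "even (of_bool (left_of A C D) + of_bool (left_of B C D)
             + of_bool (right_of C A B) + of_bool (right_of D A B) :: nat)"
proof -
  define g where "g y = crossing_pos C D y - crossing_pos A B y" for y
  have cont: "continuous_on S g" for S
    unfolding g_def crossing_pos_def using AB CD by (intro continuous_intros) auto
  have nz: "g y \<noteq> 0" if "Im A \<le> y" "y \<le> Im B" "Im C \<le> y" "y \<le> Im D" for y
    using crossing_pos_in_segment[OF AB, of y] crossing_pos_in_segment[OF CD, of y] that disj
    by (auto simp: g_def)
  have l: "left_of A C D \<longleftrightarrow> crosses A C D \<and> 0 < g (Im A)"
      "left_of B C D \<longleftrightarrow> crosses B C D \<and> 0 < g (Im B)"
      "right_of C A B \<longleftrightarrow> crosses C A B \<and> 0 < g (Im C)"
      "right_of D A B \<longleftrightarrow> crosses D A B \<and> 0 < g (Im D)"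
    using AB CD by (auto simp: left_of_def right_of_def g_def crossing_pos_ends)
  define y1 where "y1 = max (Im A) (Im C)"
  define y2 where "y2 = min (Im B) (Im D)"
  show ?thesis
  proof (cases "y1 \<le> y2")
    case True
    have s: "0 < g y1 \<longleftrightarrow> 0 < g y2"
      by (rule nonvanishing_same_sign[OF cont True]) (use nz in \<open>auto simp: y1_def y2_def\<close>)
    then show ?thesis
      using True AB CD ne unfolding l crosses_def y1_def y2_def
      by (auto simp: max_def min_def split: if_splits)
  next
    case False
    then show ?thesis
      using AB CD ne unfolding l crosses_def y1_def y2_def by (auto simp: max_def min_def split: if_splits)
  qed
qed

lemma disjoint_cell:
  assumes ne: "Im A \<noteq> Im B" "Im C \<noteq> Im D" "Im A \<noteq> Im C" "Im A \<noteq> Im D" "Im B \<noteq> Im C" "Im B \<noteq> Im D"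
    and disj: "closed_segment A B \<inter> closed_segment C D = {}"
  shows "even (of_bool (left_of A C D) + of_bool (left_of B C D)
             + of_bool (right_of C A B) + of_bool (right_of D A B) :: nat)"
proof -
  have *: "closed_segment B A = closed_segment A B" "closed_segment D C = closed_segment C D"
    by (simp_all add: closed_segment_commute)
  note c = left_right_of_commute[OF ne(1)] left_right_of_commute[OF ne(2)]
  consider "Im A < Im B" "Im C < Im D" | "Im B < Im A" "Im C < Im D"
    | "Im A < Im B" "Im D < Im C" | "Im B < Im A" "Im D < Im C"
    using ne by linarith
  then show ?thesis
  proof cases
    case 1 then show ?thesis using disjoint_cell_upward[of A B C D] ne disj by auto
  next
    case 2 then show ?thesis using disjoint_cell_upward[of B A C D] ne disj * c by (auto simp: ac_simps)
  next
    case 3 then show ?thesis using disjoint_cell_upward[of A B D C] ne disj * c by (auto simp: ac_simps)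
  next
    case 4 then show ?thesis using disjoint_cell_upward[of B A D C] ne disj * c by (auto simp: ac_simps)
  qed
qed

lemma odd_wind_1_iff:
  assumes "Im A \<noteq> Im B" "Im B \<noteq> Im D"
  shows "odd (wind 1 (A, B) (B, D)) \<longleftrightarrow>
     (Im B < Im A \<and> Im B < Im D \<and> 0 < det2 (B - A) (D - B)) \<or>
     (Im A < Im B \<and> Im D < Im B \<and> det2 (B - A) (D - B) < 0)"
  using assms by (auto simp: wind_def s_index_def evec_def det2_def split: if_splits)

lemma corner_left_of:
  assumes "Im A \<noteq> Im B" "Im B \<noteq> Im D" "Im A \<noteq> Im D"
  shows "left_of A B D \<longleftrightarrow>
    (Im B < Im A \<and> Im A < Im D \<and> 0 < det2 (B - A) (D - B)) \<or>
    (Im D < Im A \<and> Im A < Im B \<and> det2 (B - A) (D - B) < 0)"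
proof -
  consider "Im B < Im D" | "Im D < Im B" using assms by linarith
  then show ?thesis
    using assms
    by cases (auto simp: left_of_def crosses_def crossing_pos_def det2_def field_simps)
qed

lemma corner_right_of:
  assumes "Im A \<noteq> Im B" "Im B \<noteq> Im D" "Im A \<noteq> Im D"
  shows "right_of D A B \<longleftrightarrow>
    (Im B < Im D \<and> Im D < Im A \<and> 0 < det2 (B - A) (D - B)) \<or>
    (Im A < Im D \<and> Im D < Im B \<and> det2 (B - A) (D - B) < 0)"
proof -
  consider "Im B < Im A" | "Im A < Im B" using assms by linarith
  then show ?thesis
    using assms
    by cases (auto simp: right_of_def crosses_def crossing_pos_def det2_def field_simps)
qed

lemma corner_cell:
  assumes "Im A \<noteq> Im B" "Im B \<noteq> Im D" "Im A \<noteq> Im D"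
  shows "odd (of_bool (left_of A B D) + of_bool (right_of D A B) :: nat) \<longleftrightarrow> odd (wind 1 (A, B) (B, D))"
  unfolding corner_left_of[OF assms] corner_right_of[OF assms] odd_wind_1_iff[OF assms(1,2)]
  using assms by auto

text \<open>
  At the lowest vertex the two edges occur in the cell in the opposite order, so that a turn through
  \<open>-l\<close> is counted instead.
\<close>

lemma bottom_cell:
  assumes "Im B < Im A" "Im B < Im D" "Im A \<noteq> Im D" "det2 (B - A) (D - B) \<noteq> 0"
  shows "odd (of_bool (left_of D A B) + of_bool (right_of A B D) :: nat) \<longleftrightarrow> even (wind 1 (A, B) (B, D))"
proof -
  have sw: "det2 (B - D) (A - B) = - det2 (B - A) (D - B)" by (simp add: det2_def algebra_simps)
  have "odd (of_bool (left_of D B A) + of_bool (right_of A D B) :: nat) \<longleftrightarrow> odd (wind 1 (D, B) (B, A))"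
    using assms by (intro corner_cell) auto
  moreover have "left_of D B A = left_of D A B" "right_of A D B = right_of A B D"
    using assms left_right_of_commute by auto
  moreover have "odd (wind 1 (D, B) (B, A)) \<longleftrightarrow> even (wind 1 (A, B) (B, D))"
    using assms odd_wind_1_iff[of D B A] odd_wind_1_iff[of A B D] sw by auto
  ultimately show ?thesis by simp
qed

lemma even_telescope:
  fixes f :: "nat \<Rightarrow> nat"
  assumes "a \<le> b"
  shows "even (\<Sum>i\<in>{a..<b}. f i + f (Suc i)) \<longleftrightarrow> even (f a + f b)"
  using assms by (induction b rule: dec_induct) auto

lemma odd_wind_polygon_generic:
  fixes P :: "nat \<Rightarrow> complex"
  assumes k: "3 \<le> k" and closed: "P k = P 0"
    and ne: "\<And>i j. i < k \<Longrightarrow> j < k \<Longrightarrow> i \<noteq> j \<Longrightarrow> Im (P i) \<noteq> Im (P j)"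
    and low: "\<And>i. 0 < i \<Longrightarrow> i < k \<Longrightarrow> Im (P 0) < Im (P i)"
    and disj: "\<And>a b. Suc a < b \<Longrightarrow> b < k \<Longrightarrow> \<not> (a = 0 \<and> b = k - 1) \<Longrightarrow>
        closed_segment (P a) (P (Suc a)) \<inter> closed_segment (P b) (P (Suc b)) = {}"
    and bottom: "det2 (P 0 - P (k - 1)) (P 1 - P 0) \<noteq> 0"
  shows "odd (wind 1 (P (k - 1), P 0) (P 0, P 1) +
           (\<Sum>b\<in>{1..<k}. wind 1 (P (b - 1), P b) (P b, P (Suc b))))"
proof -
  \<comment> \<open>The square (a, b) of the grid stands for pairs of a point on edge
    \<open>a\<close> and a point on edge \<open>b\<close>. \<open>X\<close> lives on the grid lines
    where the first point is a vertex, \<open>Y\<close> on those where the second is, and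
    \<open>cell\<close> adds up the four sides of a square.\<close>
  define X where "X a b = (of_bool (left_of (P a) (P b) (P (Suc b))) :: nat)" for a b
  define Y where "Y b a = (of_bool (right_of (P b) (P a) (P (Suc a))) :: nat)" for b a
  define cell where "cell a b = (X a b + X (Suc a) b) + (Y b a + Y (Suc b) a)" for a b
  define W where "W b = wind 1 (P (b - 1), P b) (P b, P (Suc b))" for b
  define W0 where "W0 = wind 1 (P (k - 1), P 0) (P 0, P 1)"
  have low': "Im (P 0) \<le> Im (P i)" if "i \<le> k" for i
    using low[of i] closed that by (cases "i = 0"; cases "i = k") auto
  have ne_cyc: "Im (P i) \<noteq> Im (P j)" if "i \<le> k" "j \<le> k" "i \<noteq> j" "i = k \<longrightarrow> j \<noteq> 0" "j = k \<longrightarrow> i \<noteq> 0" for i j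
    using ne[of i j] ne[of 0 j] ne[of i 0] closed that by (cases "i = k"; cases "j = k") auto
  \<comment> \<open>Index 0 is the lowest vertex, so no edge goes below it; index \<open>k\<close>
    is the same vertex again.\<close>
  have zero: "X 0 b = 0" "Y k b = 0" if "b < k" for b
    using low'[of b] low'[of "Suc b"] that closed
    by (auto simp: X_def Y_def left_of_def right_of_def crosses_def)
  have ends: "X b b = 0" "Y (Suc b) b = 0" "X (Suc b) b = 0" "Y b b = 0" for b
    by (auto simp: X_def Y_def)
  \<comment> \<open>Over the triangle a < b every inner side is counted twice. The sides left over
    lie at vertex 0, at vertex \<open>k\<close> or on the diagonal, where \<open>zero\<close> and
    \<open>ends\<close> apply.\<close>
  have total: "even (\<Sum>b<k. \<Sum>a<b. cell a b)"
  proof -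
    have 1: "even (\<Sum>b<k. \<Sum>a<b. X a b + X (Suc a) b)"
    proof (rule dvd_sum)
      fix b assume "b \<in> {..<k}"
      then show "even (\<Sum>a<b. X a b + X (Suc a) b)"
        using even_telescope[of 0 b "\<lambda>a. X a b"] zero ends by (simp add: atLeast0LessThan)
    qed
    have "(\<Sum>b<k. \<Sum>a<b. Y b a + Y (Suc b) a) = (\<Sum>a<k. \<Sum>b\<in>{Suc a..<k}. Y b a + Y (Suc b) a)"
      by (subst sum.Sigma, simp, simp)+
         (rule sum.reindex_bij_witness[of _ "\<lambda>(a, b). (b, a)" "\<lambda>(a, b). (b, a)"]; auto)
    moreover have "even (\<Sum>a<k. \<Sum>b\<in>{Suc a..<k}. Y b a + Y (Suc b) a)"
    proof (rule dvd_sum)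
      fix a assume "a \<in> {..<k}"
      then show "even (\<Sum>b\<in>{Suc a..<k}. Y b a + Y (Suc b) a)"
        using even_telescope[of "Suc a" k "\<lambda>b. Y b a"] zero ends by simp
    qed
    ultimately show ?thesis using 1 by (simp add: cell_def sum.distrib)
  qed
  have adj: "odd (cell (b - 1) b) \<longleftrightarrow> odd (W b)" if b: "1 \<le> b" "b < k" for b
  proof -
    have ne': "Im (P (b - 1)) \<noteq> Im (P b)" "Im (P b) \<noteq> Im (P (Suc b))" "Im (P (b - 1)) \<noteq> Im (P (Suc b))"
      by (rule ne_cyc; use b k in auto)+
    show ?thesis using corner_cell[OF ne'] b by (simp add: cell_def W_def X_def Y_def)
  qed
  have far: "even (cell a b)" if ab: "Suc a < b" "b < k" "\<not> (a = 0 \<and> b = k - 1)" for a b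
  proof -
    have ne': "Im (P a) \<noteq> Im (P (Suc a))" "Im (P b) \<noteq> Im (P (Suc b))" "Im (P a) \<noteq> Im (P b)"
      "Im (P a) \<noteq> Im (P (Suc b))" "Im (P (Suc a)) \<noteq> Im (P b)" "Im (P (Suc a)) \<noteq> Im (P (Suc b))"
      by (rule ne_cyc; use ab in auto)+
    show ?thesis using disjoint_cell[OF ne' disj[OF ab]] by (simp add: cell_def X_def Y_def ac_simps)
  qed
  have bot: "odd (cell 0 (k - 1)) \<longleftrightarrow> even W0"
  proof -
    have "Suc (k - 1) = k" using k by simp
    moreover have "Im (P (k - 1)) \<noteq> Im (P 1)" by (rule ne) (use k in auto)
    ultimately show ?thesis using bottom_cell[of "P 0" "P (k - 1)" "P 1"] low[of 1] low[of "k - 1"] k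
      bottom closed zero[of 0] zero[of "k - 1"]
      by (simp add: cell_def X_def Y_def W0_def)
  qed
  \<comment> \<open>Column \<open>b\<close> consists of the corner cell (b - 1, b) and cells of
    disjoint edges; only the last column also contains the cell of the two edges at the lowest
    vertex. Since \<open>k\<close> is at least 3, these two special cells are distinct.\<close>
  have col: "odd (\<Sum>a<b. cell a b) \<longleftrightarrow> odd (W b + of_bool (b = k - 1 \<and> even W0))" if b: "b \<in> {1..<k}" for b
  proof -
    obtain c where c: "b = Suc c" using b by (cases b) auto
    have "(\<Sum>a<b. cell a b) = (\<Sum>a<c. cell a b) + cell c b" by (simp add: c)
    moreover have "odd (\<Sum>a<c. cell a b) \<longleftrightarrow> b = k - 1 \<and> even W0"
    proof (cases "b = k - 1")
      case False
      then have "even (\<Sum>a<c. cell a b)" using b c by (intro dvd_sum far) auto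
      with False show ?thesis by simp
    next
      case True
      obtain d where d: "c = Suc d" using True c k by (cases c) auto
      have "(\<Sum>a<c. cell a b) = cell 0 b + (\<Sum>a<d. cell (Suc a) b)"
        unfolding d by (rule sum.lessThan_Suc_shift)
      moreover have "even (\<Sum>a<d. cell (Suc a) b)" using b c d by (intro dvd_sum far) auto
      ultimately show ?thesis using bot True by simp
    qed
    ultimately show ?thesis using adj[of b] b c by auto
  qed
  have par: "odd (\<Sum>b\<in>B. \<Sum>a<b. cell a b) \<longleftrightarrow> odd (\<Sum>b\<in>B. W b + of_bool (b = k - 1 \<and> even W0))"
    if "B \<subseteq> {1..<k}" "finite B" for B
    using that(2,1) by (induction B rule: finite_induct) (use col in auto)
  have "(\<Sum>b<k. \<Sum>a<b. cell a b) = (\<Sum>b\<in>{1..<k}. \<Sum>a<b. cell a b)"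
    by (rule sum.mono_neutral_right) (use k in \<open>auto simp: Suc_le_eq\<close>)
  with total par[of "{1..<k}"] have "even (\<Sum>b\<in>{1..<k}. W b + of_bool (b = k - 1 \<and> even W0))"
    by auto
  moreover have "(\<Sum>b\<in>{1..<k}. W b + of_bool (b = k - 1 \<and> even W0)) = (\<Sum>b\<in>{1..<k}. W b) + of_bool (even W0)"
  proof -
    have "(\<Sum>b\<in>{1..<k}. of_bool (b = k - 1 \<and> even W0)) = (\<Sum>b\<in>{1..<k}. if b = k - 1 then of_bool (even W0) else (0::int))"
      by (intro sum.cong) auto
    also have "\<dots> = of_bool (even W0)" using k by (subst sum.delta) auto
    finally show ?thesis by (simp only: sum.distrib)
  qed
  ultimately have "even ((\<Sum>b\<in>{1..<k}. W b) + of_bool (even W0))" by simp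
  then show ?thesis unfolding W_def W0_def by auto
qed

section \<open>Simple polygons and an arbitrary direction\<close>

lemma det2_scale: "det2 (cnj l * a) (cnj l * b) = (cmod l)\<^sup>2 * det2 a b"
  unfolding cmod_power2 by (simp add: det2_def power2_eq_square) (simp add: algebra_simps)

lemma Im_cnj_mult: "Im (cnj l * a) = det2 l a"
  by (simp add: det2_def)

lemma det2_skew: "det2 a b = - det2 b a"
  by (simp add: det2_def)

text \<open>Multiplication by \<open>cnj l\<close> turns \<open>l\<close> into a positive real
  number and multiplies every \<open>det2\<close> by the square of its length, so all signs are kept
  and \<open>det2 l\<close> becomes the height.\<close>

lemma wind_rotate:
  assumes "l \<noteq> 0"
  shows "wind l (A, B) (C, D) = wind 1 (cnj l * A, cnj l * B) (cnj l * C, cnj l * D)"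
proof -
  have "s_index (cnj l * a) (cnj l * b) = s_index a b" for a b
    using assms by (simp add: s_index_def det2_scale zero_less_mult_iff)
  moreover have "det2 1 (cnj l * a) = det2 l a" for a
    by (simp add: det2_def)
  then have "s_index 1 (cnj l * a) = s_index l a" "s_index (cnj l * a) 1 = s_index a l" for a
    by (simp_all add: s_index_def det2_skew[of _ 1] det2_skew[of _ l])
  ultimately show ?thesis
    by (simp add: wind_def evec_def flip: right_diff_distrib)
qed

lemma det2_zero_parallel:
  assumes "det2 x y = 0" "Im x \<noteq> 0"
  shows "y = (Im y / Im x) *\<^sub>R x"
  using assms unfolding complex_eq_iff det2_def by (simp add: field_simps)

text \<open>If the second edge ran back along the first, the shorter one would have its far end on
  the longer one: \<open>D\<close> on the segment from \<open>B\<close> to \<open>A\<close>, or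
  \<open>A\<close> on the segment from \<open>B\<close> to \<open>D\<close>.\<close>

lemma no_fold:
  fixes A B D :: complex
  assumes "closed_segment A B \<inter> closed_segment B D \<subseteq> {B}" "A \<noteq> B" "B \<noteq> D" "0 < t"
  shows "D - B \<noteq> t *\<^sub>R (A - B)"
proof
  assume eq: "D - B = t *\<^sub>R (A - B)"
  show False
  proof (cases "t \<le> 1")
    case True
    have "D = (1 - t) *\<^sub>R B + t *\<^sub>R A" using eq by (simp add: algebra_simps)
    then have "D \<in> closed_segment B A" using True \<open>0 < t\<close> unfolding in_segment by (intro exI[of _ t]) simp
    then show False using assms by (auto simp: closed_segment_commute)
  next
    case False
    have "A = (1 - inverse t) *\<^sub>R B + inverse t *\<^sub>R D"
    proof -
      have "inverse t *\<^sub>R (D - B) = A - B" using eq \<open>0 < t\<close> by simp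
      then show ?thesis by (simp add: algebra_simps)
    qed
    moreover have "inverse t \<le> 1" "0 \<le> inverse t" using False by (simp_all add: field_simps)
    ultimately have "A \<in> closed_segment B D" unfolding in_segment by (intro exI[of _ "inverse t"]) simp
    then show False using assms by auto
  qed
qed

lemma sum_periodic:
  fixes f :: "nat \<Rightarrow> 'a::cancel_comm_monoid_add"
  assumes "\<And>i. f (i + k) = f i"
  shows "(\<Sum>i<k. f (a + i)) = (\<Sum>i<k. f i)"
proof (induction a)
  case (Suc a)
  have "f a + (\<Sum>i<k. f (Suc a + i)) = (\<Sum>i<Suc k. f (a + i))"
    by (subst sum.lessThan_Suc_shift) simp
  also have "\<dots> = f a + (\<Sum>i<k. f (a + i))" using assms[of a] by (simp add: add.commute)
  finally show ?case using Suc by simp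
qed simp

text \<open>A periodic sequence on all naturals makes it possible to restart the numbering at any
  vertex and to speak of the next edge without a special case at the seam.\<close>

locale simple_polygon =
  fixes v :: "nat \<Rightarrow> complex" and k :: nat
  assumes k: "3 \<le> k"
    and periodic: "v (i + k) = v i"
    and inj: "inj_on v {..<k}"
    and simple: "\<And>a b. a < k \<Longrightarrow> b < k \<Longrightarrow> a \<noteq> b \<Longrightarrow>
      closed_segment (v a) (v (Suc a)) \<inter> closed_segment (v b) (v (Suc b))
        \<subseteq> {v a, v (Suc a)} \<inter> {v b, v (Suc b)}"
begin

lemma periodic_mod: "v i = v (i mod k)"
proof -
  have "v (j + n * k) = v j" for j n
    using periodic by (induction n) (simp_all add: add.assoc[symmetric] add.commute[of k])
  from this[of "i mod k" "i div k"] show ?thesis by simp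
qed

lemma v_eq_iff: "v i = v j \<longleftrightarrow> i mod k = j mod k"
  using inj k periodic_mod[of i] periodic_mod[of j] by (auto dest: inj_onD)

lemma simple_mod:
  assumes "a mod k \<noteq> b mod k"
  shows "closed_segment (v a) (v (Suc a)) \<inter> closed_segment (v b) (v (Suc b))
        \<subseteq> {v a, v (Suc a)} \<inter> {v b, v (Suc b)}"
proof -
  have "v (Suc (i mod k)) = v (Suc i)" for i by (simp add: v_eq_iff mod_Suc_eq)
  moreover have "v (i mod k) = v i" for i using periodic_mod[of i] by simp
  ultimately show ?thesis using simple[of "a mod k" "b mod k"] assms k by simp
qed

lemma Suc_mod_neq: "Suc i mod k \<noteq> i mod k" "Suc (Suc i) mod k \<noteq> i mod k"
  using k by (auto simp: mod_Suc)

lemma consecutive: "closed_segment (v i) (v (Suc i)) \<inter> closed_segment (v (Suc i)) (v (Suc (Suc i))) \<subseteq> {v (Suc i)}"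
  using simple_mod[of i "Suc i"] Suc_mod_neq[of i] Suc_mod_neq(1)[of "Suc i"] by (auto simp: v_eq_iff)

lemma odd_wind_generic_direction:
  assumes l: "l \<noteq> 0" and gen: "\<And>i j. i < k \<Longrightarrow> j < k \<Longrightarrow> i \<noteq> j \<Longrightarrow> det2 l (v i) \<noteq> det2 l (v j)"
  shows "odd (\<Sum>i<k. wind l (v i, v (Suc i)) (v (Suc i), v (Suc (Suc i))))"
proof -
  \<comment> \<open>The numbering is shifted to a vertex of least height, since
    \<open>odd_wind_polygon_generic\<close> has the lowest vertex at index 0.\<close>
  define a where "a = (ARG_MIN (\<lambda>i. det2 l (v i)) i. i \<in> {..<k})"
  have a: "a < k" "\<And>i. i < k \<Longrightarrow> det2 l (v a) \<le> det2 l (v i)"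
    using k ex_is_arg_min_if_finite[of "{..<k}" "\<lambda>i. det2 l (v i)"]
      arg_min_if_finite[of "{..<k}" "\<lambda>i. det2 l (v i)"]
    unfolding a_def arg_min_on_def[symmetric] by force+
  define P where "P i = cnj l * v (a + i)" for i
  have h: "Im (P i) = det2 l (v (a + i))" for i by (simp only: P_def Im_cnj_mult)
  have mod: "(a + i) mod k = (if a + i < k then a + i else a + i - k)" if "i < k" for i
    using a that by (simp add: mod_if)
  have modne: "(a + i) mod k \<noteq> (a + j) mod k" if "i < k" "j < k" "i \<noteq> j" for i j
    using that a by (auto simp: mod)
  have gen': "Im (P i) \<noteq> Im (P j)" if "i < k" "j < k" "i \<noteq> j" for i j
    using gen[of "(a + i) mod k" "(a + j) mod k"] modne[OF that] k
    by (simp add: h periodic_mod[symmetric])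
  have Pk: "P k = P 0" using periodic[of a] by (simp add: P_def)
  have low: "Im (P 0) < Im (P i)" if "0 < i" "i < k" for i
    using gen'[of 0 i] that a(2)[of "(a + i) mod k"] k by (simp add: h periodic_mod[symmetric])
  have seg: "closed_segment (P i) (P (Suc i)) = (\<lambda>x. cnj l * x) ` closed_segment (v (a + i)) (v (Suc (a + i)))" for i
    unfolding P_def using closed_segment_linear_image[OF bounded_linear.linear[OF bounded_linear_mult_right, of "cnj l"]]
    by (simp add: add.commute)
  have inj_mult: "inj (\<lambda>x. cnj l * x)" using l by (auto simp: inj_def)
  have disj: "closed_segment (P i) (P (Suc i)) \<inter> closed_segment (P j) (P (Suc j)) = {}"
    if ij: "Suc i < j" "j < k" "\<not> (i = 0 \<and> j = k - 1)" for i j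
  proof -
    have "v (a + i) \<noteq> v (a + j)" "v (a + i) \<noteq> v (Suc (a + j))" "v (Suc (a + i)) \<noteq> v (a + j)"
      "v (Suc (a + i)) \<noteq> v (Suc (a + j))"
    proof -
      have 1: "P (Suc j) = P (if Suc j = k then 0 else Suc j)" using Pk by simp
      have "P i \<noteq> P j" "P (Suc i) \<noteq> P j" using gen'[of i j] gen'[of "Suc i" j] ij by auto
      moreover have "P i \<noteq> P (Suc j)" "P (Suc i) \<noteq> P (Suc j)"
        unfolding 1 using gen'[of i 0] gen'[of i "Suc j"] gen'[of "Suc i" 0] gen'[of "Suc i" "Suc j"] ij by auto
      ultimately show "v (a + i) \<noteq> v (a + j)" "v (a + i) \<noteq> v (Suc (a + j))" "v (Suc (a + i)) \<noteq> v (a + j)"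
        "v (Suc (a + i)) \<noteq> v (Suc (a + j))" by (auto simp: P_def)
    qed
    then have "closed_segment (v (a + i)) (v (Suc (a + i))) \<inter> closed_segment (v (a + j)) (v (Suc (a + j))) = {}"
      using simple_mod[OF modne[of i j]] ij by auto
    then show ?thesis unfolding seg image_Int[OF inj_mult, symmetric] by simp
  qed
  \<comment> \<open>Both edges at the lowest vertex go upwards from it; if they were parallel they
    would overlap, against \<open>no_fold\<close>.\<close>
  have bottom: "det2 (P 0 - P (k - 1)) (P 1 - P 0) \<noteq> 0"
  proof
    assume d: "det2 (P 0 - P (k - 1)) (P 1 - P 0) = 0"
    have h1: "0 < Im (P (k - 1) - P 0)" "0 < Im (P 1 - P 0)" using low[of "k - 1"] low[of 1] k by auto
    define t where "t = Im (P 1 - P 0) / Im (P (k - 1) - P 0)"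
    have "P 1 - P 0 = t *\<^sub>R (P (k - 1) - P 0)"
      unfolding t_def
    proof (rule det2_zero_parallel)
      show "det2 (P (k - 1) - P 0) (P 1 - P 0) = 0" using d by (simp add: det2_def algebra_simps)
    qed (use h1 in simp)
    then have "cnj l * (v (a + 1) - v a) = cnj l * (t *\<^sub>R (v (a + (k - 1)) - v a))"
      by (simp only: P_def right_diff_distrib mult_scaleR_right add_0_right)
    then have "v (Suc a) - v a = t *\<^sub>R (v (a + (k - 1)) - v a)"
      using l mult_left_cancel[of "cnj l"] by (simp del: mult_scaleR_right)
    moreover have "v (Suc (a + (k - 1))) = v a" "v (Suc (Suc (a + (k - 1)))) = v (Suc a)"
      using periodic[of a] periodic[of "Suc a"] k by (simp_all add: add.commute)
    moreover have "0 < t" using h1 by (simp add: t_def)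
    moreover have "v (a + (k - 1)) \<noteq> v a" "v a \<noteq> v (Suc a)" using h1 by (auto simp: P_def)
    ultimately show False
      using no_fold[of "v (a + (k - 1))" "v a" "v (Suc a)" t] consecutive[of "a + (k - 1)"] by simp
  qed
  define f where "f i = wind l (v i, v (Suc i)) (v (Suc i), v (Suc (Suc i)))" for i
  have f: "wind 1 (P i, P (Suc i)) (P (Suc i), P (Suc (Suc i))) = f (a + i)" for i
    using wind_rotate[OF l] by (simp add: P_def f_def)
  have "odd (wind 1 (P (k - 1), P 0) (P 0, P 1) + (\<Sum>b\<in>{1..<k}. wind 1 (P (b - 1), P b) (P b, P (Suc b))))"
    by (rule odd_wind_polygon_generic[OF k Pk gen' low disj bottom])
  also have "(\<Sum>b\<in>{1..<k}. wind 1 (P (b - 1), P b) (P b, P (Suc b))) = (\<Sum>b<k - 1. f (a + b))"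
  proof (rule sum.reindex_bij_witness[of _ Suc "\<lambda>b. b - 1"])
    fix b assume b: "b \<in> {1..<k}"
    then show "f (a + (b - 1)) = wind 1 (P (b - 1), P b) (P b, P (Suc b))"
      using f[of "b - 1"] by simp
  qed auto
  also have "wind 1 (P (k - 1), P 0) (P 0, P 1) = f (a + (k - 1))"
  proof -
    have "P (Suc (k - 1)) = P 0" "P (Suc (Suc (k - 1))) = P 1"
      using Pk periodic[of "Suc a"] k by (simp_all add: P_def add.commute)
    then show ?thesis by (simp flip: f)
  qed
  also have "f (a + (k - 1)) + (\<Sum>b<k - 1. f (a + b)) = (\<Sum>b<k. f (a + b))"
    using k sum.lessThan_Suc[of "\<lambda>b. f (a + b)" "k - 1"] by simp
  also have "\<dots> = (\<Sum>b<k. f b)"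
  proof (rule sum_periodic)
    show "f (i + k) = f i" for i
      using periodic[of i] periodic[of "Suc i"] periodic[of "Suc (Suc i)"] by (simp add: f_def)
  qed
  finally show ?thesis by (simp add: f_def)
qed

lemma odd_wind:
  assumes l: "l \<noteq> 0" and np: "\<And>i. det2 l (v (Suc i) - v i) \<noteq> 0"
  shows "odd (\<Sum>i<k. wind l (v i, v (Suc i)) (v (Suc i), v (Suc (Suc i))))"
proof -
  \<comment> \<open>tilt \<open>l\<close> slightly to make all heights distinct; the winding only sees the edges, which are not parallel to \<open>l\<close>\<close>
  define m where "m \<delta> = l + of_real \<delta> * (\<i> * l)" for \<delta>
  have m: "det2 (m \<delta>) u = det2 l u + \<delta> * det2 (\<i> * l) u" for \<delta> u
    by (simp add: m_def det2_def algebra_simps)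
  have "\<forall>\<^sub>F \<delta> in at_right 0. det2 (m \<delta>) u \<noteq> 0 \<and> (det2 l u \<noteq> 0 \<longrightarrow> s_index (m \<delta>) u = s_index l u)"
    if u: "u \<noteq> 0" for u
  proof -
    have lim: "((\<lambda>\<delta>. det2 (m \<delta>) u) \<longlongrightarrow> det2 l u) (at_right 0)"
      unfolding m by (rule tendsto_eq_intros | simp)+
    consider "det2 l u > 0" | "det2 l u < 0" | "det2 l u = 0" by linarith
    then show ?thesis
    proof cases
      case 1
      from order_tendstoD(1)[OF lim 1] show ?thesis
        by eventually_elim (use 1 in \<open>simp add: s_index_def\<close>)
    next
      case 2
      from order_tendstoD(2)[OF lim 2] show ?thesis
        by eventually_elim (use 2 in \<open>simp add: s_index_def\<close>)
    next
      case 3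
      \<comment> \<open>Otherwise \<open>u\<close> would be parallel both to \<open>l\<close> and to
        its perpendicular; Lagrange's identity for the dot product and the determinant then makes
        \<open>l\<close> or \<open>u\<close> vanish.\<close>
      have "det2 (\<i> * l) u \<noteq> 0"
      proof
        assume "det2 (\<i> * l) u = 0"
        then have 1: "Im l * Im u + Re l * Re u = 0" by (simp add: det2_def)
        have 2: "Re l * Im u - Im l * Re u = 0" using 3 by (simp add: det2_def)
        have "(Im l * Im u + Re l * Re u)\<^sup>2 + (Re l * Im u - Im l * Re u)\<^sup>2 = (cmod l)\<^sup>2 * (cmod u)\<^sup>2"
          unfolding cmod_power2 by (simp add: power2_eq_square algebra_simps)
        then show False using 1 2 l u by simp
      qed
      then show ?thesis
        using 3 eventually_at_right_less[of "0::real"] by (auto simp: m elim!: eventually_mono)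
    qed
  qed
  then have "\<forall>\<^sub>F \<delta> in at_right 0. \<forall>u\<in>(\<lambda>(i, j). v i - v j) ` ({..<k + 2} \<times> {..<k + 2}) - {0}.
      det2 (m \<delta>) u \<noteq> 0 \<and> (det2 l u \<noteq> 0 \<longrightarrow> s_index (m \<delta>) u = s_index l u)"
    by (intro eventually_ball_finite ballI) auto
  moreover have "\<forall>\<^sub>F \<delta> in at_right 0. m \<delta> \<noteq> 0"
  proof -
    have "(m \<longlongrightarrow> l) (at_right 0)" unfolding m_def by (rule tendsto_eq_intros | simp)+
    then show ?thesis using l by (rule tendsto_imp_eventually_ne)
  qed
  ultimately have ev: "\<forall>\<^sub>F \<delta> in at_right 0. m \<delta> \<noteq> 0 \<and>
      (\<forall>u\<in>(\<lambda>(i, j). v i - v j) ` ({..<k + 2} \<times> {..<k + 2}) - {0}.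
      det2 (m \<delta>) u \<noteq> 0 \<and> (det2 l u \<noteq> 0 \<longrightarrow> s_index (m \<delta>) u = s_index l u))"
    by eventually_elim blast
  \<comment> \<open>Only finitely many differences are involved, so one tilt serves them all.
    Indices go up to \<open>k + 1\<close> because the last turn, at \<open>v k\<close>, looks at
    \<open>v (k + 1)\<close>.\<close>
  obtain \<delta> where \<delta>: "m \<delta> \<noteq> 0" "\<forall>u\<in>(\<lambda>(i, j). v i - v j) ` ({..<k + 2} \<times> {..<k + 2}) - {0}.
      det2 (m \<delta>) u \<noteq> 0 \<and> (det2 l u \<noteq> 0 \<longrightarrow> s_index (m \<delta>) u = s_index l u)"
    using eventually_happens'[OF trivial_limit_at_right_real ev] by blast
  define l' where "l' = m \<delta>"
  have l'0: "l' \<noteq> 0" using \<delta>(1) by (simp add: l'_def)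
  have l': "det2 l' (v i - v j) \<noteq> 0" "det2 l (v i - v j) \<noteq> 0 \<Longrightarrow> s_index l' (v i - v j) = s_index l (v i - v j)"
    if "i < k + 2" "j < k + 2" "v i \<noteq> v j" for i j
  proof -
    have "v i - v j \<in> (\<lambda>(i, j). v i - v j) ` ({..<k + 2} \<times> {..<k + 2}) - {0}" using that by force
    with \<delta>(2) show "det2 l' (v i - v j) \<noteq> 0"
      "det2 l (v i - v j) \<noteq> 0 \<Longrightarrow> s_index l' (v i - v j) = s_index l (v i - v j)"
      unfolding l'_def by blast+
  qed
  have "odd (\<Sum>i<k. wind l' (v i, v (Suc i)) (v (Suc i), v (Suc (Suc i))))"
  proof (rule odd_wind_generic_direction[OF l'0])
    fix i j assume "i < k" "j < k" "i \<noteq> j"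
    then show "det2 l' (v i) \<noteq> det2 l' (v j)"
      using l'(1)[of i j] v_eq_iff[of i j] by (auto simp: det2_def algebra_simps)
  qed
  also have "(\<Sum>i<k. wind l' (v i, v (Suc i)) (v (Suc i), v (Suc (Suc i)))) =
      (\<Sum>i<k. wind l (v i, v (Suc i)) (v (Suc i), v (Suc (Suc i))))"
  proof (rule sum.cong)
    fix i assume i: "i \<in> {..<k}"
    have skew: "s_index x y = - s_index y x" for x y
      using det2_skew[of x y] by (simp add: s_index_def)
    have ne: "v (Suc j) \<noteq> v j" for j using np[of j] by (auto simp: det2_def)
    have "s_index l' (v (Suc j) - v j) = s_index l (v (Suc j) - v j)" if "j < k + 1" for j
      using l'(2)[of "Suc j" j] np[of j] ne[of j] that by simp
    from this[of i] this[of "Suc i"] i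
    show "wind l' (v i, v (Suc i)) (v (Suc i), v (Suc (Suc i))) = wind l (v i, v (Suc i)) (v (Suc i), v (Suc (Suc i)))"
      by (simp add: wind_def evec_def skew[of _ l] skew[of _ l'])
  qed simp
  finally show ?thesis .
qed

end

section \<open>Determinants and rational power series\<close>

lemma sign_cycle_of_list: "distinct cs \<Longrightarrow> sign (cycle_of_list cs) = (-1) ^ (length cs - 1)"
proof (induction cs rule: cycle_of_list.induct)
  case (1 i j cs)
  then show ?case
    using sign_compose[OF permutation_swap_id[of i j] permutation_of_cycle[of "j # cs"]]
    by (auto simp: sign_swap_id simp del: o_apply)
qed auto

lemma cycle_of_list_nth:
  assumes "distinct cs" "i < length cs"
  shows "cycle_of_list cs (cs ! i) = cs ! (Suc i mod length cs)"
proof -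
  have "map (cycle_of_list cs) cs = rotate1 cs"
    using cyclic_rotation[OF assms(1), of 1] by simp
  then have "cycle_of_list cs (cs ! i) = rotate1 cs ! i"
    using assms(2) by (metis nth_map)
  then show ?thesis using assms(2) by (simp add: nth_rotate1)
qed

lemma cycle_decomp_permutes: "cycle_decomp I p \<Longrightarrow> finite I \<and> p permutes I"
proof (induction rule: cycle_decomp.induct)
  case (comp I p cs)
  then show ?case
    using permutes_compose[OF permutes_subset[of p I "set cs \<union> I"] permutes_subset[OF cycle_permutes[of cs], of "set cs \<union> I"]]
    by (auto simp del: o_apply simp: comp_def)
qed (simp add: permutes_def)

text \<open>The product splits along the cycle decomposition, in which fixed points appear as cycles
  of length one. A longer cycle meets only off-diagonal entries and contributes minus the product of
  \<open>T\<close> along it; a fixed point contributes \<open>1 - T x x\<close>.\<close>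

lemma sign_prod_nonneg_of_cycle_decomp:
  fixes T :: "'a \<Rightarrow> 'a \<Rightarrow> real"
  assumes "cycle_decomp S p"
    and cyc: "\<And>cs. distinct cs \<Longrightarrow> cs \<noteq> [] \<Longrightarrow> set cs \<subseteq> V \<Longrightarrow>
      (\<Prod>i<length cs. T (cs ! i) (cs ! (Suc i mod length cs))) \<le> 0"
    and "S \<subseteq> V"
  shows "0 \<le> of_int (sign p) * (\<Prod>i\<in>S. of_bool (i = p i) - T i (p i))"
  using assms(1,3)
proof (induction rule: cycle_decomp.induct)
  case (comp I p cs)
  let ?A = "\<lambda>i j. of_bool (i = j) - T i j"
  let ?n = "length cs"
  have cd: "p permutes I" and fin: "finite I" using cycle_decomp_permutes[OF comp.hyps(1)] by auto
  have pc: "p x = x" if "x \<in> set cs" for x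
    using cd that comp.hyps(3) by (auto simp: permutes_def)
  have cI: "cycle_of_list cs (p x) = p x" if "x \<in> I" for x
    using id_outside_supp[of "p x" cs] permutes_in_image[OF cd, of x] that comp.hyps(3) by auto
  have split: "(\<Prod>i\<in>set cs \<union> I. ?A i ((cycle_of_list cs \<circ> p) i)) =
      (\<Prod>i\<in>set cs. ?A i (cycle_of_list cs i)) * (\<Prod>i\<in>I. ?A i (p i))"
    using fin comp.hyps(3) by (subst prod.union_disjoint) (auto simp: pc cI)
  have sgn: "sign (cycle_of_list cs \<circ> p) = sign (cycle_of_list cs) * sign p"
    using permutation_of_cycle cd fin by (intro sign_compose) (auto intro: permutation_permutes[THEN iffD2])
  have cyc_part: "0 \<le> of_int (sign (cycle_of_list cs)) * (\<Prod>i\<in>set cs. ?A i (cycle_of_list cs i))"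
  proof -
    consider "cs = []" | x where "cs = [x]" | "2 \<le> ?n"
      by (cases cs rule: remdups_adj.cases) auto
    then show ?thesis
    proof cases
      case (2 x)
      then show ?thesis using cyc[of cs] comp by simp
    next
      case 3
      have "(\<Prod>i\<in>set cs. ?A i (cycle_of_list cs i)) = (\<Prod>i<?n. ?A (cs ! i) (cycle_of_list cs (cs ! i)))"
        using prod.reindex_bij_betw[OF bij_betw_nth[OF comp.hyps(2) refl refl], of "\<lambda>i. ?A i (cycle_of_list cs i)"] by simp
      also have "\<dots> = (\<Prod>i<?n. - T (cs ! i) (cs ! (Suc i mod ?n)))"
      proof (rule prod.cong)
        fix i assume i: "i \<in> {..<?n}"
        have "cs ! i \<noteq> cs ! (Suc i mod ?n)"
          using i 3 comp.hyps(2) by (subst nth_eq_iff_index_eq) (auto simp: mod_Suc)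
        then show "?A (cs ! i) (cycle_of_list cs (cs ! i)) = - T (cs ! i) (cs ! (Suc i mod ?n))"
          using cycle_of_list_nth[OF comp.hyps(2), of i] i by simp
      qed simp
      also have "\<dots> = (-1) ^ ?n * (\<Prod>i<?n. T (cs ! i) (cs ! (Suc i mod ?n)))"
        by (simp add: prod_uminus)
      finally have eq: "(\<Prod>i\<in>set cs. ?A i (cycle_of_list cs i)) = (-1) ^ ?n * (\<Prod>i<?n. T (cs ! i) (cs ! (Suc i mod ?n)))" .
      obtain n' where n': "?n = Suc n'" using 3 by (cases ?n) auto
      have "of_int (sign (cycle_of_list cs)) * (\<Prod>i\<in>set cs. ?A i (cycle_of_list cs i)) =
          ((-1) ^ n' * (-1) ^ n') * - (\<Prod>i<?n. T (cs ! i) (cs ! (Suc i mod ?n)))"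
        unfolding eq sign_cycle_of_list[OF comp.hyps(2)] by (simp add: n')
      also have "\<dots> = - (\<Prod>i<?n. T (cs ! i) (cs ! (Suc i mod ?n)))"
        by (simp flip: power_mult_distrib)
      finally have eq2: "of_int (sign (cycle_of_list cs)) * (\<Prod>i\<in>set cs. ?A i (cycle_of_list cs i)) =
        - (\<Prod>i<?n. T (cs ! i) (cs ! (Suc i mod ?n)))" .
      have "(\<Prod>i<?n. T (cs ! i) (cs ! (Suc i mod ?n))) \<le> 0"
        by (rule cyc) (use comp 3 in auto)
      then show ?thesis unfolding eq2 by linarith
    qed simp
  qed
  have "0 \<le> (of_int (sign (cycle_of_list cs)) * (\<Prod>i\<in>set cs. ?A i (cycle_of_list cs i))) *
      (of_int (sign p) * (\<Prod>i\<in>I. ?A i (p i)))"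
    by (rule mult_nonneg_nonneg[OF cyc_part comp.IH]) (use comp.prems in auto)
  then show ?case unfolding split sgn by (simp add: ac_simps)
qed simp

lemma det_one_minus_pos:
  fixes T :: "nat \<Rightarrow> nat \<Rightarrow> real"
  assumes cyc: "\<And>cs. distinct cs \<Longrightarrow> cs \<noteq> [] \<Longrightarrow> set cs \<subseteq> {..<n} \<Longrightarrow>
      (\<Prod>i<length cs. T (cs ! i) (cs ! (Suc i mod length cs))) \<le> 0"
  shows "0 < Determinant.det (Matrix.mat n n (\<lambda>(i, j). of_bool (i = j) - T i j))"
proof -
  let ?t = "\<lambda>p. of_int (sign p) * (\<Prod>i = 0..<n. of_bool (i = p i) - T i (p i))"
  have eq: "Determinant.det (Matrix.mat n n (\<lambda>(i, j). of_bool (i = j) - T i j)) = (\<Sum>p | p permutes {0..<n}. ?t p)"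
    by (subst det_def'[of _ n]) (auto intro!: sum.cong prod.cong simp: permutes_in_image[of _ "{0..<n}", simplified])
  have nonneg: "0 \<le> ?t p" if "p permutes {0..<n}" for p
    using sign_prod_nonneg_of_cycle_decomp[OF cycle_decomposition[OF that], of "{..<n}" T] cyc atLeast0LessThan by blast
  have diag: "T x x \<le> 0" if "x < n" for x
    using cyc[of "[x]"] that by simp
  have "0 < ?t id"
  proof -
    have "0 < (\<Prod>i = 0..<n. of_bool (i = id i) - T i (id i))"
    proof (rule prod_pos)
      fix i assume "i \<in> {0..<n}"
      then show "0 < of_bool (i = id i) - T i (id i)" using diag[of i] by simp
    qed
    then show ?thesis by simp
  qed
  also have "?t id \<le> (\<Sum>p | p permutes {0..<n}. ?t p)"
    by (rule member_le_sum) (auto intro: nonneg permutes_id[unfolded id_def] finite_permutations)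
  finally show ?thesis unfolding eq .
qed

section \<open>Adjugate identities over a commutative ring\<close>

lemma adjugate_identities:
  fixes A :: "nat \<Rightarrow> nat \<Rightarrow> 'a :: comm_ring_1"
  obtains N where
    "\<And>i k. i < n \<Longrightarrow> k < n \<Longrightarrow> (\<Sum>j<n. N i j * A j k) = (if i = k then Determinant.det (Matrix.mat n n (\<lambda>(i, j). A i j)) else 0)"
    "\<And>i k. i < n \<Longrightarrow> k < n \<Longrightarrow> (\<Sum>j<n. A i j * N j k) = (if i = k then Determinant.det (Matrix.mat n n (\<lambda>(i, j). A i j)) else 0)"
proof -
  let ?A = "Matrix.mat n n (\<lambda>(i, j). A i j)"
  have A: "?A \<in> carrier_mat n n" by simp
  have c: "adj_mat ?A \<in> carrier_mat n n" using adj_mat(1)[OF A] .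
  define N where "N i j = adj_mat ?A $$ (i, j)" for i j
  have "(adj_mat ?A * ?A) $$ (i, k) = (\<Sum>j<n. N i j * A j k)"
    "(?A * adj_mat ?A) $$ (i, k) = (\<Sum>j<n. A i j * N j k)" if "i < n" "k < n" for i k
    using that c by (auto simp: N_def scalar_prod_def atLeast0LessThan intro!: sum.cong)
  note entries = this
  show thesis
  proof (rule that[of N])
    fix i k assume ik: "i < n" "k < n"
    show "(\<Sum>j<n. N i j * A j k) = (if i = k then Determinant.det ?A else 0)"
      using entries(1)[OF ik] ik unfolding adj_mat(3)[OF A] by (cases "i = k") auto
    show "(\<Sum>j<n. A i j * N j k) = (if i = k then Determinant.det ?A else 0)"
      using entries(2)[OF ik] ik unfolding adj_mat(2)[OF A] by (cases "i = k") auto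
  qed
qed

text \<open>The entries will be polynomials, hence the generality of a commutative ring. The left
  identity serves for uniqueness and for Cramer's rule on series, the right one for
  existence.\<close>

lemma adjugate_identities_on:
  fixes A :: "'b \<Rightarrow> 'b \<Rightarrow> 'a :: comm_ring_1"
  assumes h: "bij_betw h {..<n} S"
  obtains N where
    "\<And>i k. i \<in> S \<Longrightarrow> k \<in> S \<Longrightarrow> (\<Sum>j\<in>S. N i j * A j k) =
       (if i = k then Determinant.det (Matrix.mat n n (\<lambda>(i, j). A (h i) (h j))) else 0)"
    "\<And>i k. i \<in> S \<Longrightarrow> k \<in> S \<Longrightarrow> (\<Sum>j\<in>S. A i j * N j k) =
       (if i = k then Determinant.det (Matrix.mat n n (\<lambda>(i, j). A (h i) (h j))) else 0)"
proof -
  obtain N where N: "\<And>i k. i < n \<Longrightarrow> k < n \<Longrightarrow> (\<Sum>j<n. N i j * A (h j) (h k)) =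
       (if i = k then Determinant.det (Matrix.mat n n (\<lambda>(i, j). A (h i) (h j))) else 0)"
    "\<And>i k. i < n \<Longrightarrow> k < n \<Longrightarrow> (\<Sum>j<n. A (h i) (h j) * N j k) =
       (if i = k then Determinant.det (Matrix.mat n n (\<lambda>(i, j). A (h i) (h j))) else 0)"
    using adjugate_identities[of n "\<lambda>i j. A (h i) (h j)"] by blast
  define g where "g = inv_into {..<n} h"
  have g: "g (h j) = j" if "j < n" for j
    using h that by (simp add: g_def bij_betw_def)
  have hg: "h (g i) = i" "g i < n" if "i \<in> S" for i
    using h that bij_betw_inv_into_right[OF h that] inv_into_into[of i h "{..<n}"]
    by (auto simp: g_def bij_betw_def)
  have inj: "g i = g k \<longleftrightarrow> i = k" if "i \<in> S" "k \<in> S" for i k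
    using hg that by metis
  have sum: "(\<Sum>j\<in>S. f j) = (\<Sum>j<n. f (h j))" for f :: "'b \<Rightarrow> 'a"
    by (rule sum.reindex_bij_betw[OF h, symmetric])
  show thesis
  proof (rule that[of "\<lambda>i j. N (g i) (g j)"])
    fix i k assume ik: "i \<in> S" "k \<in> S"
    show "(\<Sum>j\<in>S. N (g i) (g j) * A j k) = (if i = k then Determinant.det (Matrix.mat n n (\<lambda>(i, j). A (h i) (h j))) else 0)"
      using N(1)[of "g i" "g k"] hg[OF ik(1)] hg[OF ik(2)] inj[OF ik] by (simp add: sum g)
    show "(\<Sum>j\<in>S. A i j * N (g j) (g k)) = (if i = k then Determinant.det (Matrix.mat n n (\<lambda>(i, j). A (h i) (h j))) else 0)"
      using N(2)[of "g i" "g k"] hg[OF ik(1)] hg[OF ik(2)] inj[OF ik] by (simp add: sum g)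
  qed
qed

section \<open>Polynomials with multisets as monomials\<close>

lemma finite_submultisets: "finite {a. a \<subseteq># (m :: 'a multiset)}"
proof -
  have "{a. a \<subseteq># m} \<subseteq> mset ` {xs. set xs \<subseteq> set_mset m \<and> length xs \<le> size m}"
  proof
    fix a assume "a \<in> {a. a \<subseteq># m}"
    moreover obtain xs where "mset xs = a" using ex_mset by blast
    ultimately show "a \<in> mset ` {xs. set xs \<subseteq> set_mset m \<and> length xs \<le> size m}"
      using size_mset_mono set_mset_mono by fastforce
  qed
  then show ?thesis
    by (rule finite_subset) (intro finite_imageI finite_lists_length_le finite_set_mset)
qed

lemma add_subseteq_mset_iff: "a + b \<subseteq># m \<longleftrightarrow> a \<subseteq># m \<and> b \<subseteq># m - a"
proof (cases "a \<subseteq># m")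
  case True
  then show ?thesis by (auto simp: mset_subset_eq_exists_conv)
next
  case False
  then show ?thesis using subset_mset.trans[OF mset_subset_eq_add_left] by blast
qed

lemma poly_mapping_monomial_induct [case_names zero add]:
  fixes P :: "'a \<Rightarrow>\<^sub>0 'b :: comm_monoid_add"
  assumes "\<Phi> 0" and "\<And>P a x. \<Phi> P \<Longrightarrow> \<Phi> (P + Poly_Mapping.single a x)"
  shows "\<Phi> P"
proof (induction P rule: update_induct)
  case (update f a b)
  have "Poly_Mapping.update a b f = f + Poly_Mapping.single a b"
    using update.hyps by (intro poly_mapping_eqI) (auto simp: lookup_update lookup_add lookup_single when_def in_keys_iff)
  then show ?case using assms(2)[OF update.IH] by simp
qed (rule assms(1))

subsection \<open>Evaluation of polynomials\<close>

lemma poly_value_superset: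
  assumes "finite S" "Poly_Mapping.keys P \<subseteq> S"
  shows "poly_value w P = (\<Sum>m\<in>S. Poly_Mapping.lookup P m * (\<Prod>e\<in>#m. w e))"
  unfolding poly_value_def using assms by (intro sum.mono_neutral_left) (auto simp: in_keys_iff)

lemma poly_value_add: "poly_value w (P + Q) = poly_value w P + poly_value w Q"
proof -
  let ?S = "Poly_Mapping.keys P \<union> Poly_Mapping.keys Q"
  have "poly_value w R = (\<Sum>m\<in>?S. Poly_Mapping.lookup R m * (\<Prod>e\<in>#m. w e))"
    if "R \<in> {P, Q, P + Q}" for R
    using that Poly_Mapping.keys_add[of P Q] by (intro poly_value_superset) auto
  then show ?thesis by (simp add: lookup_add distrib_right sum.distrib)
qed

lemma poly_value_zero: "poly_value w 0 = 0"
  by (simp add: poly_value_def)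

lemma poly_value_single: "poly_value w (Poly_Mapping.single a x) = x * (\<Prod>e\<in>#a. w e)"
  by (subst poly_value_superset[of "{a}"]) auto

lemma poly_value_single_mult:
  "poly_value w (Poly_Mapping.single a x * Q) = poly_value w (Poly_Mapping.single a x) * poly_value w Q"
  by (induction Q rule: poly_mapping_monomial_induct)
    (simp_all add: poly_value_zero distrib_left poly_value_add mult_single poly_value_single)

lemma poly_value_mult: "poly_value w (P * Q) = poly_value w P * poly_value w Q"
  by (induction P rule: poly_mapping_monomial_induct)
    (simp_all add: poly_value_zero distrib_right poly_value_add poly_value_single_mult)

lemma poly_value_one: "poly_value w 1 = 1"
  unfolding single_one[symmetric] by (simp only: poly_value_single) simp

lemma poly_value_hom: "comm_ring_hom (poly_value w)"
  by unfold_locales (simp_all add: poly_value_zero poly_value_one poly_value_add poly_value_mult)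

subsection \<open>Multiplication of a formal power series by a polynomial\<close>

text \<open>A series is a plain function because its support may be infinite; the sum is still
  finite, as a multiset has finitely many submultisets. It is the sum that occurs in
  \<open>has_rational_value\<close>.\<close>

definition poly_act :: "('e multiset \<Rightarrow>\<^sub>0 real) \<Rightarrow> ('e multiset \<Rightarrow> real) \<Rightarrow> 'e multiset \<Rightarrow> real" where
  "poly_act Q F m = (\<Sum>a | a \<subseteq># m. Poly_Mapping.lookup Q a * F (m - a))"

lemma poly_act_zero: "poly_act 0 F = (\<lambda>m. 0)"
  by (auto simp: poly_act_def)

lemma poly_act_add: "poly_act (P + Q) F = (\<lambda>m. poly_act P F m + poly_act Q F m)"
  by (auto simp: poly_act_def lookup_add distrib_right sum.distrib)

lemma poly_act_sum: "poly_act (\<Sum>i\<in>I. P i) F = (\<lambda>m. \<Sum>i\<in>I. poly_act (P i) F m)"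
  by (induction I rule: infinite_finite_induct) (simp_all add: poly_act_zero poly_act_add)

lemma poly_act_series_add: "poly_act P (\<lambda>m. F m + F' m) = (\<lambda>m. poly_act P F m + poly_act P F' m)"
  by (auto simp: poly_act_def distrib_left sum.distrib)

lemma poly_act_series_scale: "poly_act P (\<lambda>m. c * F m) = (\<lambda>m. c * poly_act P F m)"
  by (auto simp: poly_act_def sum_distrib_left ac_simps)

lemma poly_act_series_zero: "poly_act P (\<lambda>m. 0) = (\<lambda>m. 0)"
  by (auto simp: poly_act_def)

lemma poly_act_series_sum: "poly_act P (\<lambda>m. \<Sum>i\<in>I. F i m) = (\<lambda>m. \<Sum>i\<in>I. poly_act P (F i) m)"
  by (induction I rule: infinite_finite_induct) (simp_all add: poly_act_series_zero poly_act_series_add)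

lemma poly_act_single: "poly_act (Poly_Mapping.single a x) F m = (if a \<subseteq># m then x * F (m - a) else 0)"
proof -
  have "poly_act (Poly_Mapping.single a x) F m = (\<Sum>b | b \<subseteq># m. if b = a then x * F (m - a) else 0)"
    unfolding poly_act_def by (intro sum.cong) (auto simp: lookup_single when_def)
  then show ?thesis by (simp add: finite_submultisets)
qed

lemma poly_act_single_mult:
  "poly_act (Poly_Mapping.single a x * Q) F = poly_act (Poly_Mapping.single a x) (poly_act Q F)"
proof (induction Q rule: poly_mapping_monomial_induct)
  case (add Q b y)
  have "poly_act (Poly_Mapping.single (a + b) (x * y)) F m =
      poly_act (Poly_Mapping.single a x) (poly_act (Poly_Mapping.single b y) F) m" for m
    by (simp add: poly_act_single add_subseteq_mset_iff)
  then show ?case using add by (auto simp: distrib_left poly_act_add mult_single poly_act_series_add)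
qed (simp add: poly_act_zero poly_act_series_zero)

text \<open>This is the associative law that makes the series a module over the polynomials; it is
  what allows a system for series to be multiplied by an adjugate matrix.\<close>

lemma poly_act_mult: "poly_act (P * Q) F = poly_act P (poly_act Q F)"
  by (induction P rule: poly_mapping_monomial_induct)
    (simp_all add: poly_act_zero distrib_right poly_act_add poly_act_single_mult)

text \<open>The indicator of the empty multiset is the series 1, so a polynomial is recovered from
  its action on 1. Products of polynomials thereby become instances of the module law.\<close>

lemma poly_act_one_series: "poly_act P (\<lambda>m. of_bool (m = {#})) = Poly_Mapping.lookup P"
proof
  fix m
  have "poly_act P (\<lambda>m. of_bool (m = {#})) m = (\<Sum>b | b \<subseteq># m. if b = m then Poly_Mapping.lookup P m else 0)"
    unfolding poly_act_def by (intro sum.cong) (auto simp: Diff_eq_empty_iff_mset subset_mset.antisym)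
  then show "poly_act P (\<lambda>m. of_bool (m = {#})) m = Poly_Mapping.lookup P m"
    by (simp add: finite_submultisets)
qed

lemma poly_act_lookup: "poly_act P (Poly_Mapping.lookup Q) = Poly_Mapping.lookup (P * Q)"
  by (simp add: poly_act_mult flip: poly_act_one_series)

section \<open>Values of rational power series and Cramer's rule\<close>

lemma has_rational_value_iff:
  "has_rational_value w F x \<longleftrightarrow>
     (\<exists>P Q. poly_act Q F = Poly_Mapping.lookup P \<and> poly_value w Q \<noteq> 0 \<and> x = poly_value w P / poly_value w Q)"
  by (simp add: has_rational_value_def poly_act_def fun_eq_iff)

text \<open>Since \<open>Q' * Q\<close> and \<open>Q * Q'\<close> act alike on \<open>F\<close>, the
  polynomials \<open>Q' * P\<close> and \<open>Q * P'\<close> agree; evaluating them compares the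
  two quotients. This makes the definite description in \<open>boundary_measurement\<close>
  meaningful.\<close>

lemma has_rational_value_unique:
  assumes "has_rational_value w F x" "has_rational_value w F y"
  shows "x = y"
proof -
  obtain P Q where 1: "poly_act Q F = Poly_Mapping.lookup P" "poly_value w Q \<noteq> 0" "x = poly_value w P / poly_value w Q"
    using assms(1) unfolding has_rational_value_iff by blast
  obtain P' Q' where 2: "poly_act Q' F = Poly_Mapping.lookup P'" "poly_value w Q' \<noteq> 0" "y = poly_value w P' / poly_value w Q'"
    using assms(2) unfolding has_rational_value_iff by blast
  have "Poly_Mapping.lookup (Q' * P) = poly_act (Q' * Q) F" by (simp add: poly_act_mult 1 flip: poly_act_lookup)
  also have "\<dots> = Poly_Mapping.lookup (Q * P')" by (subst mult.commute) (simp add: poly_act_mult 2 flip: poly_act_lookup)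
  finally have "Q' * P = Q * P'" by (intro poly_mapping_eqI) simp
  then have "poly_value w Q' * poly_value w P = poly_value w Q * poly_value w P'"
    by (simp flip: poly_value_mult)
  then have "x * (poly_value w Q * poly_value w Q') = y * (poly_value w Q * poly_value w Q')"
    by (simp add: 1 2 ac_simps)
  then show ?thesis using 1(2) 2(2) by simp
qed

text \<open>The right-hand side of the system is the unit vector at \<open>s\<close>. Multiplication
  by \<open>N\<close> from the left turns it into column \<open>s\<close> of \<open>N\<close>, and
  no series has to be divided.\<close>

lemma formal_cramer:
  fixes A N :: "'a \<Rightarrow> 'a \<Rightarrow> 'e multiset \<Rightarrow>\<^sub>0 real"
  assumes S: "finite S"
    and N: "\<And>i k. i \<in> S \<Longrightarrow> k \<in> S \<Longrightarrow> (\<Sum>j\<in>S. N i j * A j k) = (if i = k then D else 0)"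
    and X: "\<And>i. i \<in> S \<Longrightarrow> (\<lambda>m. \<Sum>j\<in>S. poly_act (A i j) (X j) m) = Poly_Mapping.lookup (of_bool (i = s))"
    and i: "i \<in> S" and s: "s \<in> S"
  shows "poly_act D (X i) = Poly_Mapping.lookup (N i s)"
proof -
  have "poly_act D (X i) m = (\<Sum>k\<in>S. poly_act (\<Sum>j\<in>S. N i j * A j k) (X k) m)" for m
  proof -
    have "(\<Sum>k\<in>S. poly_act (\<Sum>j\<in>S. N i j * A j k) (X k) m) = (\<Sum>k\<in>S. if k = i then poly_act D (X i) m else 0)"
      using i by (intro sum.cong) (auto simp: N poly_act_zero)
    then show ?thesis using i S by simp
  qed
  also have "(\<Sum>k\<in>S. poly_act (\<Sum>j\<in>S. N i j * A j k) (X k) m) =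
      (\<Sum>j\<in>S. poly_act (N i j) (\<lambda>m. \<Sum>k\<in>S. poly_act (A j k) (X k) m) m)" for m
    by (simp add: poly_act_sum poly_act_mult poly_act_series_sum, rule sum.swap)
  also have "(\<Sum>j\<in>S. poly_act (N i j) (\<lambda>m. \<Sum>k\<in>S. poly_act (A j k) (X k) m) m) =
      (\<Sum>j\<in>S. if j = s then Poly_Mapping.lookup (N i s) m else 0)" for m
    by (intro sum.cong) (auto simp: X poly_act_lookup)
  finally show ?thesis using s S by auto
qed

section \<open>Geometry of a plabic graph\<close>

lemma det2_zero_multiple:
  assumes "l \<noteq> 0" "det2 l X = 0"
  shows "\<exists>t. X = of_real t * l"
proof (cases "Re l = 0")
  case True
  then have "Im l \<noteq> 0" using assms(1) by (auto simp: complex_eq_iff)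
  then show ?thesis using assms(2) True by (intro exI[of _ "Im X / Im l"]) (auto simp: complex_eq_iff det2_def)
next
  case False
  then show ?thesis using assms(2) by (intro exI[of _ "Re X / Re l"]) (auto simp: complex_eq_iff det2_def field_simps)
qed

context plabic_graph
begin

lemma finite_verts: "finite (verts (dg G))" and finite_edges: "finite (edges G)"
  using finite_loopfree by (auto simp: pair_digraph_def pair_fin_digraph_def pair_fin_digraph_axioms_def)

lemma edgeD:
  assumes "e \<in> edges G"
  shows "fst e \<in> verts (dg G)" "snd e \<in> verts (dg G)" "fst e \<noteq> snd e"
proof -
  interpret pair_digraph "net G" by (rule finite_loopfree)
  show "fst e \<in> verts (dg G)" "snd e \<in> verts (dg G)" "fst e \<noteq> snd e"
    using assms arc_fst_in_verts arc_snd_in_verts no_loops' by auto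
qed

lemma in_out_arcs:
  "in_arcs (dg G) v = {e \<in> edges G. snd e = v}" "out_arcs (dg G) v = {e \<in> edges G. fst e = v}"
  by (auto simp: in_arcs_def out_arcs_def)

lemma finite_in_out_arcs [simp]: "finite (in_arcs (dg G) v)" "finite (out_arcs (dg G) v)"
  using finite_edges by (auto simp: in_out_arcs)

lemma edges_at_iff: "e \<in> edges_at G v \<longleftrightarrow> e \<in> edges G \<and> (fst e = v \<or> snd e = v)"
  by (auto simp: edges_at_def in_out_arcs)

lemma bdry_eq_iff: "bdry G i = bdry G j \<longleftrightarrow> i = j"
proof -
  obtain \<theta> where \<theta>: "\<And>i. bdry G i = centre G + of_real (radius G) * cis (\<theta> i)"
    "\<And>i j. i < j \<Longrightarrow> \<theta> j < \<theta> i \<and> \<theta> i - \<theta> j < pi"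
    using boundary_clockwise by blast
  have "bdry G i \<noteq> bdry G j" if "i < j" for i j
  proof
    assume "bdry G i = bdry G j"
    then have "cis (\<theta> i) = cis (\<theta> j)" using \<theta>(1) radius_pos by simp
    then have "cis (\<theta> i - \<theta> j) = 1" by (simp flip: cis_divide)
    then have "cos (\<theta> i - \<theta> j) = 1" by (simp add: complex_eq_iff)
    moreover have "cos (\<theta> i - \<theta> j) < cos 0"
      using \<theta>(2)[OF that] by (intro cos_monotone_0_pi) auto
    ultimately show False by simp
  qed
  then show ?thesis by (metis linorder_neq_iff)
qed

lemma label_bdry [simp]: "label G (bdry G i) = i"
  unfolding label_def by (rule inv_f_f) (auto simp: inj_def bdry_eq_iff)

lemma vert_cases:
  assumes "v \<in> verts (dg G)"
  obtains "v \<in> internal G" | i where "v = bdry G i" "v \<notin> internal G"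
  using assms by (auto simp: internal_def)

lemma bdry_notin_internal [simp]: "bdry G i \<notin> internal G"
  by (simp add: internal_def)

lemma internal_vert: "v \<in> internal G \<Longrightarrow> v \<in> verts (dg G)"
  by (simp add: internal_def)

lemma bdry_vert [simp]: "bdry G i \<in> verts (dg G)"
  using boundary_verts by auto

lemma card_in_out_bdry: "card (in_arcs (dg G) (bdry G i)) + card (out_arcs (dg G) (bdry G i)) = 1"
  using boundary_degree[of i] by (simp add: degree_def in_degree_def out_degree_def)

lemma source_iff: "i \<in> sources G \<longleftrightarrow> out_arcs (dg G) (bdry G i) \<noteq> {}"
  unfolding sources_def in_out_arcs by blast

lemma source_arcs:
  assumes "i \<in> sources G"
  obtains e where "out_arcs (dg G) (bdry G i) = {e}" "in_arcs (dg G) (bdry G i) = {}"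
proof -
  have "card (out_arcs (dg G) (bdry G i)) \<noteq> 0" using assms by (simp only: card_0_eq finite_in_out_arcs source_iff not_False_eq_True)
  then have "card (out_arcs (dg G) (bdry G i)) = 1" "card (in_arcs (dg G) (bdry G i)) = 0"
    using card_in_out_bdry[of i] by linarith+
  from this(1) obtain e where "out_arcs (dg G) (bdry G i) = {e}" by (rule card_1_singletonE)
  moreover have "in_arcs (dg G) (bdry G i) = {}"
    using \<open>card (in_arcs (dg G) (bdry G i)) = 0\<close> by (simp only: card_0_eq finite_in_out_arcs)
  ultimately show thesis by (rule that)
qed

lemma sink_arcs:
  assumes "i \<notin> sources G"
  obtains e where "in_arcs (dg G) (bdry G i) = {e}" "out_arcs (dg G) (bdry G i) = {}"
proof -
  have "out_arcs (dg G) (bdry G i) = {}" using assms by (simp add: source_iff)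
  then have "card (in_arcs (dg G) (bdry G i)) = 1" using card_in_out_bdry[of i] by simp
  then obtain e where "in_arcs (dg G) (bdry G i) = {e}" by (rule card_1_singletonE)
  then show thesis using \<open>out_arcs (dg G) (bdry G i) = {}\<close> by (rule that)
qed

lemma white_in_arcs:
  assumes "v \<in> internal G" "v \<in> white G"
  shows "in_arcs (dg G) v = {in_edge G v}"
proof -
  have "card (in_arcs (dg G) v) = 1" using perfect_white[OF assms] by (simp only: in_degree_def)
  then obtain e where "in_arcs (dg G) v = {e}" by (rule card_1_singletonE)
  then show ?thesis by (simp only: in_edge_def the_elem_eq)
qed

lemma black_out_arcs:
  assumes "v \<in> internal G" "v \<notin> white G"
  shows "out_arcs (dg G) v = {out_edge G v}"
proof -
  have "card (out_arcs (dg G) v) = 1" using perfect_black[OF assms] by (simp only: out_degree_def)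
  then obtain e where "out_arcs (dg G) v = {e}" by (rule card_1_singletonE)
  then show ?thesis by (simp only: out_edge_def the_elem_eq)
qed

lemma internal_out_arcs: "v \<in> internal G \<Longrightarrow> out_arcs (dg G) v \<noteq> {}"
  using internal_degree[of v] perfect_white[of v] perfect_black[of v]
  by (cases "v \<in> white G") (auto simp: degree_def in_degree_def out_degree_def)

text \<open>A boundary vertex has degree one, so it cannot have both an incoming and an outgoing
  edge.\<close>

lemma through_vertex_internal:
  assumes "e \<in> edges G" "f \<in> edges G" "snd e = fst f"
  shows "snd e \<in> internal G"
proof (rule ccontr)
  assume "snd e \<notin> internal G"
  then obtain i where i: "snd e = bdry G i" using edgeD(2)[OF assms(1)] by (auto simp: internal_def)
  have "e \<in> in_arcs (dg G) (bdry G i)" "f \<in> out_arcs (dg G) (bdry G i)"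
    using assms i by (auto simp: in_out_arcs)
  then have "in_arcs (dg G) (bdry G i) \<noteq> {}" "out_arcs (dg G) (bdry G i) \<noteq> {}" by blast+
  moreover have "in_arcs (dg G) (bdry G i) = {} \<or> out_arcs (dg G) (bdry G i) = {}"
  proof (cases "i \<in> sources G")
    case True
    then show ?thesis by (rule source_arcs) simp
  next
    case False
    then show ?thesis by (rule sink_arcs) simp
  qed
  ultimately show False by blast
qed

lemma norm_bdry: "norm (bdry G i - centre G) = radius G"
proof -
  obtain \<theta> where "\<And>i. bdry G i = centre G + of_real (radius G) * cis (\<theta> i)"
    using boundary_clockwise by blast
  then show ?thesis using radius_pos by (simp add: norm_mult)
qed

lemma vert_in_cball: "v \<in> verts (dg G) \<Longrightarrow> v \<in> cball (centre G) (radius G)"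
  using internal_in_disc norm_bdry
  by (elim vert_cases) (auto simp: dist_norm norm_minus_commute less_imp_le)

text \<open>Expanding the bound on the length of \<open>d + r\<close> leaves |d|^2 + 2 d.r \<le> 0.
  Geometrically, the disc touches its tangent at b_i only in b_i.\<close>

lemma inward_of_cball:
  assumes "x \<in> cball (centre G) (radius G)" "x \<noteq> bdry G i"
  shows "(x - bdry G i) \<bullet> (bdry G i - centre G) < 0"
proof -
  define d r where "d = x - bdry G i" and "r = bdry G i - centre G"
  have "norm (d + r) \<le> radius G" using assms(1) by (simp add: d_def r_def dist_norm norm_minus_commute)
  then have "(d + r) \<bullet> (d + r) \<le> (radius G)\<^sup>2"
    by (simp add: dot_square_norm power_mono)
  also have "(radius G)\<^sup>2 = r \<bullet> r" by (simp add: dot_square_norm norm_bdry r_def)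
  finally have "d \<bullet> d + 2 * (d \<bullet> r) \<le> 0" by (simp add: inner_add_left inner_add_right inner_commute[of r d])
  moreover have "0 < d \<bullet> d" using assms(2) by (simp add: d_def)
  ultimately show ?thesis unfolding d_def r_def by linarith
qed

text \<open>Two opposite edges would share their midpoint, which is an end point of neither. This
  rules out directed cycles of length two, to which no polygon corresponds.\<close>

lemma no_antiparallel: "(A, B) \<in> edges G \<Longrightarrow> (B, A) \<notin> edges G"
proof
  assume "(A, B) \<in> edges G" "(B, A) \<in> edges G"
  moreover have ne: "A \<noteq> B" using edgeD(3)[OF \<open>(A, B) \<in> edges G\<close>] by simp
  ultimately have "closed_segment A B \<inter> closed_segment B A \<subseteq> {A, B}"
    using embedded[of "(A, B)" "(B, A)"] by auto
  moreover have "midpoint A B \<in> closed_segment A B" by (rule midpoint_in_closed_segment)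
  moreover have "midpoint A B \<in> closed_segment B A"
    unfolding closed_segment_commute[of B A] by (rule midpoint_in_closed_segment)
  ultimately have "midpoint A B \<in> {A, B}" by blast
  then show False using ne by (auto simp: midpoint_eq_endpoint)
qed

end

section \<open>Gauge rays and heights of the boundary vertices\<close>

locale gauged_plabic_graph = plabic_graph G for G :: "'n::{finite,linorder} plabic" +
  fixes l :: complex
  assumes gauge: "gauge_direction G l"
begin

lemma l_nonzero: "l \<noteq> 0" and not_parallel: "e \<in> edges G \<Longrightarrow> det2 l (evec e) \<noteq> 0"
  and ray_avoids_internal: "v \<in> internal G \<Longrightarrow> v \<notin> gauge_ray l (bdry G i)"
  using gauge by (auto simp: gauge_direction_def)

lemma gauge_inward: "l \<bullet> (bdry G i - centre G) < 0"
proof -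
  obtain x where "x \<in> gauge_ray l (bdry G i)" "x \<in> ball (centre G) (radius G)"
    using gauge unfolding gauge_direction_def by blast
  then obtain t where t: "0 < t" "x = bdry G i + of_real t * l" by (auto simp: gauge_ray_def)
  have "(x - bdry G i) \<bullet> (bdry G i - centre G) < 0"
    using \<open>x \<in> ball _ _\<close> t l_nonzero by (intro inward_of_cball) auto
  then have "t * (l \<bullet> (bdry G i - centre G)) < 0" using t by (simp add: inner_complex_def algebra_simps)
  then show ?thesis using t by (simp add: mult_less_0_iff)
qed

text \<open>\<open>q\<close> is the component of \<open>l\<close> along the radius to the middle of
  the arc between the two vertices. As \<open>l\<close> points inwards at both of them and the half
  angle is below a quarter turn, \<open>q\<close> is negative; the height difference is a negative
  multiple of \<open>q\<close>, because labels run clockwise.\<close>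

lemma height_bdry_less:
  assumes "i < j"
  shows "det2 l (bdry G i) < det2 l (bdry G j)"
proof -
  obtain \<theta> where \<theta>: "\<And>i. bdry G i = centre G + of_real (radius G) * cis (\<theta> i)"
    "\<And>i j. i < j \<Longrightarrow> \<theta> j < \<theta> i \<and> \<theta> i - \<theta> j < pi"
    using boundary_clockwise by blast
  define \<mu> where "\<mu> = (\<theta> i + \<theta> j) / 2"
  define \<delta> where "\<delta> = (\<theta> i - \<theta> j) / 2"
  define q where "q = Re l * cos \<mu> + Im l * sin \<mu>"
  have \<delta>: "0 < \<delta>" "\<delta> < pi / 2" using \<theta>(2)[OF assms] by (auto simp: \<delta>_def)
  have sc: "0 < sin \<delta>" "0 < cos \<delta>" using \<delta> by (auto intro: sin_gt_zero cos_gt_zero)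
  have ang: "\<theta> i = \<mu> + \<delta>" "\<theta> j = \<mu> - \<delta>" by (simp_all add: \<mu>_def \<delta>_def field_simps)
  have "l \<bullet> (bdry G i - centre G) + l \<bullet> (bdry G j - centre G) = 2 * radius G * cos \<delta> * q"
    by (simp add: \<theta>(1) ang q_def inner_complex_def cos_add cos_diff sin_add sin_diff algebra_simps)
  then have "2 * radius G * cos \<delta> * q < 0" using gauge_inward[of i] gauge_inward[of j] by linarith
  then have "q < 0" using sc radius_pos by (simp add: mult_less_0_iff)
  have "det2 l (bdry G j) - det2 l (bdry G i) = 2 * radius G * sin \<delta> * - q"
    by (simp add: \<theta>(1) ang q_def det2_def cos_add cos_diff sin_add sin_diff algebra_simps)
  also have "\<dots> > 0" using sc radius_pos \<open>q < 0\<close> by (intro mult_pos_pos) auto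
  finally show ?thesis by simp
qed

lemma height_bdry_less_iff: "det2 l (bdry G i) < det2 l (bdry G j) \<longleftrightarrow> i < j"
  using height_bdry_less[of i j] height_bdry_less[of j i] by (cases i j rule: linorder_cases) auto

abbreviation side :: "'n \<Rightarrow> complex \<Rightarrow> real" where
  "side m x \<equiv> det2 l (x - bdry G m)"

lemma side_bdry: "side m (bdry G i) = det2 l (bdry G i) - det2 l (bdry G m)"
  by (simp add: det2_def algebra_simps)

text \<open>Going backwards from b_m along \<open>l\<close> leads to the outer side of the tangent,
  hence out of the disc. Inside the disc the whole line may therefore replace the ray, and signs of
  \<open>side\<close> decide about crossings.\<close>

lemma in_ray_iff:
  assumes "x \<in> cball (centre G) (radius G)"
  shows "x \<in> gauge_ray l (bdry G m) \<longleftrightarrow> side m x = 0 \<and> x \<noteq> bdry G m"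
proof
  assume "x \<in> gauge_ray l (bdry G m)"
  then show "side m x = 0 \<and> x \<noteq> bdry G m" using l_nonzero by (auto simp: gauge_ray_def det2_def)
next
  assume *: "side m x = 0 \<and> x \<noteq> bdry G m"
  then obtain t where "x - bdry G m = of_real t * l" using det2_zero_multiple[OF l_nonzero] by blast
  note t = this
  have "(x - bdry G m) \<bullet> (bdry G m - centre G) < 0" using inward_of_cball[OF assms] * by auto
  then have "t * (l \<bullet> (bdry G m - centre G)) < 0"
    unfolding t by (simp add: inner_complex_def distrib_left mult.assoc)
  then have "0 < t" using gauge_inward[of m] by (simp add: mult_less_0_iff)
  moreover have "x = bdry G m + of_real t * l" using t by (metis add.commute diff_add_cancel)
  ultimately show "x \<in> gauge_ray l (bdry G m)" unfolding gauge_ray_def by blast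
qed

text \<open>An internal vertex on the line would lie on the ray, which the gauge condition forbids,
  and different boundary vertices have different heights.\<close>

lemma side_eq_0_iff:
  assumes "v \<in> verts (dg G)"
  shows "side m v = 0 \<longleftrightarrow> v = bdry G m"
  using assms
proof (cases v rule: vert_cases)
  case 1
  then show ?thesis using ray_avoids_internal[of v m] in_ray_iff[of v m] vert_in_cball[OF assms]
    by (auto simp: det2_def)
next
  case (2 i)
  then show ?thesis using height_bdry_less_iff[of i m] height_bdry_less_iff[of m i]
    by (auto simp: side_bdry bdry_eq_iff)
qed

end

lemma minus_one_powi: "(-1 :: real) powi k = (if even k then 1 else -1)"
  by (auto simp: power_int_def minus_one_power_iff even_nat_iff)

lemma minus_one_power_nat_mod: "(-1 :: real) ^ nat (x mod 2) = (-1) powi x"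
  by (cases "even x") (auto simp: minus_one_powi even_iff_mod_2_eq_zero odd_iff_mod_2_eq_one)

lemma powi_add: "(-1 :: real) powi (a + b) = (-1) powi a * (-1) powi b"
  by (simp add: power_int_add)

lemma minus_one_powi_sum: "(-1 :: real) powi (\<Sum>i\<in>I. f i) = (\<Prod>i\<in>I. (-1) powi f i)"
  by (induction I rule: infinite_finite_induct) (simp_all add: powi_add)

section \<open>Intersection indices and arc signs\<close>

context gauged_plabic_graph
begin

text \<open>The strict inequality gives the sign 1 to the edge at b_m itself, in accordance with
  \<open>gauge_ray\<close>, which omits its starting point.\<close>

abbreviation crossing_sign :: "'n \<Rightarrow> complex \<times> complex \<Rightarrow> real" where
  "crossing_sign m e \<equiv> if side m (fst e) * side m (snd e) < 0 then -1 else 1"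

lemma side_convex: "side m ((1 - u) *\<^sub>R x + u *\<^sub>R y) = (1 - u) * side m x + u * side m y"
  by (simp add: det2_def algebra_simps)

lemma side_neq:
  assumes "e \<in> edges G"
  shows "side m (fst e) \<noteq> side m (snd e)"
  using not_parallel[OF assms] by (auto simp: evec_def det2_def algebra_simps)

text \<open>Along the edge \<open>side m\<close> is affine and not constant, because the edge is not
  parallel to \<open>l\<close>; so it vanishes at most once, and strictly inside the edge exactly if
  it changes sign. It remains to see that this zero is not the starting point of the ray.\<close>

lemma card_segment_ray:
  assumes e: "e \<in> edges G"
  shows "finite (closed_segment (fst e) (snd e) \<inter> gauge_ray l (bdry G m))" (is "finite ?S")
    and "card (closed_segment (fst e) (snd e) \<inter> gauge_ray l (bdry G m)) = of_bool (side m (fst e) * side m (snd e) < 0)"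
proof -
  obtain U V where UV: "e = (U, V)" by (cases e)
  have v: "U \<in> verts (dg G)" "V \<in> verts (dg G)" using edgeD[OF e] UV by auto
  have ne: "side m U \<noteq> side m V" using side_neq[OF e] UV by auto
  have cb: "closed_segment U V \<subseteq> cball (centre G) (radius G)"
    using v vert_in_cball by (intro closed_segment_subset) auto
  have S: "x \<in> ?S \<longleftrightarrow> x \<in> closed_segment U V \<and> side m x = 0 \<and> x \<noteq> bdry G m" for x
    using cb in_ray_iff[of x m] UV by auto
  have uniq: "x = y" if xy: "x \<in> ?S" "y \<in> ?S" for x y
  proof -
    obtain s t where s: "x = (1 - s) *\<^sub>R U + s *\<^sub>R V" and t: "y = (1 - t) *\<^sub>R U + t *\<^sub>R V"
      using xy S by (auto simp: in_segment)
    have "side m x = 0" "side m y = 0" using xy S by auto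
    then have "(1 - s) * side m U + s * side m V = (1 - t) * side m U + t * side m V"
      unfolding s t side_convex by simp
    then have "(s - t) * (side m V - side m U) = 0" by (simp only: algebra_simps)
    then have "s = t" using ne by auto
    then show ?thesis by (simp add: s t)
  qed
  have sub: "?S = {} \<or> (\<exists>x. ?S = {x})" using uniq by blast
  then show "finite ?S" by auto
  have "?S \<noteq> {} \<longleftrightarrow> side m U * side m V < 0"
  proof
    assume "?S \<noteq> {}"
    then obtain x where x: "x \<in> ?S" by blast
    then obtain u where u: "0 \<le> u" "u \<le> 1" "x = (1 - u) *\<^sub>R U + u *\<^sub>R V" using S by (auto simp: in_segment)
    have eq: "(1 - u) * side m U + u * side m V = 0" and xm: "x \<noteq> bdry G m"
      using x S u(3) side_convex by auto
    show "side m U * side m V < 0"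
    proof (rule ccontr)
      assume "\<not> ?thesis"
      then have nn: "0 \<le> side m U * side m V" by simp
      consider "side m U = 0" | "side m V = 0" | "0 < side m U * side m V" using nn by (auto simp: le_less)
      then show False
      proof cases
        case 1
        then have "u = 0" using eq ne by auto
        then show False using 1 xm u side_eq_0_iff[OF v(1)] by simp
      next
        case 2
        then have "u = 1" using eq ne by auto
        then show False using 2 xm u side_eq_0_iff[OF v(2)] by simp
      next
        case 3
        have "0 = (1 - u) * (side m U * side m U) + u * (side m U * side m V)"
          using arg_cong[OF eq, of "\<lambda>y. side m U * y"] by (simp add: distrib_left ac_simps)
        moreover have "0 \<le> (1 - u) * (side m U * side m U)" "0 \<le> u * (side m U * side m V)" using 3 u by auto
        moreover have "0 < side m U * side m U" using 3 by (auto simp: zero_less_mult_iff)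
        ultimately show False using 3 u by (auto simp: add_nonneg_eq_0_iff)
      qed
    qed
  next
    assume neg: "side m U * side m V < 0"
    define u where "u = side m U / (side m U - side m V)"
    have u: "0 < u" "u < 1" using neg by (auto simp: u_def mult_less_0_iff field_simps)
    define x where "x = (1 - u) *\<^sub>R U + u *\<^sub>R V"
    have "x \<in> closed_segment U V" using u by (auto simp: in_segment x_def intro!: exI[of _ u])
    moreover have "side m x = 0" unfolding x_def side_convex using ne by (simp add: u_def field_simps)
    \<comment> \<open>Both ends of the edge lie strictly on the inner side of the tangent at b_m,
      hence so does every convex combination of them, whereas b_m lies on the tangent.\<close>
    moreover have "x \<noteq> bdry G m"
    proof
      assume xm: "x = bdry G m"
      have "U \<noteq> bdry G m" "V \<noteq> bdry G m" using neg by (auto simp: det2_def)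
      then have "(U - bdry G m) \<bullet> (bdry G m - centre G) < 0" "(V - bdry G m) \<bullet> (bdry G m - centre G) < 0"
        using v vert_in_cball inward_of_cball by auto
      then have "(1 - u) * ((U - bdry G m) \<bullet> (bdry G m - centre G)) + u * ((V - bdry G m) \<bullet> (bdry G m - centre G)) < 0"
        using u by (intro add_neg_neg mult_pos_neg) auto
      also have "(1 - u) * ((U - bdry G m) \<bullet> (bdry G m - centre G)) + u * ((V - bdry G m) \<bullet> (bdry G m - centre G))
        = (x - bdry G m) \<bullet> (bdry G m - centre G)"
        by (simp add: x_def inner_complex_def algebra_simps)
      finally show False using xm by simp
    qed
    ultimately show "?S \<noteq> {}" using S by blast
  qed
  then show "card ?S = of_bool (side m (fst e) * side m (snd e) < 0)"
    using sub UV by auto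
qed

text \<open>Different rays lie at different heights and are disjoint, so crossings can be counted
  source by source. The factor \<open>s_index l (evec e)\<close> is odd because the edge is not
  parallel to \<open>l\<close>.\<close>

lemma int_index_sign:
  assumes e: "e \<in> edges G"
  shows "(-1 :: real) powi int_index G l e = (\<Prod>m\<in>sources G. crossing_sign m e)"
proof -
  let ?c = "card (closed_segment (fst e) (snd e) \<inter> (\<Union>i\<in>sources G. gauge_ray l (bdry G i)))"
  have disj: "gauge_ray l (bdry G i) \<inter> gauge_ray l (bdry G j) = {}" if "i \<noteq> j" for i j
  proof -
    have ray: "det2 l x = det2 l (bdry G m)" if "x \<in> gauge_ray l (bdry G m)" for x m
      using that by (auto simp: gauge_ray_def det2_def algebra_simps)
    have ne: "det2 l (bdry G i) \<noteq> det2 l (bdry G j)"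
      using height_bdry_less_iff[of i j] height_bdry_less_iff[of j i] that by auto
    show ?thesis
    proof (rule equals0I)
      fix x assume "x \<in> gauge_ray l (bdry G i) \<inter> gauge_ray l (bdry G j)"
      then have "x \<in> gauge_ray l (bdry G i)" "x \<in> gauge_ray l (bdry G j)" by auto
      from ray[OF this(1)] ray[OF this(2)] ne show False by simp
    qed
  qed
  have "?c = (\<Sum>m\<in>sources G. card (closed_segment (fst e) (snd e) \<inter> gauge_ray l (bdry G m)))"
    unfolding Int_UN_distrib
    by (rule card_UN_disjoint) (use card_segment_ray(1)[OF e] disj in auto)
  then have c: "?c = (\<Sum>m\<in>sources G. of_bool (side m (fst e) * side m (snd e) < 0))"
    by (simp only: card_segment_ray(2)[OF e])
  have "odd (s_index l (evec e))" using not_parallel[OF e] by (auto simp: s_index_def)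
  then have "(-1 :: real) powi int_index G l e = (-1) ^ ?c"
    by (simp only: int_index_def minus_one_powi minus_one_power_iff even_mult_iff even_of_nat) simp
  also have "\<dots> = (\<Prod>m\<in>sources G. (-1) ^ of_bool (side m (fst e) * side m (snd e) < 0))"
    unfolding c by (rule power_sum)
  also have "\<dots> = (\<Prod>m\<in>sources G. crossing_sign m e)"
    by (intro prod.cong) auto
  finally show ?thesis .
qed

lemma int_index_sign_internal:
  assumes e: "e \<in> edges G" and "fst e \<in> internal G" "snd e \<in> internal G"
  shows "(-1 :: real) powi int_index G l e = (\<Prod>m\<in>sources G. sgn (side m (fst e))) * (\<Prod>m\<in>sources G. sgn (side m (snd e)))"
proof -
  have "side m (fst e) \<noteq> 0" "side m (snd e) \<noteq> 0" for m
    using side_eq_0_iff[of "fst e" m] side_eq_0_iff[of "snd e" m] assms edgeD[OF e] by auto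
  then have "crossing_sign m e = sgn (side m (fst e)) * sgn (side m (snd e))" for m
    by (auto simp: mult_less_0_iff sgn_if)
  then show ?thesis unfolding int_index_sign[OF e] prod.distrib[symmetric] by (intro prod.cong) auto
qed

text \<open>The perfect orientation determines the previous edge at a white tail and the next edge
  at a black head, so these windings are functions of a single edge and can enter a matrix
  entry.\<close>

definition out_wind_sign :: "complex \<times> complex \<Rightarrow> real" where
  "out_wind_sign e = (if fst e \<in> internal G \<and> fst e \<in> white G then (-1) powi wind l (in_edge G (fst e)) e else 1)"

definition in_wind_sign :: "complex \<times> complex \<Rightarrow> real" where
  "in_wind_sign e = (if snd e \<in> internal G \<and> snd e \<notin> white G then (-1) powi wind l e (out_edge G (snd e)) else 1)"

definition arc_sign :: "complex \<times> complex \<Rightarrow> real" where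
  "arc_sign e = (-1) powi int_index G l e * out_wind_sign e * in_wind_sign e"

text \<open>This is the sign between a half-edge vector at the tail of an edge and the summand of
  that edge in the vertex equation: the zero sum at a white vertex and the convention at a source
  bring a minus sign, equality at a black vertex brings none.\<close>

definition vertex_sign :: "complex \<Rightarrow> real" where
  "vertex_sign v = (if v \<in> internal G \<and> v \<notin> white G then 1 else -1)"

lemma geometric_signature_sign:
  "(-1 :: real) ^ geometric_signature G l e = vertex_sign (fst e) * arc_sign e"
  unfolding geometric_signature_def Let_def minus_one_power_nat_mod
  by (simp add: powi_add vertex_sign_def arc_sign_def out_wind_sign_def in_wind_sign_def)

text \<open>The vertex between the two edges has one colour, so exactly one of the two factors
  carries the winding there and the other one is 1.\<close>

lemma consecutive_wind_sign:
  assumes "e \<in> edges G" "f \<in> edges G" "snd e = fst f"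
  shows "in_wind_sign e * out_wind_sign f = (-1) powi wind l e f"
proof -
  have int: "fst f \<in> internal G" using through_vertex_internal[OF assms] assms(3) by simp
  show ?thesis
  proof (cases "fst f \<in> white G")
    case True
    have "e \<in> in_arcs (dg G) (fst f)" using assms by (simp add: in_out_arcs)
    then have "in_edge G (fst f) = e" using white_in_arcs[OF int True] by simp
    then show ?thesis using int True assms(3) by (simp add: in_wind_sign_def out_wind_sign_def)
  next
    case False
    have "f \<in> out_arcs (dg G) (fst f)" using assms by (simp add: in_out_arcs)
    then have "out_edge G (fst f) = f" using black_out_arcs[OF int False] by simp
    then show ?thesis using int False assms(3) by (simp add: in_wind_sign_def out_wind_sign_def)
  qed
qed

end

section \<open>Signs of directed cycles and the transfer matrix\<close>

context gauged_plabic_graph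
begin

definition arc_weight :: "(complex \<times> complex \<Rightarrow> real) \<Rightarrow> complex \<Rightarrow> complex \<Rightarrow> real" where
  "arc_weight w U V = (if (U, V) \<in> edges G then arc_sign (U, V) * w (U, V) else 0)"

text \<open>
  The factor of a white vertex sits on the outgoing edge and that of a black vertex on the incoming
  edge, so that a cycle collects the winding at each of its vertices once.
\<close>

lemma cycle_sign:
  assumes us: "distinct us" "us \<noteq> []"
    and ed: "\<And>i. i < length us \<Longrightarrow> (us ! i, us ! (Suc i mod length us)) \<in> edges G"
  shows "(\<Prod>i<length us. arc_sign (us ! i, us ! (Suc i mod length us))) = -1"
proof -
  let ?k = "length us"
  define v where "v i = us ! (i mod ?k)" for i
  have k0: "0 < ?k" using us by simp
  have v_edge: "(v i, v (Suc i)) \<in> edges G" for i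
    using ed[of "i mod ?k"] k0 by (simp add: v_def mod_Suc_eq)
  have v_eq: "v i = v j \<longleftrightarrow> i mod ?k = j mod ?k" for i j
    using us k0 by (simp add: v_def nth_eq_iff_index_eq)
  have k3: "3 \<le> ?k"
  proof (rule ccontr)
    assume "\<not> 3 \<le> ?k"
    then consider "?k = 1" | "?k = 2" using k0 by linarith
    then show False
    proof cases
      case 1
      then have "v 0 = v 1" by (simp add: v_eq)
      then show False using edgeD(3)[OF v_edge[of 0]] by simp
    next
      case 2
      then have "v (Suc (Suc 0)) = v 0" by (simp add: v_eq)
      then show False using v_edge[of 0] v_edge[of 1] no_antiparallel[of "v 0" "v 1"] by simp
    qed
  qed
  interpret simple_polygon v ?k
  proof
    show "3 \<le> ?k" by (rule k3)
    show "v (i + ?k) = v i" for i by (simp add: v_eq)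
    show "inj_on v {..<?k}" by (auto simp: inj_on_def v_eq)
    fix a b assume "a < ?k" "b < ?k" "a \<noteq> b"
    then have "(v a, v (Suc a)) \<noteq> (v b, v (Suc b))" by (simp add: v_eq)
    from embedded[OF v_edge v_edge this]
    show "closed_segment (v a) (v (Suc a)) \<inter> closed_segment (v b) (v (Suc b))
        \<subseteq> {v a, v (Suc a)} \<inter> {v b, v (Suc b)}" by simp
  qed
  let ?e = "\<lambda>i. (v i, v (Suc i))"
  have int: "v i \<in> internal G" for i
  proof -
    \<comment> \<open>Adding \<open>?k\<close> first gives the cyclic predecessor also for i =
      0.\<close>
    have "v (Suc (i + ?k - 1)) = v i" using k0 by (simp add: v_eq)
    then show ?thesis using through_vertex_internal[OF v_edge[of "i + ?k - 1"] v_edge[of i]] by simp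
  qed
  \<comment> \<open>The intersection sign of an edge is the product of \<open>pot\<close> at its
    ends, and every vertex of the cycle is an end of two of its edges.\<close>
  define pot where "pot i = (\<Prod>m\<in>sources G. sgn (side m (v i)))" for i
  have pot_square: "pot i * pot i = 1" for i
  proof -
    have "sgn (side m (v i)) * sgn (side m (v i)) = 1" for m
      using side_eq_0_iff[OF internal_vert[OF int[of i]], of m] int[of i] by (auto simp: sgn_if)
    then show ?thesis by (simp add: pot_def flip: prod.distrib)
  qed
  have periodic_prod: "(\<Prod>i<?k. f (Suc i)) = (\<Prod>i<?k. f i)" if "f ?k = f 0" for f :: "nat \<Rightarrow> real"
  proof -
    have "(\<Prod>i<?k. f (Suc i)) * f 0 = (\<Prod>i<Suc ?k. f i)" by (subst prod.lessThan_Suc_shift) (simp add: mult.commute)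
    also have "\<dots> = (\<Prod>i<?k. f i) * f 0" by (simp add: that)
    finally have *: "(\<Prod>i<?k. f (Suc i)) * f 0 = (\<Prod>i<?k. f i) * f 0" .
    show ?thesis
    proof (cases "f 0 = 0")
      case True
      then have "(\<Prod>i<?k. f i) = 0" using k0 by (auto intro!: prod_zero bexI[of _ 0])
      moreover have "(\<Prod>i<?k. f (Suc i)) = 0"
        using True that k0 by (auto intro!: prod_zero bexI[of _ "?k - 1"])
      ultimately show ?thesis by (simp only:)
    qed (use * in simp)
  qed
  have "(\<Prod>i<?k. arc_sign (us ! i, us ! (Suc i mod ?k))) = (\<Prod>i<?k. arc_sign (?e i))"
    by (intro prod.cong) (auto simp: v_def)
  also have "\<dots> = (\<Prod>i<?k. (-1) powi int_index G l (?e i)) * ((\<Prod>i<?k. out_wind_sign (?e i)) * (\<Prod>i<?k. in_wind_sign (?e i)))"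
    by (simp add: arc_sign_def prod.distrib)
  also have "(\<Prod>i<?k. (-1 :: real) powi int_index G l (?e i)) = (\<Prod>i<?k. pot i * pot (Suc i))"
    using int_index_sign_internal[OF v_edge] int by (simp add: pot_def)
  also have "\<dots> = 1"
  proof -
    have "(\<Prod>i<?k. pot (Suc i)) = (\<Prod>i<?k. pot i)"
      by (rule periodic_prod) (simp add: pot_def v_def)
    then show ?thesis by (simp add: prod.distrib) (simp add: pot_square flip: prod.distrib)
  qed
  \<comment> \<open>The shift by one pairs the tail factor of each edge with the head factor of its
    predecessor.\<close>
  also have "(\<Prod>i<?k. out_wind_sign (?e i)) = (\<Prod>i<?k. out_wind_sign (?e (Suc i)))"
    by (rule periodic_prod[symmetric]) (use periodic[of 0] periodic[of "Suc 0"] in simp)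
  also have "(\<Prod>i<?k. out_wind_sign (?e (Suc i))) * (\<Prod>i<?k. in_wind_sign (?e i)) =
      (\<Prod>i<?k. (-1) powi wind l (?e i) (?e (Suc i)))"
    using consecutive_wind_sign[OF v_edge v_edge] by (simp add: mult.commute flip: prod.distrib)
  also have "\<dots> = (-1) powi (\<Sum>i<?k. wind l (?e i) (?e (Suc i)))"
    by (rule minus_one_powi_sum[symmetric])
  also have "\<dots> = -1"
    using odd_wind[OF l_nonzero] not_parallel[OF v_edge] by (simp add: minus_one_powi evec_def)
  finally show ?thesis by simp
qed

lemma cycle_weight_nonpos:
  assumes w: "\<forall>e\<in>edges G. 0 < w e" and us: "distinct us" "us \<noteq> []"
  shows "(\<Prod>i<length us. arc_weight w (us ! i) (us ! (Suc i mod length us))) \<le> 0"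
proof (cases "\<forall>i<length us. (us ! i, us ! (Suc i mod length us)) \<in> edges G")
  case True
  then have "(\<Prod>i<length us. arc_weight w (us ! i) (us ! (Suc i mod length us))) =
      (\<Prod>i<length us. arc_sign (us ! i, us ! (Suc i mod length us))) *
      (\<Prod>i<length us. w (us ! i, us ! (Suc i mod length us)))"
    by (simp add: arc_weight_def prod.distrib)
  also have "\<dots> \<le> 0"
  proof -
    have "0 \<le> (\<Prod>i<length us. w (us ! i, us ! (Suc i mod length us)))"
      using True w by (intro prod_nonneg) (auto intro: less_imp_le)
    moreover have "(\<Prod>i<length us. arc_sign (us ! i, us ! (Suc i mod length us))) = -1"
      using cycle_sign[OF us] True by blast
    ultimately show ?thesis by simp
  qed
  finally show ?thesis .
next
  case False
  then obtain i where "i < length us" "arc_weight w (us ! i) (us ! (Suc i mod length us)) = 0"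
    by (auto simp: arc_weight_def)
  then have "(\<Prod>i<length us. arc_weight w (us ! i) (us ! (Suc i mod length us))) = 0"
    by (intro prod_zero) auto
  then show ?thesis by (rule eq_refl)
qed

definition arc_monomial :: "complex \<Rightarrow> complex \<Rightarrow> (complex \<times> complex) multiset \<Rightarrow>\<^sub>0 real" where
  "arc_monomial U V = (if (U, V) \<in> edges G then Poly_Mapping.single {#(U, V)#} (arc_sign (U, V)) else 0)"

lemma poly_value_arc_monomial: "poly_value w (arc_monomial U V) = arc_weight w U V"
  by (simp add: arc_monomial_def arc_weight_def poly_value_single poly_value_zero)

text \<open>\<open>N\<close> and \<open>D\<close> are found before any weights are chosen.
  Evaluation is a ring homomorphism and commutes with the determinant, so positivity can be tested
  on the evaluated matrix.\<close>

lemma transfer_adjugate: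
  obtains N D where
    "\<And>U W. U \<in> verts (dg G) \<Longrightarrow> W \<in> verts (dg G) \<Longrightarrow>
      (\<Sum>V\<in>verts (dg G). N U V * (of_bool (V = W) - arc_monomial V W)) = (if U = W then D else 0)"
    "\<And>U W. U \<in> verts (dg G) \<Longrightarrow> W \<in> verts (dg G) \<Longrightarrow>
      (\<Sum>V\<in>verts (dg G). (of_bool (U = V) - arc_monomial U V) * N V W) = (if U = W then D else 0)"
    "\<And>w. \<forall>e\<in>edges G. 0 < w e \<Longrightarrow> 0 < poly_value w D"
proof -
  define n where "n = card (verts (dg G))"
  obtain h where h: "bij_betw h {..<n} (verts (dg G))"
    using ex_bij_betw_nat_finite[OF finite_verts] by (auto simp: n_def atLeast0LessThan)
  define D where "D = Determinant.det (Matrix.mat n n (\<lambda>(i, j). of_bool (h i = h j) - arc_monomial (h i) (h j)))"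
  obtain N where N: "\<And>U W. U \<in> verts (dg G) \<Longrightarrow> W \<in> verts (dg G) \<Longrightarrow>
      (\<Sum>V\<in>verts (dg G). N U V * (of_bool (V = W) - arc_monomial V W)) = (if U = W then D else 0)"
    "\<And>U W. U \<in> verts (dg G) \<Longrightarrow> W \<in> verts (dg G) \<Longrightarrow>
      (\<Sum>V\<in>verts (dg G). (of_bool (U = V) - arc_monomial U V) * N V W) = (if U = W then D else 0)"
    using adjugate_identities_on[OF h, of "\<lambda>U V. of_bool (U = V) - arc_monomial U V"] unfolding D_def by blast
  have "0 < poly_value w D" if w: "\<forall>e\<in>edges G. 0 < w e" for w
  proof -
    interpret comm_ring_hom "poly_value w" by (rule poly_value_hom)
    have inj: "h i = h j \<longleftrightarrow> i = j" if "i < n" "j < n" for i j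
      using h that by (auto simp: bij_betw_def inj_on_def)
    have "poly_value w D = Determinant.det (Matrix.mat n n (\<lambda>(i, j). of_bool (i = j) - arc_weight w (h i) (h j)))"
    proof -
      have "map_mat (poly_value w) (Matrix.mat n n (\<lambda>(i, j). of_bool (h i = h j) - arc_monomial (h i) (h j))) =
          Matrix.mat n n (\<lambda>(i, j). of_bool (i = j) - arc_weight w (h i) (h j))"
        by (rule eq_matI) (auto simp: inj hom_minus poly_value_arc_monomial)
      then show ?thesis unfolding D_def by (simp flip: hom_det)
    qed
    also have "\<dots> > 0"
    proof (rule det_one_minus_pos)
      fix cs :: "nat list" assume cs: "distinct cs" "cs \<noteq> []" "set cs \<subseteq> {..<n}"
      have "distinct (map h cs)" using cs h by (auto simp: distinct_map bij_betw_def intro: inj_on_subset)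
      from cycle_weight_nonpos[OF w this] cs
      have "(\<Prod>i<length cs. arc_weight w (map h cs ! i) (map h cs ! (Suc i mod length cs))) \<le> 0" by simp
      also have "(\<Prod>i<length cs. arc_weight w (map h cs ! i) (map h cs ! (Suc i mod length cs))) =
        (\<Prod>i<length cs. arc_weight w (h (cs ! i)) (h (cs ! (Suc i mod length cs))))"
        using cs by (intro prod.cong) auto
      finally show "(\<Prod>i<length cs. arc_weight w (h (cs ! i)) (h (cs ! (Suc i mod length cs)))) \<le> 0" .
    qed
    finally show ?thesis .
  qed
  with N show thesis by (rule that)
qed

end

context gauged_plabic_graph
begin

subsection \<open>Vertex vectors and Lam's relations\<close>

definition vertex_system ::
  "(complex \<times> complex \<Rightarrow> real) \<Rightarrow> (complex \<Rightarrow> 'a::real_vector) \<Rightarrow> (complex \<Rightarrow> 'a) \<Rightarrow> bool" where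
  "vertex_system w b y \<longleftrightarrow>
     (\<forall>U\<in>verts (dg G). y U = b U + (\<Sum>V\<in>verts (dg G). arc_weight w U V *\<^sub>R y V))"

lemma sum_arc_weight:
  fixes y :: "complex \<Rightarrow> 'a::real_vector"
  shows "(\<Sum>V\<in>verts (dg G). arc_weight w U V *\<^sub>R y V) =
   (\<Sum>e\<in>out_arcs (dg G) U. (arc_sign e * w e) *\<^sub>R y (snd e))"
proof -
  have "(\<Sum>V\<in>verts (dg G). arc_weight w U V *\<^sub>R y V) =
      (\<Sum>V\<in>{V \<in> verts (dg G). (U, V) \<in> edges G}. (arc_sign (U, V) * w (U, V)) *\<^sub>R y V)"
    using finite_verts by (intro sum.mono_neutral_cong_right) (auto simp: arc_weight_def split: if_splits)
  also have "\<dots> = (\<Sum>e\<in>out_arcs (dg G) U. (arc_sign e * w e) *\<^sub>R y (snd e))"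
    by (rule sum.reindex_bij_witness[of _ snd "\<lambda>V. (U, V)"]) (auto simp: in_out_arcs dest: edgeD[simplified])
  finally show ?thesis .
qed

lemma vertex_system_iff:
  "vertex_system w b y \<longleftrightarrow>
     (\<forall>U\<in>verts (dg G). y U = b U + (\<Sum>e\<in>out_arcs (dg G) U. (arc_sign e * w e) *\<^sub>R y (snd e)))"
  by (simp only: vertex_system_def sum_arc_weight)

lemma vertex_system_solution:
  fixes b y :: "complex \<Rightarrow> 'a::real_vector"
  assumes N: "\<And>U W. U \<in> verts (dg G) \<Longrightarrow> W \<in> verts (dg G) \<Longrightarrow>
      (\<Sum>V\<in>verts (dg G). N U V * (of_bool (V = W) - arc_weight w V W)) = (if U = W then d else 0)"
    "\<And>U W. U \<in> verts (dg G) \<Longrightarrow> W \<in> verts (dg G) \<Longrightarrow>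
      (\<Sum>V\<in>verts (dg G). (of_bool (U = V) - arc_weight w U V) * N V W) = (if U = W then d else 0)"
    and d: "d \<noteq> 0"
  shows "vertex_system w b y \<longleftrightarrow> (\<forall>U\<in>verts (dg G). y U = (\<Sum>V\<in>verts (dg G). (N U V / d) *\<^sub>R b V))"
proof -
  let ?V = "verts (dg G)"
  have pick: "(\<Sum>V\<in>?V. (of_bool (U = V) - arc_weight w U V) *\<^sub>R x V) =
      x U - (\<Sum>V\<in>?V. arc_weight w U V *\<^sub>R x V)" if "U \<in> ?V" for U and x :: "complex \<Rightarrow> 'a"
  proof -
    have "(\<Sum>V\<in>?V. of_bool (U = V) *\<^sub>R x V) = (\<Sum>V\<in>?V. if V = U then x U else 0)"
      by (intro sum.cong) auto
    also have "\<dots> = x U" using that finite_verts by simp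
    finally show ?thesis by (simp add: scaleR_diff_left sum_subtractf)
  qed
  have sel: "(\<Sum>W\<in>?V. (if U = W then d else 0) *\<^sub>R x W) = d *\<^sub>R x U" if "U \<in> ?V" for U and x :: "complex \<Rightarrow> 'a"
  proof -
    have "(\<Sum>W\<in>?V. (if U = W then d else 0) *\<^sub>R x W) = (\<Sum>W\<in>?V. if W = U then d *\<^sub>R x U else 0)"
      by (intro sum.cong) auto
    then show ?thesis using that finite_verts by simp
  qed
  have sys: "vertex_system w b y \<longleftrightarrow> (\<forall>U\<in>?V. (\<Sum>V\<in>?V. (of_bool (U = V) - arc_weight w U V) *\<^sub>R y V) = b U)"
    unfolding vertex_system_def by (intro ball_cong refl) (simp only: pick diff_eq_eq)
  show ?thesis
  proof
    assume "vertex_system w b y"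
    then have b: "b U = (\<Sum>V\<in>?V. (of_bool (U = V) - arc_weight w U V) *\<^sub>R y V)" if "U \<in> ?V" for U
      using sys that by simp
    show "\<forall>U\<in>?V. y U = (\<Sum>V\<in>?V. (N U V / d) *\<^sub>R b V)"
    proof
      fix U assume U: "U \<in> ?V"
      have "(\<Sum>V\<in>?V. N U V *\<^sub>R b V) = (\<Sum>V\<in>?V. \<Sum>W\<in>?V. (N U V * (of_bool (V = W) - arc_weight w V W)) *\<^sub>R y W)"
        by (intro sum.cong) (simp_all add: b scaleR_sum_right)
      also have "\<dots> = (\<Sum>W\<in>?V. (\<Sum>V\<in>?V. N U V * (of_bool (V = W) - arc_weight w V W)) *\<^sub>R y W)"
        by (subst sum.swap) (simp only: scaleR_sum_left)
      also have "\<dots> = (\<Sum>W\<in>?V. (if U = W then d else 0) *\<^sub>R y W)"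
        by (intro sum.cong) (simp_all only: N(1)[OF U])
      also have "\<dots> = d *\<^sub>R y U" by (rule sel[OF U])
      finally have "(\<Sum>V\<in>?V. N U V *\<^sub>R b V) = d *\<^sub>R y U" .
      then have "inverse d *\<^sub>R (\<Sum>V\<in>?V. N U V *\<^sub>R b V) = y U" using d by simp
      then show "y U = (\<Sum>V\<in>?V. (N U V / d) *\<^sub>R b V)"
        by (simp add: scaleR_sum_right divide_inverse mult.commute)
    qed
  next
    assume y: "\<forall>U\<in>?V. y U = (\<Sum>V\<in>?V. (N U V / d) *\<^sub>R b V)"
    have "(\<Sum>V\<in>?V. (of_bool (U = V) - arc_weight w U V) *\<^sub>R y V) = b U" if U: "U \<in> ?V" for U
    proof -
      have "d *\<^sub>R (\<Sum>V\<in>?V. (of_bool (U = V) - arc_weight w U V) *\<^sub>R y V) =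
          (\<Sum>V\<in>?V. \<Sum>W\<in>?V. ((of_bool (U = V) - arc_weight w U V) * N V W) *\<^sub>R b W)"
        unfolding scaleR_sum_right
        by (intro sum.cong) (use y d in \<open>simp_all add: scaleR_sum_right ac_simps\<close>)
      also have "\<dots> = (\<Sum>W\<in>?V. (\<Sum>V\<in>?V. (of_bool (U = V) - arc_weight w U V) * N V W) *\<^sub>R b W)"
        by (subst sum.swap) (simp only: scaleR_sum_left)
      also have "\<dots> = (\<Sum>W\<in>?V. (if U = W then d else 0) *\<^sub>R b W)"
        by (intro sum.cong) (simp_all only: N(2)[OF U])
      also have "\<dots> = d *\<^sub>R b U" by (rule sel[OF U])
      finally show ?thesis using d by simp
    qed
    then show "vertex_system w b y" unfolding sys by blast
  qed
qed

text \<open>The polynomial identity is exported together with the solution formula, because the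
  formal computation of the boundary measurements has to use the same \<open>N\<close> and
  \<open>D\<close>.\<close>

lemma transfer_inverse:
  obtains N D where
    "\<And>U W. U \<in> verts (dg G) \<Longrightarrow> W \<in> verts (dg G) \<Longrightarrow>
      (\<Sum>V\<in>verts (dg G). N U V * (of_bool (V = W) - arc_monomial V W)) = (if U = W then D else 0)"
    "\<And>w. \<forall>e\<in>edges G. 0 < w e \<Longrightarrow> 0 < poly_value w D"
    "\<And>w b (y :: complex \<Rightarrow> 'a::real_vector). \<forall>e\<in>edges G. 0 < w e \<Longrightarrow> vertex_system w b y \<longleftrightarrow>
      (\<forall>U\<in>verts (dg G). y U = (\<Sum>V\<in>verts (dg G). (poly_value w (N U V) / poly_value w D) *\<^sub>R b V))"
proof -
  obtain N D where N: "\<And>U W. U \<in> verts (dg G) \<Longrightarrow> W \<in> verts (dg G) \<Longrightarrow>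
      (\<Sum>V\<in>verts (dg G). N U V * (of_bool (V = W) - arc_monomial V W)) = (if U = W then D else 0)"
    "\<And>U W. U \<in> verts (dg G) \<Longrightarrow> W \<in> verts (dg G) \<Longrightarrow>
      (\<Sum>V\<in>verts (dg G). (of_bool (U = V) - arc_monomial U V) * N V W) = (if U = W then D else 0)"
    and pos: "\<And>w. \<forall>e\<in>edges G. 0 < w e \<Longrightarrow> 0 < poly_value w D"
    by (rule transfer_adjugate) (rule that)
  show thesis
  proof (rule that[OF N(1) pos])
    fix w :: "complex \<times> complex \<Rightarrow> real" and b y :: "complex \<Rightarrow> 'a"
    assume w: "\<forall>e\<in>edges G. 0 < w e"
    interpret comm_ring_hom "poly_value w" by (rule poly_value_hom)
    have ob: "poly_value w (of_bool P) = of_bool P" for P by (cases P) auto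
    have entry: "poly_value w (of_bool P - arc_monomial U V) = of_bool P - arc_weight w U V" for P U V
      by (simp only: hom_minus poly_value_arc_monomial ob)
    show "vertex_system w b y \<longleftrightarrow>
      (\<forall>U\<in>verts (dg G). y U = (\<Sum>V\<in>verts (dg G). (poly_value w (N U V) / poly_value w D) *\<^sub>R b V))"
    proof (rule vertex_system_solution)
      show "(\<Sum>V\<in>verts (dg G). poly_value w (N U V) * (of_bool (V = W) - arc_weight w V W)) =
          (if U = W then poly_value w D else 0)" if "U \<in> verts (dg G)" "W \<in> verts (dg G)" for U W
        using arg_cong[OF N(1)[OF that], of "poly_value w"] by (cases "U = W") (simp_all add: hom_sum hom_mult entry hom_zero)
      show "(\<Sum>V\<in>verts (dg G). (of_bool (U = V) - arc_weight w U V) * poly_value w (N V W)) =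
          (if U = W then poly_value w D else 0)" if "U \<in> verts (dg G)" "W \<in> verts (dg G)" for U W
        using arg_cong[OF N(2)[OF that], of "poly_value w"] by (cases "U = W") (simp_all add: hom_sum hom_mult entry hom_zero)
      show "poly_value w D \<noteq> 0" using pos[OF w] by simp
    qed
  qed
qed

lemma vertex_system_ex_unique:
  fixes b :: "complex \<Rightarrow> 'a::real_vector"
  assumes "\<forall>e\<in>edges G. 0 < w e"
  obtains y where "vertex_system w b y" "\<And>y'. vertex_system w b y' \<Longrightarrow> \<forall>U\<in>verts (dg G). y' U = y U"
proof -
  obtain N D where "\<And>U W. U \<in> verts (dg G) \<Longrightarrow> W \<in> verts (dg G) \<Longrightarrow>
      (\<Sum>V\<in>verts (dg G). N U V * (of_bool (V = W) - arc_monomial V W)) = (if U = W then D else 0)"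
    "\<And>w. \<forall>e\<in>edges G. 0 < w e \<Longrightarrow> 0 < poly_value w D"
    and *: "\<And>w b (y :: complex \<Rightarrow> 'a). \<forall>e\<in>edges G. 0 < w e \<Longrightarrow> vertex_system w b y \<longleftrightarrow>
      (\<forall>U\<in>verts (dg G). y U = (\<Sum>V\<in>verts (dg G). (poly_value w (N U V) / poly_value w D) *\<^sub>R b V))"
    by (rule transfer_inverse[where 'a = 'a]) (rule that)
  show thesis
    by (rule that[of "\<lambda>U. \<Sum>V\<in>verts (dg G). (poly_value w (N U V) / poly_value w D) *\<^sub>R b V"])
      (simp_all add: *[OF assms])
qed

abbreviation signature :: "complex \<times> complex \<Rightarrow> nat" where
  "signature \<equiv> geometric_signature G l"

text \<open>Among the vertices, exactly the sinks have no outgoing edge; at all others the system is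
  homogeneous.\<close>

definition boundary_data :: "('n \<Rightarrow> 'a::zero) \<Rightarrow> complex \<Rightarrow> 'a" where
  "boundary_data b U = (if out_arcs (dg G) U = {} then b (label G U) else 0)"

definition half_edges_of ::
  "(complex \<times> complex \<Rightarrow> real) \<Rightarrow> (complex \<Rightarrow> (real, 'n) vec) \<Rightarrow> complex \<Rightarrow> complex \<times> complex \<Rightarrow> (real, 'n) vec" where
  "half_edges_of w y U e = (if snd e = U then y U else ((-1) ^ signature e * w e) *\<^sub>R y (snd e))"

definition vertex_vectors_of ::
  "('n \<Rightarrow> (real, 'n) vec) \<Rightarrow> (complex \<Rightarrow> complex \<times> complex \<Rightarrow> (real, 'n) vec) \<Rightarrow> complex \<Rightarrow> (real, 'n) vec" where
  "vertex_vectors_of b z U =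
     (if U \<in> internal G then if U \<in> white G then z U (in_edge G U) else z U (out_edge G U)
      else if label G U \<in> sources G then - z U (out_edge G U) else b (label G U))"

lemma source_out_edge: "i \<in> sources G \<Longrightarrow> out_arcs (dg G) (bdry G i) = {out_edge G (bdry G i)}"
  by (erule source_arcs) (simp add: out_edge_def)

lemma sum_edges_at:
  "(\<Sum>e\<in>edges_at G v. f e) = (\<Sum>e\<in>in_arcs (dg G) v. f e) + (\<Sum>e\<in>out_arcs (dg G) v. f e)"
  unfolding edges_at_def
  by (rule sum.union_disjoint[OF finite_in_out_arcs]) (auto simp: in_out_arcs dest: edgeD[simplified])

text \<open>Values of a family away from the ends of edges are meaningless, so solutions can be
  compared only on true half-edges.\<close>

lemma lam_sink_cong:
  assumes z: "\<forall>U\<in>verts (dg G). \<forall>e\<in>edges_at G U. z U e = z' U e"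
  shows "lam_system G w \<epsilon> z \<and> sink_values G b z \<longleftrightarrow> lam_system G w \<epsilon> z' \<and> sink_values G b z'"
proof -
  have "z U (U, V) = z' U (U, V)" "z V (U, V) = z' V (U, V)" if "(U, V) \<in> edges G" for U V
    using z edgeD[OF that] that by (auto simp: edges_at_iff)
  then have 1: "(\<forall>(U, V)\<in>edges G. z U (U, V) = ((-1) ^ \<epsilon> (U, V) * w (U, V)) *\<^sub>R z V (U, V)) \<longleftrightarrow>
      (\<forall>(U, V)\<in>edges G. z' U (U, V) = ((-1) ^ \<epsilon> (U, V) * w (U, V)) *\<^sub>R z' V (U, V))" by auto
  have at: "z v e = z' v e" if "v \<in> internal G" "e \<in> edges_at G v" for v e
    using z that internal_vert by blast
  have 2: "(\<Sum>e\<in>edges_at G v. z v e) = (\<Sum>e\<in>edges_at G v. z' v e)" if "v \<in> internal G" for v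
    by (intro sum.cong refl at that)
  have 3: "(\<forall>e\<in>edges_at G v. \<forall>e'\<in>edges_at G v. z v e = z v e') \<longleftrightarrow>
      (\<forall>e\<in>edges_at G v. \<forall>e'\<in>edges_at G v. z' v e = z' v e')" if "v \<in> internal G" for v
    using at[OF that] by auto
  have "z (bdry G j) e = z' (bdry G j) e" if "e \<in> edges_at G (bdry G j)" for j e
    using z that bdry_vert by blast
  then have 4: "sink_values G b z \<longleftrightarrow> sink_values G b z'"
    unfolding sink_values_def by auto
  show ?thesis unfolding lam_system_def 1 4 using 2 3 by auto
qed

text \<open>The head half-edge always carries the vertex vector: a white vertex has one incoming
  edge, at a black one all half-edges agree, and at a sink the value is prescribed. Relation (i)
  then fixes the tail half-edges, which turns the relations at the vertices into the vertex
  equations.\<close>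

lemma lam_imp_vertex_system:
  assumes lam: "lam_system G w signature z" and sink: "sink_values G b z"
  defines "y \<equiv> vertex_vectors_of b z"
  shows "vertex_system w (boundary_data b) y"
    and "\<And>U e. e \<in> edges_at G U \<Longrightarrow> z U e = half_edges_of w y U e"
proof -
  have rel: "z (fst e) e = ((-1) ^ signature e * w e) *\<^sub>R z (snd e) e" if "e \<in> edges G" for e
    using lam that by (cases e) (auto simp: lam_system_def)
  have white: "(\<Sum>e\<in>edges_at G v. z v e) = 0" if "v \<in> internal G" "v \<in> white G" for v
    using lam that by (auto simp: lam_system_def)
  have black: "z v e = z v (out_edge G v)" if "v \<in> internal G" "v \<notin> white G" "e \<in> edges_at G v" for v e
    using lam that black_out_arcs[OF that(1,2)] unfolding lam_system_def edges_at_def by blast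
  have at_head: "z (snd e) e = y (snd e)" if e: "e \<in> edges G" for e
  proof (cases "snd e \<in> internal G")
    case True
    have "e \<in> in_arcs (dg G) (snd e)" using e by (simp add: in_out_arcs)
    then have "e = in_edge G (snd e)" if "snd e \<in> white G" using white_in_arcs[OF True that] by blast
    then show ?thesis
      using True black[of "snd e" e] e
      by (auto simp: y_def vertex_vectors_of_def edges_at_iff)
  next
    case False
    then obtain j where j: "snd e = bdry G j" using edgeD(2)[OF e] by (auto simp: internal_def)
    have "j \<notin> sources G"
    proof
      assume "j \<in> sources G"
      then have "in_arcs (dg G) (bdry G j) = {}" by (rule source_arcs)
      moreover have "e \<in> in_arcs (dg G) (bdry G j)" using e j by (simp add: in_out_arcs)
      ultimately show False by blast
    qed
    then show ?thesis using sink e j by (auto simp: sink_values_def y_def vertex_vectors_of_def edges_at_iff)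
  qed
  have at_tail: "z (fst e) e = ((-1) ^ signature e * w e) *\<^sub>R y (snd e)" if "e \<in> edges G" for e
    using rel[OF that] at_head[OF that] by simp
  show "z U e = half_edges_of w y U e" if "e \<in> edges_at G U" for U e
    using that at_head[of e] at_tail[of e] by (auto simp: edges_at_iff half_edges_of_def)
  have "y U = boundary_data b U + (\<Sum>e\<in>out_arcs (dg G) U. (arc_sign e * w e) *\<^sub>R y (snd e))" (is "_ = _ + ?s")
    if U: "U \<in> verts (dg G)" for U
  proof -
    have out: "out_arcs (dg G) U = {e} \<Longrightarrow> e \<in> edges G \<and> fst e = U" for e
      by (auto simp: in_out_arcs)
    consider "U \<in> internal G" "U \<in> white G" | "U \<in> internal G" "U \<notin> white G"
      | i where "U = bdry G i" "i \<in> sources G" | i where "U = bdry G i" "i \<notin> sources G"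
      using U by (cases U rule: vert_cases) auto
    then show ?thesis
    proof cases
      case 1
      have "y U + (\<Sum>e\<in>out_arcs (dg G) U. z U e) = 0"
        using white[OF 1] white_in_arcs[OF 1] 1 by (simp add: sum_edges_at y_def vertex_vectors_of_def)
      moreover have "(\<Sum>e\<in>out_arcs (dg G) U. z U e) = (\<Sum>e\<in>out_arcs (dg G) U. - ((arc_sign e * w e) *\<^sub>R y (snd e)))"
        by (intro sum.cong) (use at_tail 1 in \<open>auto simp: in_out_arcs geometric_signature_sign vertex_sign_def\<close>)
      ultimately have "y U = ?s" by (simp add: sum_negf)
      then show ?thesis using internal_out_arcs[OF 1(1)] by (simp add: boundary_data_def)
    next
      case 2
      note oe = black_out_arcs[OF 2]
      from out[OF oe] at_tail[of "out_edge G U"] 2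
      have "y U = ?s"
        unfolding oe by (simp add: y_def vertex_vectors_of_def geometric_signature_sign vertex_sign_def)
      then show ?thesis using oe by (simp add: boundary_data_def)
    next
      case (3 i)
      note oe = source_out_edge[OF 3(2), folded 3(1)]
      from out[OF oe] at_tail[of "out_edge G U"] 3
      have "y U = ?s"
        unfolding oe by (simp add: y_def vertex_vectors_of_def geometric_signature_sign vertex_sign_def)
      then show ?thesis using oe by (simp add: boundary_data_def)
    next
      case (4 i)
      then have "out_arcs (dg G) U = {}" by (simp add: source_iff del: in_out_arcs_conv)
      then show ?thesis using 4 by (simp add: y_def vertex_vectors_of_def boundary_data_def)
    qed
  qed
  then show "vertex_system w (boundary_data b) y" unfolding vertex_system_iff by blast
qed

lemma vertex_system_imp_lam:
  assumes sys: "vertex_system w (boundary_data b) y"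
  shows "lam_system G w signature (half_edges_of w y)" "sink_values G b (half_edges_of w y)"
proof -
  have y: "y U = boundary_data b U + (\<Sum>e\<in>out_arcs (dg G) U. (arc_sign e * w e) *\<^sub>R y (snd e))"
    if "U \<in> verts (dg G)" for U
    using sys that unfolding vertex_system_iff by blast
  have head: "half_edges_of w y (snd e) e = y (snd e)" for e
    by (simp add: half_edges_of_def)
  have tail: "half_edges_of w y (fst e) e = ((-1) ^ signature e * w e) *\<^sub>R y (snd e)" if "e \<in> edges G" for e
    using edgeD(3)[OF that] by (simp add: half_edges_of_def)
  have 1: "\<forall>(U, V)\<in>edges G. half_edges_of w y U (U, V) = ((-1) ^ signature (U, V) * w (U, V)) *\<^sub>R half_edges_of w y V (U, V)"
    using head tail by fastforce
  have 2: "(\<Sum>e\<in>edges_at G v. half_edges_of w y v e) = 0" if v: "v \<in> internal G" "v \<in> white G" for v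
  proof -
    have "(\<Sum>e\<in>in_arcs (dg G) v. half_edges_of w y v e) = y v"
    proof -
      have "in_edge G v \<in> in_arcs (dg G) v" using white_in_arcs[OF v] by blast
      then have "snd (in_edge G v) = v" by (simp add: in_out_arcs)
      then show ?thesis unfolding white_in_arcs[OF v] by (simp add: half_edges_of_def)
    qed
    moreover have "(\<Sum>e\<in>out_arcs (dg G) v. half_edges_of w y v e) = - (\<Sum>e\<in>out_arcs (dg G) v. (arc_sign e * w e) *\<^sub>R y (snd e))"
      unfolding sum_negf[symmetric]
      by (intro sum.cong) (use tail v in \<open>auto simp: in_out_arcs geometric_signature_sign vertex_sign_def\<close>)
    moreover have "y v = (\<Sum>e\<in>out_arcs (dg G) v. (arc_sign e * w e) *\<^sub>R y (snd e))"
      using y[OF internal_vert[OF v(1)]] internal_out_arcs[OF v(1)] by (simp add: boundary_data_def)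
    ultimately show ?thesis by (simp add: sum_edges_at)
  qed
  have 3: "half_edges_of w y v e = y v" if v: "v \<in> internal G" "v \<notin> white G" and e: "e \<in> edges_at G v" for v e
  proof (cases "snd e = v")
    case True
    then show ?thesis by (simp add: half_edges_of_def)
  next
    case False
    then have "e \<in> out_arcs (dg G) v" using e by (auto simp: edges_at_def in_out_arcs)
    then have oe: "out_arcs (dg G) v = {e}" using black_out_arcs[OF v] by auto
    have "y v = (arc_sign e * w e) *\<^sub>R y (snd e)"
      using y[OF internal_vert[OF v(1)]] unfolding boundary_data_def oe by simp
    then show ?thesis
      using False v e by (auto simp: half_edges_of_def geometric_signature_sign vertex_sign_def edges_at_iff)
  qed
  show "lam_system G w signature (half_edges_of w y)"
    unfolding lam_system_def using 1 2 3 by simp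
  show "sink_values G b (half_edges_of w y)"
    unfolding sink_values_def
  proof (intro allI impI ballI)
    fix j e assume j: "j \<notin> sources G" and e: "e \<in> edges_at G (bdry G j)"
    have o: "out_arcs (dg G) (bdry G j) = {}" using j by (simp add: source_iff del: in_out_arcs_conv)
    then have "e \<in> in_arcs (dg G) (bdry G j)" using e by (auto simp: edges_at_def)
    then have "snd e = bdry G j" by (simp add: in_out_arcs)
    moreover have "y (bdry G j) = b j" using y[OF bdry_vert, of j] unfolding boundary_data_def o by simp
    ultimately show "half_edges_of w y (bdry G j) e = b j" by (simp add: half_edges_of_def)
  qed
qed

text \<open>Full rank, the edge vectors and the values at the sources are all read off from this
  description of the solutions.\<close>

lemma lam_solution:
  assumes w: "\<forall>e\<in>edges G. 0 < w e"
  obtains y where "vertex_system w (boundary_data b) y"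
    "\<And>z. lam_system G w signature z \<and> sink_values G b z \<longleftrightarrow>
       (\<forall>U\<in>verts (dg G). \<forall>e\<in>edges_at G U. z U e = half_edges_of w y U e)"
proof -
  obtain y where y: "vertex_system w (boundary_data b) y"
    and uniq: "\<And>y'. vertex_system w (boundary_data b) y' \<Longrightarrow> \<forall>U\<in>verts (dg G). y' U = y U"
    by (rule vertex_system_ex_unique[OF w]) (rule that)
  show thesis
  proof (rule that[OF y])
    fix z :: "complex \<Rightarrow> complex \<times> complex \<Rightarrow> (real, 'n) vec"
    show "lam_system G w signature z \<and> sink_values G b z \<longleftrightarrow>
       (\<forall>U\<in>verts (dg G). \<forall>e\<in>edges_at G U. z U e = half_edges_of w y U e)"
    proof
      assume "lam_system G w signature z \<and> sink_values G b z"
      then have lam: "lam_system G w signature z" "sink_values G b z" by auto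
      have "vertex_system w (boundary_data b) (vertex_vectors_of b z)"
        and z: "\<And>U e. e \<in> edges_at G U \<Longrightarrow> z U e = half_edges_of w (vertex_vectors_of b z) U e"
        by (rule lam_imp_vertex_system[OF lam])+
      then have "vertex_vectors_of b z U = y U" if "U \<in> verts (dg G)" for U using uniq that by blast
      then have "half_edges_of w (vertex_vectors_of b z) U e = half_edges_of w y U e" if "e \<in> edges_at G U" for U e
        using that edgeD(2)[of e] by (auto simp: half_edges_of_def edges_at_iff)
      then show "\<forall>U\<in>verts (dg G). \<forall>e\<in>edges_at G U. z U e = half_edges_of w y U e" using z by simp
    next
      assume z: "\<forall>U\<in>verts (dg G). \<forall>e\<in>edges_at G U. z U e = half_edges_of w y U e"
      note lam = vertex_system_imp_lam[OF y]
      show "lam_system G w signature z \<and> sink_values G b z"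
        by (rule lam_sink_cong[THEN iffD2, OF z]) (use lam in blast)
    qed
  qed
qed

end

section \<open>Edge vectors\<close>

text \<open>At a white vertex \<open>half_edge_vectors\<close> takes the winding from the outgoing
  to the incoming edge, the signature takes it in the direction of travel; the antisymmetry shows
  that the parities agree.\<close>

lemma wind_swap: "wind l e f = - wind l f e"
proof -
  have "s_index x y = - s_index y x" for x y
    using det2_skew[of x y] by (simp add: s_index_def)
  from this[of "evec f" "evec e"] this[of "evec f" l] this[of l "evec e"] show ?thesis
    by (auto simp: wind_def)
qed

context gauged_plabic_graph
begin

lemma sign_squares [simp]:
  "out_wind_sign e * out_wind_sign e = 1" "in_wind_sign e * in_wind_sign e = 1"
  "vertex_sign v * vertex_sign v = 1" "((-1 :: real) powi k) * ((-1) powi k) = 1"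
  by (auto simp: out_wind_sign_def in_wind_sign_def vertex_sign_def minus_one_powi)

lemma half_edge_vectors_tail:
  assumes e: "e \<in> edges G"
  shows "half_edge_vectors G l w F (fst e) e = (vertex_sign (fst e) * out_wind_sign e) *\<^sub>R F e"
proof -
  have eo: "e \<in> out_arcs (dg G) (fst e)" using e by (simp add: in_out_arcs)
  consider "fst e \<in> internal G" "fst e \<in> white G" | "fst e \<in> internal G" "fst e \<notin> white G"
    | i where "fst e = bdry G i"
    using edgeD(1)[OF e] by (cases rule: vert_cases) auto
  then show ?thesis
  proof cases
    case 1
    have "e \<noteq> in_edge G (fst e)"
    proof
      assume "e = in_edge G (fst e)"
      then have "e \<in> in_arcs (dg G) (fst e)" using white_in_arcs[OF 1] by blast
      then show False using edgeD(3)[OF e] by (simp add: in_out_arcs)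
    qed
    then show ?thesis
      using 1 wind_swap[of l e] by (simp add: half_edge_vectors_def vertex_sign_def out_wind_sign_def minus_one_powi)
  next
    case 2
    have "e = out_edge G (fst e)" using eo black_out_arcs[OF 2] by blast
    then show ?thesis using 2 by (simp add: half_edge_vectors_def vertex_sign_def out_wind_sign_def)
  next
    case (3 i)
    then have "out_arcs (dg G) (bdry G i) \<noteq> {}" using eo by auto
    then have "i \<in> sources G" by (simp only: source_iff not_False_eq_True)
    then show ?thesis using 3 by (simp add: half_edge_vectors_def vertex_sign_def out_wind_sign_def)
  qed
qed

lemma half_edge_vectors_head:
  assumes e: "e \<in> edges G" and int: "snd e \<in> internal G"
  shows "half_edge_vectors G l w F (snd e) e =
    ((-1) powi int_index G l e * in_wind_sign e * inverse (w e)) *\<^sub>R F e"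
proof -
  have ei: "e \<in> in_arcs (dg G) (snd e)" using e by (simp add: in_out_arcs)
  show ?thesis
  proof (cases "snd e \<in> white G")
    case True
    have "e = in_edge G (snd e)" using ei white_in_arcs[OF int True] by blast
    then show ?thesis using int True by (simp add: half_edge_vectors_def in_wind_sign_def)
  next
    case False
    have "e \<noteq> out_edge G (snd e)"
    proof
      assume "e = out_edge G (snd e)"
      then have "e \<in> out_arcs (dg G) (snd e)" using black_out_arcs[OF int False] by blast
      then show False using edgeD(3)[OF e] by (simp add: in_out_arcs)
    qed
    then show ?thesis using int False by (simp add: half_edge_vectors_def in_wind_sign_def powi_add)
  qed
qed

lemma head_cases:
  assumes e: "e \<in> edges G"
  obtains "snd e \<in> internal G" | j where "snd e = bdry G j" "j \<notin> sources G"
proof -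
  have sink: "j \<notin> sources G" if "snd e = bdry G j" for j
  proof
    assume "j \<in> sources G"
    then have "in_arcs (dg G) (bdry G j) = {}" by (rule source_arcs)
    moreover have "e \<in> in_arcs (dg G) (bdry G j)" using e that by (simp add: in_out_arcs)
    ultimately show False by blast
  qed
  show thesis
    by (rule vert_cases[OF edgeD(2)[OF e]]) (use that sink in blast)+
qed

text \<open>At a bivalent vertex the equation of either colour reduces to the bivalent one, so the
  conditions can be sorted by colour alone, as in Lam's relations.\<close>

lemma edge_vector_system_iff:
  "edge_vector_system G l w F \<longleftrightarrow>
     (\<forall>j. \<forall>e\<in>in_arcs (dg G) (bdry G j). F e = ((-1) powi int_index G l e * w e) *\<^sub>R axis j 1) \<and>
     (\<forall>v\<in>internal G. v \<in> white G \<longrightarrow> F (in_edge G v) = (\<Sum>f\<in>out_arcs (dg G) v.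
           ((-1) powi (int_index G l (in_edge G v) + wind l (in_edge G v) f) * w (in_edge G v)) *\<^sub>R F f)) \<and>
     (\<forall>v\<in>internal G. v \<notin> white G \<longrightarrow> (\<forall>e\<in>in_arcs (dg G) v.
           F e = ((-1) powi (int_index G l e + wind l e (out_edge G v)) * w e) *\<^sub>R F (out_edge G v)))"
proof -
  let ?W = "\<lambda>v. F (in_edge G v) = (\<Sum>f\<in>out_arcs (dg G) v.
           ((-1) powi (int_index G l (in_edge G v) + wind l (in_edge G v) f) * w (in_edge G v)) *\<^sub>R F f)"
  let ?B = "\<lambda>v. \<forall>e\<in>in_arcs (dg G) v.
           F e = ((-1) powi (int_index G l e + wind l e (out_edge G v)) * w e) *\<^sub>R F (out_edge G v)"
  let ?D = "\<lambda>v. \<forall>e\<in>in_arcs (dg G) v. \<forall>f\<in>out_arcs (dg G) v.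
           F e = ((-1) powi (int_index G l e + wind l e f) * w e) *\<^sub>R F f"
  have D_white: "?D v \<longleftrightarrow> ?W v" if v: "v \<in> internal G" "v \<in> white G" "degree G v = 2" for v
  proof -
    have "card (out_arcs (dg G) v) = 1"
      using v(3) white_in_arcs[OF v(1,2)] by (simp add: degree_def in_degree_def out_degree_def)
    then obtain f where f: "out_arcs (dg G) v = {f}" by (rule card_1_singletonE)
    show ?thesis unfolding white_in_arcs[OF v(1,2)] f by simp
  qed
  have D_black: "?D v \<longleftrightarrow> ?B v" if v: "v \<in> internal G" "v \<notin> white G" for v
    unfolding black_out_arcs[OF v] by simp
  have deg: "degree G v = 3 \<longleftrightarrow> degree G v \<noteq> 2" if "v \<in> internal G" for v
    using internal_degree[OF that] by auto
  have iff: "(\<forall>v\<in>internal G. degree G v = 2 \<longrightarrow> ?D v) \<and> (\<forall>v\<in>internal G. degree G v = 3 \<and> v \<notin> white G \<longrightarrow> ?B v) \<and>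
      (\<forall>v\<in>internal G. degree G v = 3 \<and> v \<in> white G \<longrightarrow> ?W v) \<longleftrightarrow>
      (\<forall>v\<in>internal G. v \<in> white G \<longrightarrow> ?W v) \<and> (\<forall>v\<in>internal G. v \<notin> white G \<longrightarrow> ?B v)" (is "?L \<longleftrightarrow> ?R")
  proof
    assume L: ?L
    have "?W v" if "v \<in> internal G" "v \<in> white G" for v
      using L deg[OF that(1)] D_white[OF that] that by (cases "degree G v = 2") blast+
    moreover have "?B v" if "v \<in> internal G" "v \<notin> white G" for v
      using L deg[OF that(1)] D_black[OF that] that by (cases "degree G v = 2") blast+
    ultimately show ?R by blast
  next
    assume R: ?R
    have "?D v" if "v \<in> internal G" "degree G v = 2" for v
      using R D_white[of v] D_black[of v] that by (cases "v \<in> white G") blast+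
    then show ?L using R by blast
  qed
  show ?thesis unfolding edge_vector_system_def by (rule arg_cong2[where f = "(\<and>)", OF refl iff])
qed

text \<open>At an edge with internal head relation (i) holds identically, because every sign occurs
  twice and the weight cancels. At an edge into a sink it is the boundary equation, and the white
  and black relations are the vertex equations up to a nonzero factor.\<close>

lemma edge_vector_system_iff_lam:
  assumes w: "\<forall>e\<in>edges G. 0 < w e"
  shows "edge_vector_system G l w F \<longleftrightarrow> lam_system G w signature (half_edge_vectors G l w F)"
proof -
  let ?H = "half_edge_vectors G l w F"
  have sgn0: "vertex_sign v \<noteq> 0" "out_wind_sign e \<noteq> 0" "in_wind_sign e \<noteq> 0" for v e
    by (auto simp: vertex_sign_def out_wind_sign_def in_wind_sign_def minus_one_powi)
  have edge: "?H (fst e) e = ((-1) ^ signature e * w e) *\<^sub>R ?H (snd e) e \<longleftrightarrow>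
      (\<forall>j. snd e = bdry G j \<longrightarrow> F e = ((-1) powi int_index G l e * w e) *\<^sub>R axis j 1)" if e: "e \<in> edges G" for e
  proof (cases rule: head_cases[OF e])
    case 1
    have w0: "w e \<noteq> 0" using w e by force
    have "((-1) ^ signature e * w e) *\<^sub>R ?H (snd e) e =
      (vertex_sign (fst e) * out_wind_sign e * (((-1) powi int_index G l e) * ((-1) powi int_index G l e)) *
        (in_wind_sign e * in_wind_sign e) * (w e * inverse (w e))) *\<^sub>R F e"
      unfolding half_edge_vectors_head[OF e 1] geometric_signature_sign arc_sign_def scaleR_scaleR
      by (simp only: ac_simps)
    then have "?H (fst e) e = ((-1) ^ signature e * w e) *\<^sub>R ?H (snd e) e"
      unfolding half_edge_vectors_tail[OF e] sign_squares using w0 by simp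
    then show ?thesis using 1 by auto
  next
    case (2 j)
    have "?H (snd e) e = axis j 1" using 2 by (simp add: half_edge_vectors_def)
    moreover have "in_wind_sign e = 1" using 2 by (simp add: in_wind_sign_def)
    ultimately have "((-1) ^ signature e * w e) *\<^sub>R ?H (snd e) e =
        (vertex_sign (fst e) * out_wind_sign e) *\<^sub>R (((-1) powi int_index G l e * w e) *\<^sub>R axis j 1)"
      by (simp add: geometric_signature_sign arc_sign_def ac_simps)
    then have "?H (fst e) e = ((-1) ^ signature e * w e) *\<^sub>R ?H (snd e) e \<longleftrightarrow>
        F e = ((-1) powi int_index G l e * w e) *\<^sub>R axis j 1"
      unfolding half_edge_vectors_tail[OF e] using sgn0 by (simp only: scaleR_cancel_left) simp
    then show ?thesis using 2 by (auto simp: bdry_eq_iff)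
  qed
  have 1: "(\<forall>(U, V)\<in>edges G. ?H U (U, V) = ((-1) ^ signature (U, V) * w (U, V)) *\<^sub>R ?H V (U, V)) \<longleftrightarrow>
     (\<forall>j. \<forall>e\<in>in_arcs (dg G) (bdry G j). F e = ((-1) powi int_index G l e * w e) *\<^sub>R axis j 1)"
    (is "?A \<longleftrightarrow> ?B")
  proof -
    have "?A \<longleftrightarrow> (\<forall>e\<in>edges G. ?H (fst e) e = ((-1) ^ signature e * w e) *\<^sub>R ?H (snd e) e)"
      by (auto simp: split_def)
    also have "\<dots> \<longleftrightarrow> (\<forall>e\<in>edges G. \<forall>j. snd e = bdry G j \<longrightarrow> F e = ((-1) powi int_index G l e * w e) *\<^sub>R axis j 1)"
      by (intro ball_cong refl edge)
    also have "\<dots> \<longleftrightarrow> ?B" by (auto simp: in_out_arcs)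
    finally show ?thesis .
  qed
  have 2: "(\<Sum>e\<in>edges_at G v. ?H v e) = 0 \<longleftrightarrow> F (in_edge G v) = (\<Sum>f\<in>out_arcs (dg G) v.
      ((-1) powi (int_index G l (in_edge G v) + wind l (in_edge G v) f) * w (in_edge G v)) *\<^sub>R F f)"
    if v: "v \<in> internal G" "v \<in> white G" for v
  proof -
    let ?i = "in_edge G v"
    have "?i \<in> in_arcs (dg G) v" using white_in_arcs[OF v] by blast
    then have i: "?i \<in> edges G" "snd ?i = v" by (auto simp: in_out_arcs)
    have w0: "w ?i \<noteq> 0" using w i by force
    define c where "c = (-1) powi int_index G l ?i * w ?i"
    have c0: "c \<noteq> 0" using w0 by (simp add: c_def)
    have cinv: "(-1) powi int_index G l ?i * inverse (w ?i) = inverse c"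
      by (simp add: c_def minus_one_powi)
    define s where "s = (\<Sum>f\<in>out_arcs (dg G) v. ((-1) powi wind l ?i f) *\<^sub>R F f)"
    have "(\<Sum>e\<in>in_arcs (dg G) v. ?H v e) = inverse c *\<^sub>R F ?i"
      unfolding white_in_arcs[OF v] using half_edge_vectors_head[OF i(1), of w F] i(2) v cinv
      by (simp add: in_wind_sign_def)
    moreover have "(\<Sum>e\<in>out_arcs (dg G) v. ?H v e) = - s"
      unfolding s_def sum_negf[symmetric]
    proof (rule sum.cong)
      fix e assume "e \<in> out_arcs (dg G) v"
      then have e: "e \<in> edges G" "fst e = v" by (auto simp: in_out_arcs)
      show "?H v e = - ((-1) powi wind l ?i e *\<^sub>R F e)"
        using half_edge_vectors_tail[OF e(1), of w F] e(2) v by (simp add: vertex_sign_def out_wind_sign_def)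
    qed simp
    ultimately have "(\<Sum>e\<in>edges_at G v. ?H v e) = 0 \<longleftrightarrow> inverse c *\<^sub>R F ?i = s"
      by (simp add: sum_edges_at)
    also have "\<dots> \<longleftrightarrow> F ?i = c *\<^sub>R s"
    proof
      assume "inverse c *\<^sub>R F ?i = s"
      then have "c *\<^sub>R (inverse c *\<^sub>R F ?i) = c *\<^sub>R s" by simp
      then show "F ?i = c *\<^sub>R s" using c0 by simp
    next
      assume "F ?i = c *\<^sub>R s"
      then show "inverse c *\<^sub>R F ?i = s" using c0 by simp
    qed
    also have "c *\<^sub>R s = (\<Sum>f\<in>out_arcs (dg G) v. ((-1) powi (int_index G l ?i + wind l ?i f) * w ?i) *\<^sub>R F f)"
      unfolding s_def scaleR_sum_right by (intro sum.cong) (simp_all add: c_def powi_add ac_simps)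
    finally show ?thesis .
  qed
  have 3: "(\<forall>e\<in>edges_at G v. \<forall>e'\<in>edges_at G v. ?H v e = ?H v e') \<longleftrightarrow> (\<forall>e\<in>in_arcs (dg G) v.
      F e = ((-1) powi (int_index G l e + wind l e (out_edge G v)) * w e) *\<^sub>R F (out_edge G v))"
    if v: "v \<in> internal G" "v \<notin> white G" for v
  proof -
    let ?o = "out_edge G v"
    have "?o \<in> out_arcs (dg G) v" using black_out_arcs[OF v] by blast
    then have o: "?o \<in> edges G" "fst ?o = v" by (auto simp: in_out_arcs)
    have Ho: "?H v ?o = F ?o"
      using half_edge_vectors_tail[OF o(1), of w F] o(2) v by (simp add: vertex_sign_def out_wind_sign_def)
    have Hi: "?H v e = F ?o \<longleftrightarrow> F e = ((-1) powi (int_index G l e + wind l e ?o) * w e) *\<^sub>R F ?o"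
      if "e \<in> in_arcs (dg G) v" for e
    proof -
      have e: "e \<in> edges G" "snd e = v" using that by (auto simp: in_out_arcs)
      define c where "c = (-1) powi (int_index G l e + wind l e ?o) * w e"
      have "w e \<noteq> 0" using w e by force
      then have c0: "c \<noteq> 0" by (simp add: c_def)
      have "?H v e = inverse c *\<^sub>R F e"
        using half_edge_vectors_head[OF e(1), of w F] e(2) v
        by (simp add: in_wind_sign_def c_def minus_one_powi)
      moreover have "inverse c *\<^sub>R F e = F ?o \<longleftrightarrow> F e = c *\<^sub>R F ?o"
      proof
        assume "inverse c *\<^sub>R F e = F ?o"
        then have "c *\<^sub>R (inverse c *\<^sub>R F e) = c *\<^sub>R F ?o" by simp
        then show "F e = c *\<^sub>R F ?o" using c0 by simp
      qed (use c0 in simp)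
      ultimately show ?thesis by (simp add: c_def)
    qed
    have "edges_at G v = insert ?o (in_arcs (dg G) v)" by (simp add: edges_at_def black_out_arcs[OF v])
    then have "(\<forall>e\<in>edges_at G v. \<forall>e'\<in>edges_at G v. ?H v e = ?H v e') \<longleftrightarrow> (\<forall>e\<in>in_arcs (dg G) v. ?H v e = F ?o)"
      using Ho by (simp only: ball_simps) metis
    then show ?thesis using Hi by blast
  qed
  show ?thesis
    unfolding edge_vector_system_iff lam_system_def 1 using 2 3 by auto
qed

lemma sink_values_half_edge_vectors: "sink_values G (\<lambda>j. axis j 1) (half_edge_vectors G l w F)"
  by (simp add: sink_values_def half_edge_vectors_def)

text \<open>\<open>edge_vectors\<close> is a definite description, so existence and uniqueness are
  both due. A candidate arises from the Lam solution by inverting the formula for tail half-edges;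
  conversely these determine the edge vectors, as the factor in the formula is a sign.\<close>

lemma edge_vector_system_edge_vectors:
  assumes w: "\<forall>e\<in>edges G. 0 < w e"
  shows "edge_vector_system G l w (edge_vectors G l w)"
proof -
  obtain y :: "complex \<Rightarrow> (real, 'n) vec" where y: "vertex_system w (boundary_data (\<lambda>j. axis j 1)) y"
    and lam: "\<And>z. lam_system G w signature z \<and> sink_values G (\<lambda>j. axis j 1) z \<longleftrightarrow>
       (\<forall>U\<in>verts (dg G). \<forall>e\<in>edges_at G U. z U e = half_edges_of w y U e)"
    by (rule lam_solution[OF w]) (rule that)
  define F where "F e = (if e \<in> edges G then (vertex_sign (fst e) * out_wind_sign e) *\<^sub>R half_edges_of w y (fst e) e else 0)" for e
  have "half_edge_vectors G l w F U e = half_edges_of w y U e" if e: "e \<in> edges_at G U" for U e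
  proof (cases "fst e = U")
    case True
    then have e': "e \<in> edges G" using e by (simp add: edges_at_iff)
    have "half_edge_vectors G l w F (fst e) e =
        ((vertex_sign (fst e) * vertex_sign (fst e)) * (out_wind_sign e * out_wind_sign e)) *\<^sub>R half_edges_of w y (fst e) e"
      unfolding half_edge_vectors_tail[OF e'] using e' by (simp add: F_def ac_simps)
    then show ?thesis using True by simp
  next
    case False
    then have e': "e \<in> edges G" and U: "snd e = U" using e by (auto simp: edges_at_iff)
    have tail: "half_edges_of w y (fst e) e = (vertex_sign (fst e) * arc_sign e * w e) *\<^sub>R y (snd e)"
      using edgeD(3)[OF e'] by (simp add: half_edges_of_def geometric_signature_sign)
    show ?thesis
    proof (cases rule: head_cases[OF e'])
      case 1
      have "w e \<noteq> 0" using w e' by force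
      have "half_edge_vectors G l w F (snd e) e = (((-1) powi int_index G l e * (-1) powi int_index G l e) *
          (in_wind_sign e * in_wind_sign e) * (vertex_sign (fst e) * vertex_sign (fst e)) *
          (out_wind_sign e * out_wind_sign e) * (w e * inverse (w e))) *\<^sub>R y (snd e)"
        unfolding half_edge_vectors_head[OF e' 1] using e'
        by (simp only: F_def tail arc_sign_def scaleR_scaleR if_True ac_simps)
      then show ?thesis using \<open>w e \<noteq> 0\<close> U by (simp add: half_edges_of_def)
    next
      case (2 j)
      then have o: "out_arcs (dg G) (bdry G j) = {}" by (simp only: source_iff not_not)
      have "y (bdry G j) = axis j 1"
        using y[unfolded vertex_system_iff, rule_format, OF bdry_vert, of j] unfolding boundary_data_def o by simp
      then show ?thesis using 2 U by (auto simp: half_edges_of_def half_edge_vectors_def)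
    qed
  qed
  then have "lam_system G w signature (half_edge_vectors G l w F)" using lam by blast
  then have F: "edge_vector_system G l w F \<and> (\<forall>e. e \<notin> edges G \<longrightarrow> F e = 0)"
    by (simp add: edge_vector_system_iff_lam[OF w] F_def)
  have uniq: "F' = F" if F': "edge_vector_system G l w F' \<and> (\<forall>e. e \<notin> edges G \<longrightarrow> F' e = 0)" for F'
  proof
    fix e
    show "F' e = F e"
    proof (cases "e \<in> edges G")
      case True
      have at: "e \<in> edges_at G (fst e)" using True by (simp add: edges_at_iff)
      have "half_edge_vectors G l w F' (fst e) e = half_edges_of w y (fst e) e"
        "half_edge_vectors G l w F (fst e) e = half_edges_of w y (fst e) e"
        using F F' at edgeD(1)[OF True] lam sink_values_half_edge_vectors
        unfolding edge_vector_system_iff_lam[OF w] by blast+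
      then have "(vertex_sign (fst e) * out_wind_sign e) *\<^sub>R F' e = (vertex_sign (fst e) * out_wind_sign e) *\<^sub>R F e"
        by (simp only: half_edge_vectors_tail[OF True])
      moreover have "vertex_sign (fst e) * out_wind_sign e \<noteq> 0"
        by (auto simp: vertex_sign_def out_wind_sign_def minus_one_powi)
      ultimately show ?thesis by (simp only: scaleR_cancel_left) simp
    next
      case False
      then have "F' e = 0" "F e = 0" using F F' by blast+
      then show ?thesis by simp
    qed
  qed
  have "edge_vectors G l w = F"
    unfolding edge_vectors_def using F uniq by (rule the_equality)
  then show ?thesis using F by simp
qed

lemma full_rank_signature:
  assumes w: "\<forall>e\<in>edges G. 0 < w e"
  shows "full_rank G w signature"
  unfolding full_rank_def
proof
  fix b :: "'n \<Rightarrow> (real, 'n) vec"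
  obtain y :: "complex \<Rightarrow> (real, 'n) vec" where "vertex_system w (boundary_data b) y"
    and lam: "\<And>z. lam_system G w signature z \<and> sink_values G b z \<longleftrightarrow>
       (\<forall>U\<in>verts (dg G). \<forall>e\<in>edges_at G U. z U e = half_edges_of w y U e)"
    by (rule lam_solution[OF w]) (rule that)
  show "\<exists>z. lam_system G w signature z \<and> sink_values G b z \<and>
        (\<forall>z'. lam_system G w signature z' \<and> sink_values G b z' \<longrightarrow>
           (\<forall>U\<in>verts (dg G). \<forall>e\<in>edges_at G U. z' U e = z U e))"
    by (rule exI[of _ "half_edges_of w y"]) (simp only: conj_assoc[symmetric] lam, blast)
qed

text \<open>Rescaling by \<open>g\<close> is an involution that exchanges relation (i) for the two
  signatures. All half-edges at a vertex get the same nonzero factor, which preserves the relations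
  there, and \<open>g\<close> is 1 on the boundary.\<close>

lemma equivalent_signature_lam:
  assumes eq: "equivalent_via G \<epsilon> \<epsilon>' \<eta>"
  defines "g \<equiv> \<lambda>U. if U \<in> internal G then (-1 :: real) ^ \<eta> U else 1"
  shows "lam_system G w \<epsilon>' z \<and> sink_values G b z \<longleftrightarrow>
    lam_system G w \<epsilon> (\<lambda>U e. g U *\<^sub>R z U e) \<and> sink_values G b (\<lambda>U e. g U *\<^sub>R z U e)"
proof -
  have g2: "g U * g U = 1" for U by (simp add: g_def flip: power_mult_distrib)
  then have g0: "g U \<noteq> 0" for U by (metis mult_zero_left zero_neq_one)
  have sgn: "(-1 :: real) ^ \<epsilon>' (U, V) = (-1) ^ \<epsilon> (U, V) * g U * g V" if e: "(U, V) \<in> edges G" for U V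
  proof -
    let ?n = "\<epsilon> (U, V) + (if U \<in> internal G then \<eta> U else 0) + (if V \<in> internal G then \<eta> V else 0)"
    have "\<epsilon>' (U, V) mod 2 = ?n mod 2" using eq e by (auto simp: equivalent_via_def)
    then have "even (\<epsilon>' (U, V)) \<longleftrightarrow> even ?n" by (simp only: even_iff_mod_2_eq_zero)
    then have "(-1 :: real) ^ \<epsilon>' (U, V) = (-1) ^ ?n" by (simp only: minus_one_power_iff)
    then show ?thesis by (simp add: power_add g_def)
  qed
  have 1: "z U (U, V) = ((-1) ^ \<epsilon>' (U, V) * w (U, V)) *\<^sub>R z V (U, V) \<longleftrightarrow>
      g U *\<^sub>R z U (U, V) = ((-1) ^ \<epsilon> (U, V) * w (U, V)) *\<^sub>R g V *\<^sub>R z V (U, V)" if e: "(U, V) \<in> edges G" for U V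
  proof -
    have "((-1) ^ \<epsilon> (U, V) * w (U, V)) *\<^sub>R g V *\<^sub>R z V (U, V) =
       ((g U * g U) * ((-1) ^ \<epsilon> (U, V) * w (U, V) * g V)) *\<^sub>R z V (U, V)" by (simp add: g2)
    also have "\<dots> = g U *\<^sub>R (((-1) ^ \<epsilon>' (U, V) * w (U, V)) *\<^sub>R z V (U, V))"
      unfolding sgn[OF e] scaleR_scaleR by (simp only: ac_simps)
    finally show ?thesis using g0[of U] by (simp only: scaleR_cancel_left) simp
  qed
  have 2: "(\<Sum>e\<in>edges_at G v. g v *\<^sub>R z v e) = 0 \<longleftrightarrow> (\<Sum>e\<in>edges_at G v. z v e) = 0" for v
    using g0[of v] by (simp flip: scaleR_sum_right)
  have 3: "g v *\<^sub>R z v e = g v *\<^sub>R z v e' \<longleftrightarrow> z v e = z v e'" for v e e'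
    using g0[of v] by simp
  have 4: "g (bdry G j) = 1" for j by (simp add: g_def)
  have "(\<forall>(U, V)\<in>edges G. z U (U, V) = ((-1) ^ \<epsilon>' (U, V) * w (U, V)) *\<^sub>R z V (U, V)) \<longleftrightarrow>
    (\<forall>(U, V)\<in>edges G. g U *\<^sub>R z U (U, V) = ((-1) ^ \<epsilon> (U, V) * w (U, V)) *\<^sub>R g V *\<^sub>R z V (U, V))"
    by (intro ball_cong refl) (auto simp: 1)
  then show ?thesis unfolding lam_system_def sink_values_def 2 3 4 scaleR_one by blast
qed

end

section \<open>Winding number of a closed sequence of directions\<close>

fun sum_consecutive :: "('a \<Rightarrow> 'a \<Rightarrow> 'b::comm_monoid_add) \<Rightarrow> 'a list \<Rightarrow> 'b" where
  "sum_consecutive f (x # y # zs) = f x y + sum_consecutive f (y # zs)"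
| "sum_consecutive f _ = 0"

lemma sum_consecutive_nth:
  "sum_consecutive f xs = (\<Sum>k<length xs - 1. f (xs ! k) (xs ! Suc k))"
proof (induction f xs rule: sum_consecutive.induct)
  case (1 f x y zs)
  have "(\<Sum>k<length (x # y # zs) - 1. f ((x # y # zs) ! k) ((x # y # zs) ! Suc k)) =
      (\<Sum>k<Suc (length zs). f ((x # y # zs) ! k) ((x # y # zs) ! Suc k))" by simp
  also have "\<dots> = f x y + (\<Sum>k<length zs. f ((y # zs) ! k) ((y # zs) ! Suc k))"
    by (subst sum.lessThan_Suc_shift) simp
  finally show ?case using 1 by simp
qed auto

lemma sum_consecutive_map: "sum_consecutive f (map g xs) = sum_consecutive (\<lambda>x y. f (g x) (g y)) xs"
  by (induction xs rule: induct_list012) auto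

lemma sum_consecutive_snoc:
  "xs \<noteq> [] \<Longrightarrow> sum_consecutive f (xs @ [x]) = sum_consecutive f xs + f (last xs) x"
  by (induction xs rule: induct_list012) (auto simp: add.assoc)

text \<open>In terms of directions the winding also applies to the chord of a walk, which need not
  be an edge.\<close>

definition turn :: "complex \<Rightarrow> complex \<Rightarrow> complex \<Rightarrow> int" where
  "turn l d d' = wind l (0, d) (0, d')"

lemma wind_eq_turn: "wind l e f = turn l (evec e) (evec f)"
  by (simp add: turn_def wind_def evec_def)

text \<open>Corners of exactly half a turn are excluded; these are the ones at which the sense of
  the smoothing would be ambiguous.\<close>

definition not_opposite :: "complex \<Rightarrow> complex \<Rightarrow> bool" where
  "not_opposite d d' \<longleftrightarrow> (\<forall>t>0. d' \<noteq> - (t *\<^sub>R d))"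

text \<open>\<open>Arg (- d / l)\<close> is the branch of the angle of \<open>d\<close> that jumps at the direction \<open>l\<close>.\<close>

lemma Arg_turn:
  assumes l: "det2 l d \<noteq> 0" "det2 l d' \<noteq> 0" and no: "not_opposite d d'"
  shows "Arg (d' / d) = Arg (- d' / l) - Arg (- d / l) + 2 * pi * of_int (turn l d d')"
proof -
  define \<alpha> \<beta> where "\<alpha> = Arg (- d / l)" and "\<beta> = Arg (- d' / l)"
  define r s where "r = cmod (- d / l)" and "s = cmod (- d' / l)"
  have nz: "l \<noteq> 0" "d \<noteq> 0" "d' \<noteq> 0" using l by (auto simp: det2_def)
  then have rs: "0 < r" "0 < s" by (simp_all add: r_def s_def)
  have d: "d = - (l * rcis r \<alpha>)" and d': "d' = - (l * rcis s \<beta>)"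
    unfolding r_def s_def \<alpha>_def \<beta>_def rcis_cmod_Arg using nz by simp_all
  have bnd: "- pi < \<alpha>" "\<alpha> \<le> pi" "- pi < \<beta>" "\<beta> \<le> pi"
    unfolding \<alpha>_def \<beta>_def by (auto simp: mpi_less_Arg Arg_le_pi)
  have L: "0 < (cmod l)\<^sup>2" using nz by simp
  have det_l: "det2 l (- (l * rcis t x)) = - ((cmod l)\<^sup>2 * t * sin x)" for t x
    unfolding cmod_power2 by (simp add: det2_def rcis_def power2_eq_square algebra_simps)
  have det_dd: "det2 d d' = (cmod l)\<^sup>2 * r * s * sin (\<beta> - \<alpha>)"
    unfolding cmod_power2 d d' by (simp add: det2_def rcis_def power2_eq_square sin_diff algebra_simps)
  have s_l: "det2 l d = - ((cmod l)\<^sup>2 * r * sin \<alpha>)" "det2 l d' = - ((cmod l)\<^sup>2 * s * sin \<beta>)"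
    unfolding d d' det_l by simp_all
  have sin0: "sin \<alpha> \<noteq> 0" "sin \<beta> \<noteq> 0" using l unfolding s_l by auto
  then have bnd': "\<alpha> < pi" "\<beta> < pi" "\<alpha> \<noteq> 0" "\<beta> \<noteq> 0" using bnd by (auto simp: le_less)
  have sin_sign: "0 < sin x \<longleftrightarrow> 0 < x" if "- pi < x" "x < pi" "x \<noteq> 0" for x
    using sin_gt_zero[of x] sin_gt_zero[of "- x"] that by (cases "0 < x") auto
  have sL: "s_index l d' = (if 0 < \<beta> then -1 else 1)" "s_index d l = (if 0 < \<alpha> then 1 else -1)"
    using sin_sign[of \<alpha>] sin_sign[of \<beta>] bnd bnd' sin0 L rs
    by (auto simp: s_index_def s_l det2_skew[of d] zero_less_mult_iff mult_less_0_iff)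
  have sD: "s_index d d' = (if 0 < sin (\<beta> - \<alpha>) then 1 else if sin (\<beta> - \<alpha>) = 0 then 0 else -1)"
  proof -
    define K where "K = (cmod l)\<^sup>2 * r * s"
    have "0 < K" using L rs by (simp add: K_def)
    then show ?thesis unfolding s_index_def det_dd K_def[symmetric] by (auto simp: zero_less_mult_iff)
  qed
  have quot: "d' / d = of_real (s / r) * exp (\<i> * of_real (\<beta> - \<alpha> + 2 * pi * of_int k))" for k
  proof -
    have "exp (\<i> * of_real (\<beta> - \<alpha> + 2 * pi * of_int k)) = cis (\<beta> - \<alpha>) * cis (2 * pi * of_int k)"
      by (simp only: cis_conv_exp[symmetric] cis_mult)
    also have "cis (2 * pi * of_int k) = 1" by (rule cis_multiple_2pi) simp
    finally have "exp (\<i> * of_real (\<beta> - \<alpha> + 2 * pi * of_int k)) = cis \<beta> / cis \<alpha>" by (simp add: cis_divide)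
    then show ?thesis unfolding d d' rcis_def using nz rs by (simp add: field_simps)
  qed
  have not_pi: "\<beta> - \<alpha> \<noteq> pi" "\<beta> - \<alpha> \<noteq> - pi"
  proof -
    have "cis (\<beta> - \<alpha>) \<noteq> - 1"
    proof
      assume "cis (\<beta> - \<alpha>) = - 1"
      then have "d' / d = - of_real (s / r)"
        using quot[of 0] by (simp add: cis_conv_exp)
      then have "d' = - ((s / r) *\<^sub>R d)" using nz by (simp add: field_simps scaleR_conv_of_real)
      moreover have "0 < s / r" using rs by simp
      ultimately show False using no unfolding not_opposite_def by blast
    qed
    then show "\<beta> - \<alpha> \<noteq> pi" "\<beta> - \<alpha> \<noteq> - pi" by (auto simp: complex_eq_iff)
  qed
  have turn: "turn l d d' = (if 0 < sin (\<beta> - \<alpha>) \<and> 0 < \<alpha> \<and> \<beta> < 0 then 1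
      else if sin (\<beta> - \<alpha>) < 0 \<and> \<alpha> < 0 \<and> 0 < \<beta> then -1 else 0)"
    using bnd' by (auto simp: turn_def wind_def evec_def sL sD)
  \<comment> \<open>The difference of the two angles can leave the range of \<open>Arg\<close> only
    if they have opposite signs; the sign of its sine then tells whether it does, and
    \<open>turn\<close> brings it back.\<close>
  have range: "- pi < \<beta> - \<alpha> + 2 * pi * of_int (turn l d d')" "\<beta> - \<alpha> + 2 * pi * of_int (turn l d d') \<le> pi"
  proof -
    consider "0 < \<alpha>" "\<beta> < 0" | "\<alpha> < 0" "0 < \<beta>" | "0 < \<alpha>" "0 < \<beta>" | "\<alpha> < 0" "\<beta> < 0"
      using bnd' by linarith
    then have "- pi < \<beta> - \<alpha> + 2 * pi * of_int (turn l d d') \<and> \<beta> - \<alpha> + 2 * pi * of_int (turn l d d') \<le> pi"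
    proof cases
      case 1
      have "0 < sin (\<beta> - \<alpha>) \<longleftrightarrow> \<beta> - \<alpha> < - pi"
      proof -
        define x where "x = \<beta> - \<alpha> + pi"
        have "- pi < x" "x < pi" "x \<noteq> 0" using 1 bnd not_pi by (auto simp: x_def)
        then have A: "sin x < 0 \<longleftrightarrow> x < 0" using sin_sign[of "- x"] by simp
        have B: "sin (\<beta> - \<alpha>) = - sin x" by (simp add: x_def)
        have C: "x < 0 \<longleftrightarrow> \<beta> - \<alpha> < - pi" unfolding x_def by linarith
        show ?thesis unfolding B neg_0_less_iff_less A C ..
      qed
      then show ?thesis using 1 bnd bnd' not_pi unfolding turn by auto
    next
      case 2
      have "sin (\<beta> - \<alpha>) < 0 \<longleftrightarrow> pi < \<beta> - \<alpha>"
      proof -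
        define x where "x = \<beta> - \<alpha> - pi"
        have "- pi < x" "x < pi" "x \<noteq> 0" using 2 bnd not_pi by (auto simp: x_def)
        then have A: "0 < sin x \<longleftrightarrow> 0 < x" by (rule sin_sign)
        have B: "sin (\<beta> - \<alpha>) = - sin x" by (simp add: x_def)
        have C: "0 < x \<longleftrightarrow> pi < \<beta> - \<alpha>" unfolding x_def by linarith
        show ?thesis unfolding B neg_less_0_iff_less A C ..
      qed
      then show ?thesis using 2 bnd bnd' not_pi unfolding turn by auto
    qed (use bnd bnd' in \<open>auto simp: turn\<close>)
    then show "- pi < \<beta> - \<alpha> + 2 * pi * of_int (turn l d d')" "\<beta> - \<alpha> + 2 * pi * of_int (turn l d d') \<le> pi"
      by auto
  qed
  have "Arg (d' / d) = \<beta> - \<alpha> + 2 * pi * of_int (turn l d d')"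
    by (rule Arg_unique[OF quot[symmetric] _ range]) (use rs in simp)
  then show ?thesis by (simp add: \<alpha>_def \<beta>_def)
qed

lemma total_turning_eq:
  assumes "ds \<noteq> []" "\<forall>d\<in>set ds. det2 l d \<noteq> 0"
    and "\<forall>k<length ds - 1. not_opposite (ds ! k) (ds ! Suc k)"
  shows "total_turning ds = Arg (- last ds / l) - Arg (- hd ds / l) + 2 * pi * of_int (sum_consecutive (turn l) ds)"
  using assms unfolding total_turning_def sum_consecutive_nth[symmetric, where f = "\<lambda>x y. Arg (y / x)"]
proof (induction ds rule: induct_list012)
  case (3 x y zs)
  have "\<forall>k<length (y # zs) - 1. not_opposite ((y # zs) ! k) ((y # zs) ! Suc k)"
    using 3(5) by (auto dest: spec[of _ "Suc _"])
  moreover have "Arg (y / x) = Arg (- y / l) - Arg (- x / l) + 2 * pi * of_int (turn l x y)"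
    using 3(4,5) by (intro Arg_turn) auto
  ultimately show ?case using 3 by (simp add: algebra_simps)
qed auto

text \<open>First and last direction coincide, so the two branch angles cancel and the quotient is
  an integer before rounding.\<close>

lemma round_total_turning_closed:
  assumes "\<forall>d\<in>set ([c] @ ds @ [c]). det2 l d \<noteq> 0"
    and "\<forall>k<Suc (length ds). not_opposite (([c] @ ds @ [c]) ! k) (([c] @ ds @ [c]) ! Suc k)"
  shows "round (total_turning ([c] @ ds @ [c]) / (2 * pi)) = sum_consecutive (turn l) ([c] @ ds @ [c])"
proof -
  have "total_turning ([c] @ ds @ [c]) = 2 * pi * of_int (sum_consecutive (turn l) ([c] @ ds @ [c]))"
    using total_turning_eq[of "[c] @ ds @ [c]" l] assms by simp
  then show ?thesis by simp
qed

section \<open>Walks and boundary measurements\<close>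

lemma prod_power_indicator:
  "finite A \<Longrightarrow> (\<Prod>x\<in>A. if P x then -1 else 1 :: real) = (-1) ^ card {x \<in> A. P x}"
proof (induction A rule: finite_induct)
  case (insert x A)
  have "{y \<in> insert x A. P y} = (if P x then insert x {y \<in> A. P y} else {y \<in> A. P y})" by auto
  then show ?case using insert by simp
qed simp

lemma prod_list_prod: "(\<Prod>m\<in>I. prod_list (map (f m) p)) = prod_list (map (\<lambda>e. \<Prod>m\<in>I. f m e) p)"
  for f :: "'a \<Rightarrow> 'b \<Rightarrow> real"
  by (induction p) (simp_all add: prod.distrib)

context gauged_plabic_graph
begin

abbreviation walk :: "complex \<Rightarrow> (complex \<times> complex) list \<Rightarrow> complex \<Rightarrow> bool" where
  "walk \<equiv> pre_digraph.awalk (dg G)"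

lemma walk_Nil_iff: "walk U [] V \<longleftrightarrow> U = V \<and> U \<in> verts (dg G)"
  and walk_Cons_iff: "walk U (e # p) V \<longleftrightarrow> e \<in> edges G \<and> fst e = U \<and> walk (snd e) p V"
proof -
  interpret pair_digraph "net G" by (rule finite_loopfree)
  show "walk U [] V \<longleftrightarrow> U = V \<and> U \<in> verts (dg G)" by (simp add: awalk_Nil_iff)
  show "walk U (e # p) V \<longleftrightarrow> e \<in> edges G \<and> fst e = U \<and> walk (snd e) p V" by (auto simp: awalk_Cons_iff)
qed

lemma walk_edges: "walk U p V \<Longrightarrow> set p \<subseteq> edges G"
  by (induction p arbitrary: U) (auto simp: walk_Cons_iff simp del: with_proj_simps)

lemma walk_last: "walk U p V \<Longrightarrow> p \<noteq> [] \<Longrightarrow> snd (last p) = V"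
  by (induction p arbitrary: U) (auto simp: walk_Cons_iff walk_Nil_iff simp del: with_proj_simps)

lemma walk_consecutive:
  assumes "walk U p V" "Suc k < length p"
  shows "snd (p ! k) = fst (p ! Suc k)"
  using assms
proof (induction p arbitrary: U k)
  case (Cons e p)
  then show ?case
    by (cases k; cases p) (auto simp: walk_Cons_iff simp del: with_proj_simps)
qed simp

subsection \<open>The formal generating function of walks\<close>

definition walk_series :: "complex \<Rightarrow> complex \<Rightarrow> (complex \<times> complex) multiset \<Rightarrow> real" where
  "walk_series t U m = (\<Sum>p | walk U p t \<and> mset p = m. prod_list (map arc_sign p))"

lemma finite_mset_eq: "finite {p. R p \<and> mset p = m}"
proof (rule finite_subset)
  show "{p. R p \<and> mset p = m} \<subseteq> {p. set p \<subseteq> set_mset m \<and> length p = size m}" by auto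
qed (rule finite_lists_length_eq[OF finite_set_mset])

text \<open>A nonempty walk is its first edge followed by a walk from the head of that edge, whose
  monomial has one copy of the edge less.\<close>

lemma walk_series_step:
  assumes "U \<in> verts (dg G)"
  shows "walk_series t U m = of_bool (U = t \<and> m = {#}) +
    (\<Sum>e\<in>out_arcs (dg G) U. if e \<in># m then arc_sign e * walk_series t (snd e) (m - {#e#}) else 0)"
proof -
  let ?E = "{e \<in> out_arcs (dg G) U. e \<in># m}"
  let ?P = "\<lambda>e. (#) e ` {q. walk (snd e) q t \<and> mset q = m - {#e#}}"
  let ?f = "\<lambda>p. prod_list (map arc_sign p)"
  have split: "{p. walk U p t \<and> mset p = m} = {p. p = [] \<and> U = t \<and> m = {#}} \<union> (\<Union>e\<in>?E. ?P e)"
  proof (rule Set.set_eqI)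
    fix p
    show "p \<in> {p. walk U p t \<and> mset p = m} \<longleftrightarrow> p \<in> {p. p = [] \<and> U = t \<and> m = {#}} \<union> (\<Union>e\<in>?E. ?P e)"
    proof (cases p)
      case Nil
      then show ?thesis using assms by (auto simp: walk_Nil_iff)
    next
      case (Cons e q)
      have "mset p = m \<longleftrightarrow> e \<in># m \<and> mset q = m - {#e#}"
        unfolding Cons by (auto simp: insert_DiffM)
      moreover have "p \<in> (\<Union>e\<in>?E. ?P e) \<longleftrightarrow> e \<in> ?E \<and> walk (snd e) q t \<and> mset q = m - {#e#}"
        unfolding Cons by blast
      moreover have "e \<in> out_arcs (dg G) U \<longleftrightarrow> e \<in> edges G \<and> fst e = U" by (simp add: in_out_arcs)
      ultimately show ?thesis using walk_Cons_iff[of U e q t] Cons by blast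
    qed
  qed
  have "walk_series t U m = (\<Sum>p\<in>{p. p = [] \<and> U = t \<and> m = {#}}. ?f p) + (\<Sum>p\<in>(\<Union>e\<in>?E. ?P e). ?f p)"
    unfolding walk_series_def split
  proof (rule sum.union_disjoint)
    show "finite (\<Union>e\<in>?E. ?P e)"
      using finite_in_out_arcs(2)[of U] finite_mset_eq by (intro finite_UN_I finite_imageI) auto
  qed auto
  also have "(\<Sum>p\<in>{p. p = [] \<and> U = t \<and> m = {#}}. ?f p) = of_bool (U = t \<and> m = {#})"
    by (cases "U = t \<and> m = {#}") auto
  also have "(\<Sum>p\<in>(\<Union>e\<in>?E. ?P e). ?f p) = (\<Sum>e\<in>?E. \<Sum>p\<in>?P e. ?f p)"
    using finite_in_out_arcs(2)[of U] finite_mset_eq by (intro sum.UNION_disjoint) auto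
  also have "\<dots> = (\<Sum>e\<in>?E. arc_sign e * walk_series t (snd e) (m - {#e#}))"
    by (intro sum.cong refl) (simp add: sum.reindex walk_series_def sum_distrib_left)
  also have "\<dots> = (\<Sum>e\<in>out_arcs (dg G) U. if e \<in># m then arc_sign e * walk_series t (snd e) (m - {#e#}) else 0)"
    by (rule sum.inter_filter[OF finite_in_out_arcs(2)])
  finally show ?thesis .
qed

text \<open>In matrix form the recursion on the first edge is the vertex system again, with
  polynomials acting on series and the unit vector at \<open>t\<close> as inhomogeneity.\<close>

lemma walk_series_system:
  assumes U: "U \<in> verts (dg G)"
  shows "(\<lambda>m. \<Sum>V\<in>verts (dg G). poly_act (of_bool (U = V) - arc_monomial U V) (walk_series t V) m) =
    Poly_Mapping.lookup (of_bool (U = t))"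
proof
  fix m
  have act_diff: "poly_act (P - Q) F m = poly_act P F m - poly_act Q F m" for P Q and F :: "(complex \<times> complex) multiset \<Rightarrow> real"
    by (simp add: poly_act_def lookup_minus left_diff_distrib sum_subtractf)
  have act_one: "poly_act 1 F m = F m" for F :: "(complex \<times> complex) multiset \<Rightarrow> real"
    unfolding single_one[symmetric] by (simp only: poly_act_single) simp
  have "(\<Sum>V\<in>verts (dg G). poly_act (of_bool (U = V)) (walk_series t V) m) = (\<Sum>V\<in>verts (dg G). if V = U then walk_series t U m else 0)"
    by (intro sum.cong) (auto simp: poly_act_zero act_one)
  then have 1: "(\<Sum>V\<in>verts (dg G). poly_act (of_bool (U = V)) (walk_series t V) m) = walk_series t U m"
    using U finite_verts by simp
  have "(\<Sum>V\<in>verts (dg G). poly_act (arc_monomial U V) (walk_series t V) m) =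
      (\<Sum>V\<in>{V \<in> verts (dg G). (U, V) \<in> edges G}. if (U, V) \<in># m then arc_sign (U, V) * walk_series t V (m - {#(U, V)#}) else 0)"
    using finite_verts
    by (intro sum.mono_neutral_cong_right) (auto simp: arc_monomial_def poly_act_zero poly_act_single split: if_splits)
  also have "\<dots> = (\<Sum>e\<in>out_arcs (dg G) U. if e \<in># m then arc_sign e * walk_series t (snd e) (m - {#e#}) else 0)"
    by (rule sum.reindex_bij_witness[of _ snd "\<lambda>V. (U, V)"]) (auto simp: in_out_arcs dest: edgeD[simplified])
  finally have "(\<Sum>V\<in>verts (dg G). poly_act (of_bool (U = V) - arc_monomial U V) (walk_series t V) m) = of_bool (U = t \<and> m = {#})"
    unfolding act_diff sum_subtractf 1 by (simp only: walk_series_step[OF U] add_diff_cancel_right')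
  also have "\<dots> = Poly_Mapping.lookup (of_bool (U = t)) m"
    by (cases "U = t") (auto simp: lookup_one when_def)
  finally show "(\<Sum>V\<in>verts (dg G). poly_act (of_bool (U = V) - arc_monomial U V) (walk_series t V) m) =
    Poly_Mapping.lookup (of_bool (U = t)) m" .
qed

subsection \<open>The sign of a walk between boundary vertices\<close>

text \<open>The factors at inner vertices combine to the windings between consecutive edges; what
  remains are the tail factor of the first edge and the head factor of the last.\<close>

lemma walk_arc_signs:
  assumes "walk U p V" "p \<noteq> []"
  shows "prod_list (map arc_sign p) = prod_list (map (\<lambda>e. (-1) powi int_index G l e) p) *
    out_wind_sign (hd p) * (-1) powi sum_consecutive (wind l) p * in_wind_sign (last p)"
  using assms
proof (induction p arbitrary: U rule: induct_list012)
  case (3 e f p)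
  have ef: "e \<in> edges G" "f \<in> edges G" "snd e = fst f" "walk (snd e) (f # p) V"
    using 3(3) by (simp_all add: walk_Cons_iff del: with_proj_simps)
  note IH = "3.IH"(2)[OF ef(4)]
  have "prod_list (map arc_sign (e # f # p)) = arc_sign e * prod_list (map arc_sign (f # p))" by simp
  also have "\<dots> = prod_list (map (\<lambda>e. (-1) powi int_index G l e) (e # f # p)) * out_wind_sign e *
      ((in_wind_sign e * out_wind_sign f) * (-1) powi sum_consecutive (wind l) (f # p)) * in_wind_sign (last (f # p))"
    unfolding IH[OF list.distinct(2)] by (simp add: arc_sign_def)
  also have "\<dots> = prod_list (map (\<lambda>e. (-1) powi int_index G l e) (e # f # p)) * out_wind_sign e *
      (-1) powi sum_consecutive (wind l) (e # f # p) * in_wind_sign (last (f # p))"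
    unfolding consecutive_wind_sign[OF ef(1-3)] by (simp add: powi_add)
  finally show ?case by simp
qed (auto simp: arc_sign_def)

text \<open>The product telescopes: no edge enters a source, so a walk that starts elsewhere never
  visits b_m, and \<open>side m\<close> is nonzero at all its vertices.\<close>

lemma walk_crossing_signs:
  assumes "walk U p V" "m \<in> sources G" "U \<noteq> bdry G m"
  shows "prod_list (map (crossing_sign m) p) = sgn (side m U) * sgn (side m V)"
  using assms
proof (induction p arbitrary: U)
  case Nil
  then show ?case using side_eq_0_iff[of U m] by (auto simp: walk_Nil_iff sgn_if simp del: with_proj_simps)
next
  case (Cons e p)
  have e: "e \<in> edges G" "fst e = U" "walk (snd e) p V" using Cons.prems by (simp_all add: walk_Cons_iff del: with_proj_simps)
  have ne: "snd e \<noteq> bdry G m" using head_cases[OF e(1)] Cons.prems(2) by (metis bdry_eq_iff bdry_notin_internal)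
  have "side m U \<noteq> 0" "side m (snd e) \<noteq> 0"
    using side_eq_0_iff[of U m] side_eq_0_iff[of "snd e" m] edgeD[OF e(1)] e(2) ne Cons.prems(3) by auto
  then have "crossing_sign m e = sgn (side m U) * sgn (side m (snd e))" "sgn (side m (snd e)) * sgn (side m (snd e)) = 1"
    using e(2) by (auto simp: mult_less_0_iff sgn_if)
  then show ?case using Cons.IH[OF e(3) Cons.prems(2) ne] by (simp add: ac_simps)
qed

lemma walk_int_index_signs:
  assumes p: "walk (bdry G i) p (bdry G j)" "p \<noteq> []" and i: "i \<in> sources G" and j: "j \<notin> sources G"
  shows "prod_list (map (\<lambda>e. (-1) powi int_index G l e) p) =
    (-1) ^ sigma G i j * (sgn (det2 l (evec (hd p))) * sgn (det2 l (bdry G j - bdry G i)))"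
proof -
  obtain e q where pe: "p = e # q" using p(2) by (cases p) auto
  have e: "e \<in> edges G" "fst e = bdry G i" "walk (snd e) q (bdry G j)"
    using p(1) unfolding pe by (simp_all add: walk_Cons_iff del: with_proj_simps)
  have ij: "i \<noteq> j" using i j by auto
  let ?s = "\<lambda>m x. sgn (side m x)"
  have "prod_list (map (\<lambda>e. (-1) powi int_index G l e) p) = (\<Prod>m\<in>sources G. prod_list (map (crossing_sign m) p))"
    unfolding prod_list_prod using int_index_sign walk_edges[OF p(1)] by (intro arg_cong[of _ _ prod_list] map_cong) auto
  also have "\<dots> = prod_list (map (crossing_sign i) p) * (\<Prod>m\<in>sources G - {i}. prod_list (map (crossing_sign m) p))"
    by (rule prod.remove[OF _ i]) simp
  \<comment> \<open>The first edge starts on the line through b_i and has crossing sign 1, so the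
    telescoping begins at its head.\<close>
  also have "prod_list (map (crossing_sign i) p) = sgn (det2 l (evec e)) * sgn (det2 l (bdry G j - bdry G i))"
  proof -
    have "snd e \<noteq> bdry G i" using edgeD(3)[OF e(1)] e(2) by simp
    from walk_crossing_signs[OF e(3) i this] show ?thesis
      unfolding pe by (simp add: e(2) evec_def det2_def)
  qed
  also have "(\<Prod>m\<in>sources G - {i}. prod_list (map (crossing_sign m) p)) =
      (\<Prod>m\<in>sources G - {i}. if min i j < m \<and> m < max i j then -1 else 1)"
  proof (rule prod.cong)
    fix m assume m: "m \<in> sources G - {i}"
    then have mi: "m \<noteq> i" "m \<noteq> j" using j by auto
    have "prod_list (map (crossing_sign m) p) = sgn (side m (bdry G i)) * sgn (side m (bdry G j))"
      using m mi by (intro walk_crossing_signs[OF p(1)]) (auto simp: bdry_eq_iff)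
    \<comment> \<open>Heights order the boundary vertices as their labels do, so the two ends are on
      different sides exactly for labels strictly between them.\<close>
    also have "\<dots> = (if min i j < m \<and> m < max i j then -1 else 1)"
      using mi height_bdry_less_iff[of i m] height_bdry_less_iff[of m i] height_bdry_less_iff[of j m] height_bdry_less_iff[of m j]
      by (auto simp: side_bdry sgn_if min_def max_def)
    finally show "prod_list (map (crossing_sign m) p) = (if min i j < m \<and> m < max i j then -1 else 1)" .
  qed simp
  also have "\<dots> = (-1) ^ sigma G i j"
    by (subst prod_power_indicator) (auto simp: sigma_def min_def max_def split: if_splits intro!: arg_cong[of _ _ card] arg_cong[of _ _ "(^) _"])
  finally show ?thesis by (simp add: pe ac_simps)
qed

end

section \<open>The winding index of a walk and its arc signs\<close>

context gauged_plabic_graph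
begin

lemma not_opposite_of_inward:
  fixes x y r :: complex
  assumes "(x \<bullet> r) < 0" "(y \<bullet> r) < 0"
  shows "not_opposite x y"
  unfolding not_opposite_def
proof (intro allI impI notI)
  fix t :: real assume t: "0 < t" "y = - (t *\<^sub>R x)"
  then have "y \<bullet> r = t * - (x \<bullet> r)" by simp
  also have "\<dots> > 0" using t(1) assms(1) by (intro mult_pos_pos) auto
  finally show False using assms(2) by simp
qed

text \<open>Three vectors in the plane are linearly dependent, with their 2x2 minors as
  coefficients. Paired with a normal vector this decides whether \<open>l\<close> can lie between
  two directions.\<close>

lemma det2_combination: "of_real (det2 e f) * l = of_real (det2 l f) * e + of_real (det2 e l) * f"
  by (simp add: complex_eq_iff det2_def algebra_simps)

text \<open>Inside an open half plane the short way from \<open>x\<close> to \<open>y\<close> passes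
  through \<open>l\<close> exactly if they lie on different sides of \<open>l\<close>; the linear
  dependence supplies the sign of \<open>det2 x y\<close>.\<close>

lemma turn_inward_sign:
  fixes x y r :: complex
  assumes r: "x \<bullet> r < 0" "y \<bullet> r < 0" "l \<bullet> r < 0" and nz: "det2 l x \<noteq> 0" "det2 l y \<noteq> 0"
  shows "(-1 :: real) powi turn l x y = sgn (det2 l y) * sgn (det2 l x)"
proof -
  have eq: "det2 x y * (l \<bullet> r) = det2 l y * (x \<bullet> r) + det2 x l * (y \<bullet> r)"
    using arg_cong[OF det2_combination[of x y], of "\<lambda>z :: complex. z \<bullet> r"]
    by (simp add: inner_add_left inner_complex_def algebra_simps)
  consider "0 < det2 l x" "0 < det2 l y" | "det2 l x < 0" "det2 l y < 0"
    | "0 < det2 l x" "det2 l y < 0" | "det2 l x < 0" "0 < det2 l y" using nz by linarith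
  then show ?thesis
  proof cases
    case 3
    have "0 < det2 l y * (x \<bullet> r) + det2 x l * (y \<bullet> r)"
      using 3 r by (intro add_pos_pos mult_neg_neg) (simp_all add: det2_skew[of x])
    then have "det2 x y < 0" using r unfolding eq[symmetric] by (simp add: zero_less_mult_iff)
    then show ?thesis using 3 by (simp add: turn_def wind_def s_index_def evec_def det2_skew[of x l])
  next
    case 4
    have "det2 l y * (x \<bullet> r) + det2 x l * (y \<bullet> r) < 0"
      using 4 r by (intro add_neg_neg mult_pos_neg) (simp_all add: det2_skew[of x])
    then have "0 < det2 x y" using r unfolding eq[symmetric] by (simp add: mult_less_0_iff)
    then show ?thesis using 4 by (simp add: turn_def wind_def s_index_def evec_def det2_skew[of x l])
  qed (simp_all add: turn_def wind_def s_index_def evec_def det2_skew[of x l])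
qed

text \<open>A nonzero turn would make \<open>l\<close> a positive combination of \<open>x\<close>
  and \<open>y\<close>, which would put it into their half plane.\<close>

lemma turn_outward:
  fixes x y r :: complex
  assumes r: "0 < x \<bullet> r" "0 < y \<bullet> r" "l \<bullet> r < 0"
  shows "turn l x y = 0"
proof -
  have eq: "det2 x y * (l \<bullet> r) = det2 l y * (x \<bullet> r) + det2 x l * (y \<bullet> r)"
    using arg_cong[OF det2_combination[of x y], of "\<lambda>z :: complex. z \<bullet> r"]
    by (simp add: inner_add_left inner_complex_def algebra_simps)
  have "\<not> (0 < det2 x y \<and> 0 < det2 x l \<and> 0 < det2 l y)"
  proof
    assume *: "0 < det2 x y \<and> 0 < det2 x l \<and> 0 < det2 l y"
    then have "0 < det2 l y * (x \<bullet> r) + det2 x l * (y \<bullet> r)" using r by (intro add_pos_pos mult_pos_pos) auto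
    moreover have "det2 x y * (l \<bullet> r) < 0" using * r by (intro mult_pos_neg) auto
    ultimately show False using eq by simp
  qed
  moreover have "\<not> (det2 x y < 0 \<and> det2 x l < 0 \<and> det2 l y < 0)"
  proof
    assume *: "det2 x y < 0 \<and> det2 x l < 0 \<and> det2 l y < 0"
    then have "det2 l y * (x \<bullet> r) + det2 x l * (y \<bullet> r) < 0" using r by (intro add_neg_neg mult_neg_pos) auto
    moreover have "0 < det2 x y * (l \<bullet> r)" using * r by (intro mult_neg_neg) auto
    ultimately show False using eq by simp
  qed
  ultimately show ?thesis
    by (auto simp: turn_def wind_def s_index_def evec_def split: if_splits)
qed

lemma consecutive_not_opposite:
  assumes e: "e \<in> edges G" and f: "f \<in> edges G" and ef: "snd e = fst f"
  shows "not_opposite (evec e) (evec f)"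
proof -
  obtain A B D where e': "e = (A, B)" and f': "f = (B, D)" using ef by (cases e; cases f) auto
  have AD: "A \<noteq> D" using no_antiparallel e f unfolding e' f' by blast
  have ne: "A \<noteq> B" "B \<noteq> D" using edgeD(3)[OF e] edgeD(3)[OF f] unfolding e' f' by auto
  have "closed_segment A B \<inter> closed_segment B D \<subseteq> {A, B} \<inter> {B, D}"
    using embedded[OF e f] ne unfolding e' f' by simp
  also have "\<dots> = {B}" using AD ne by auto
  finally have "D - B \<noteq> t *\<^sub>R (A - B)" if "0 < t" for t using no_fold ne that by blast
  moreover have "t *\<^sub>R (A - B) = - (t *\<^sub>R (B - A))" for t by (simp add: algebra_simps)
  ultimately show ?thesis unfolding not_opposite_def e' f' evec_def by simp
qed

lemma winding_index_sign:
  assumes p: "walk (bdry G i) p (bdry G j)" and i: "i \<in> sources G" and j: "j \<notin> sources G"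
  shows "(-1 :: real) powi winding_index G i j p = (-1) ^ sigma G i j * prod_list (map arc_sign p)"
proof -
  define c where "c = bdry G j - bdry G i"
  have ij: "bdry G i \<noteq> bdry G j" using i j by (auto simp: bdry_eq_iff)
  have p0: "p \<noteq> []" using p ij by (auto simp: walk_Nil_iff)
  define e where "e = hd p"
  define f where "f = last p"
  have pe: "set p \<subseteq> edges G" by (rule walk_edges[OF p])
  have e: "e \<in> edges G" "fst e = bdry G i"
    using p p0 unfolding e_def by (cases p; simp add: walk_Cons_iff del: with_proj_simps)+
  have f: "f \<in> edges G" "snd f = bdry G j" using pe p0 walk_last[OF p p0] by (auto simp: f_def)
  let ?ri = "bdry G i - centre G" and ?rj = "bdry G j - centre G"
  have ce: "c \<bullet> ?ri < 0" "evec e \<bullet> ?ri < 0"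
    using inward_of_cball[OF vert_in_cball[OF bdry_vert[of j]], of i] ij
      inward_of_cball[OF vert_in_cball[OF edgeD(2)[OF e(1)]], of i] edgeD(3)[OF e(1)] e(2)
    by (auto simp: c_def evec_def)
  have neg: "(x - bdry G j) \<bullet> ?rj = - ((bdry G j - x) \<bullet> ?rj)" for x by (simp add: inner_diff_left)
  have cf: "0 < c \<bullet> ?rj" "0 < evec f \<bullet> ?rj"
    using inward_of_cball[OF vert_in_cball[OF bdry_vert[of i]], of j] ij
      inward_of_cball[OF vert_in_cball[OF edgeD(1)[OF f(1)]], of j] edgeD(3)[OF f(1)] f(2)
    unfolding neg by (auto simp: c_def evec_def)
  have detc: "det2 l c \<noteq> 0"
    using side_eq_0_iff[OF bdry_vert[of j], of i] ij by (simp add: c_def)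
  have dete: "det2 l (evec g) \<noteq> 0" if "g \<in> set p" for g using not_parallel pe that by blast
  have no: "not_opposite (([c] @ map evec p @ [c]) ! k) (([c] @ map evec p @ [c]) ! Suc k)"
    if k: "k < Suc (length (map evec p))" for k
  proof -
    have "k = 0 \<or> k = Suc (k - 1) \<and> (Suc (k - 1) < length p \<or> Suc (k - 1) = length p)"
      using k unfolding length_map by linarith
    then consider "k = 0" | k' where "k = Suc k'" "Suc k' < length p" | k' where "k = Suc k'" "Suc k' = length p"
      by blast
    then show ?thesis
    proof cases
      case 1
      have "([c] @ map evec p @ [c]) ! Suc 0 = evec e" using p0 by (simp add: e_def nth_append hd_conv_nth)
      then show ?thesis using 1 not_opposite_of_inward[OF ce] by simp
    next
      case (2 k')
      have "p ! k' \<in> edges G" "p ! Suc k' \<in> edges G" using pe 2(2) by (auto dest: nth_mem)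
      then show ?thesis using 2 consecutive_not_opposite walk_consecutive[OF p 2(2)] by (simp add: nth_append)
    next
      case (3 k')
      have len: "length p = Suc k'" using 3(2) by simp
      have "p ! k' = f" using last_conv_nth[OF p0] len by (simp add: f_def)
      then have "([c] @ map evec p @ [c]) ! k = evec f" using 3(1) len by (simp add: nth_append)
      moreover have "([c] @ map evec p @ [c]) ! Suc k = c" using 3(1) len by (simp add: nth_append)
      moreover have "not_opposite (evec f) c" by (rule not_opposite_of_inward[of _ "- ?rj"]) (use cf in \<open>simp_all only: inner_minus_right neg_less_0_iff_less\<close>)
      ultimately show ?thesis by simp
    qed
  qed
  have "winding_index G i j p = sum_consecutive (turn l) ([c] @ map evec p @ [c])"
    unfolding winding_index_def Let_def c_def[symmetric]
    by (rule round_total_turning_closed) (use detc dete no in auto)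
  also have "\<dots> = turn l c (evec e) + sum_consecutive (wind l) p + turn l (evec f) c"
  proof -
    obtain q where q: "p = e # q" using p0 by (cases p) (auto simp: e_def)
    have "sum_consecutive (turn l) ([c] @ map evec p @ [c]) = turn l c (evec e) + sum_consecutive (turn l) (map evec p @ [c])"
      by (simp add: q)
    also have "sum_consecutive (turn l) (map evec p @ [c]) = sum_consecutive (turn l) (map evec p) + turn l (evec f) c"
      using p0 by (simp add: sum_consecutive_snoc last_map f_def)
    also have "sum_consecutive (turn l) (map evec p) = sum_consecutive (wind l) p"
      unfolding sum_consecutive_map by (simp add: wind_eq_turn[abs_def])
    finally show ?thesis by (simp only: add.assoc)
  qed
  also have "turn l (evec f) c = 0" by (rule turn_outward[OF cf(2,1) gauge_inward])
  finally have wi: "winding_index G i j p = turn l c (evec e) + sum_consecutive (wind l) p" by simp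
  \<comment> \<open>These are the two signs that the ray of source \<open>i\<close> produces in
    \<open>walk_int_index_signs\<close>.\<close>
  have tc: "(-1 :: real) powi turn l c (evec e) = sgn (det2 l (evec e)) * sgn (det2 l c)"
    by (rule turn_inward_sign[OF ce gauge_inward detc]) (use dete p0 in \<open>auto simp: e_def\<close>)
  have "out_wind_sign (hd p) = 1" "in_wind_sign (last p) = 1"
    using e f by (simp_all add: out_wind_sign_def in_wind_sign_def e_def f_def)
  then have "prod_list (map arc_sign p) = (-1) ^ sigma G i j * ((-1) powi turn l c (evec e)) * (-1) powi sum_consecutive (wind l) p"
    unfolding walk_arc_signs[OF p p0] walk_int_index_signs[OF p p0 i j] tc by (simp add: e_def c_def)
  then have "(-1) ^ sigma G i j * prod_list (map arc_sign p) =
     ((-1) ^ sigma G i j * (-1) ^ sigma G i j) * ((-1) powi turn l c (evec e) * (-1) powi sum_consecutive (wind l) p)"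
    by (simp only: ac_simps)
  also have "\<dots> = (-1) powi winding_index G i j p"
    by (simp add: wi powi_add flip: power_mult_distrib)
  finally show ?thesis by simp
qed

text \<open>The formal measurement is a fixed sign times the series of walks, which Cramer's rule
  turns into a quotient of polynomials; the sign enters as a constant polynomial, and uniqueness of
  rational values identifies the result.\<close>

lemma boundary_measurement_eq:
  assumes w: "\<forall>e\<in>edges G. 0 < w e"
    and N: "\<And>U W. U \<in> verts (dg G) \<Longrightarrow> W \<in> verts (dg G) \<Longrightarrow>
      (\<Sum>V\<in>verts (dg G). N U V * (of_bool (V = W) - arc_monomial V W)) = (if U = W then D else 0)"
    and D: "poly_value w D \<noteq> 0" and i: "i \<in> sources G" and j: "j \<notin> sources G"
  shows "boundary_measurement G w i j =
    (-1) ^ sigma G i j * (poly_value w (N (bdry G i) (bdry G j)) / poly_value w D)"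
proof -
  define \<sigma> :: real where "\<sigma> = (-1) ^ sigma G i j"
  have F: "formal_measurement G i j = (\<lambda>m. \<sigma> * walk_series (bdry G j) (bdry G i) m)"
    unfolding formal_measurement_def walk_series_def sum_distrib_left
    by (intro ext sum.cong refl) (auto simp: \<sigma>_def winding_index_sign[OF _ i j] simp del: with_proj_simps)
  have "poly_act D (walk_series (bdry G j) (bdry G i)) = Poly_Mapping.lookup (N (bdry G i) (bdry G j))"
    by (rule formal_cramer[where S = "verts (dg G)" and A = "\<lambda>U V. of_bool (U = V) - arc_monomial U V"
        and X = "\<lambda>U. walk_series (bdry G j) U"]) (use finite_verts N walk_series_system bdry_vert in blast)+
  then have "poly_act D (formal_measurement G i j) = Poly_Mapping.lookup (Poly_Mapping.single {#} \<sigma> * N (bdry G i) (bdry G j))"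
    unfolding F poly_act_series_scale by (auto simp: poly_act_single simp flip: poly_act_lookup)
  then have "has_rational_value w (formal_measurement G i j)
      (poly_value w (Poly_Mapping.single {#} \<sigma> * N (bdry G i) (bdry G j)) / poly_value w D)"
    unfolding has_rational_value_iff using D by blast
  then have rational: "has_rational_value w (formal_measurement G i j) (\<sigma> * (poly_value w (N (bdry G i) (bdry G j)) / poly_value w D))"
    by (simp add: poly_value_mult poly_value_single)
  show ?thesis
    unfolding boundary_measurement_def \<sigma>_def[symmetric]
    by (rule the_equality, rule rational, erule has_rational_value_unique[OF _ rational])
qed

lemma nth_source_in_sources:
  assumes "r \<in> {1..card (sources G)}"
  shows "nth_source G r \<in> sources G"
  using assms nth_mem[of "r - 1" "sorted_list_of_set (sources G)"] unfolding nth_source_def by auto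

text \<open>The vertex vector at a source has the entries of \<open>N / D\<close> at the sinks and 0
  in all source columns, whereas the row of the matrix has 1 in its own source column; this accounts
  for the extra basis vector. The sign in the matrix cancels the one in the boundary
  measurement.\<close>

lemma boundary_solution:
  assumes w: "\<forall>e\<in>edges G. 0 < w e"
    and y: "vertex_system w (boundary_data (\<lambda>j. axis j 1)) (y :: complex \<Rightarrow> (real, 'n) vec)"
    and r: "r \<in> {1..card (sources G)}"
    and e: "e \<in> edges_at G (bdry G (nth_source G r))"
  shows "half_edges_of w y (bdry G (nth_source G r)) e = axis (nth_source G r) 1 - boundary_measurement_row G w r"
proof -
  define i where "i = nth_source G r"
  have i: "i \<in> sources G" unfolding i_def by (rule nth_source_in_sources[OF r])
  obtain N D where N: "\<And>U W. U \<in> verts (dg G) \<Longrightarrow> W \<in> verts (dg G) \<Longrightarrow>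
      (\<Sum>V\<in>verts (dg G). N U V * (of_bool (V = W) - arc_monomial V W)) = (if U = W then D else 0)"
    and D: "\<And>w. \<forall>e\<in>edges G. 0 < w e \<Longrightarrow> 0 < poly_value w D"
    and sol: "\<And>w b (y :: complex \<Rightarrow> (real, 'n) vec). \<forall>e\<in>edges G. 0 < w e \<Longrightarrow> vertex_system w b y \<longleftrightarrow>
      (\<forall>U\<in>verts (dg G). y U = (\<Sum>V\<in>verts (dg G). (poly_value w (N U V) / poly_value w D) *\<^sub>R b V))"
    by (rule transfer_inverse[where 'a = "(real, 'n) vec"]) (rule that)
  have out: "out_arcs (dg G) (bdry G i) = {e}"
  proof -
    from i obtain e' where e': "out_arcs (dg G) (bdry G i) = {e'}" "in_arcs (dg G) (bdry G i) = {}"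
      by (rule source_arcs) (rule that)
    then show ?thesis using e unfolding i_def[symmetric] edges_at_def by simp
  qed
  then have "e \<in> out_arcs (dg G) (bdry G i)" by blast
  then have e': "e \<in> edges G" "fst e = bdry G i" by (auto simp: in_out_arcs)
  have yi: "y (bdry G i) = (arc_sign e * w e) *\<^sub>R y (snd e)"
    using y[unfolded vertex_system_iff, rule_format, OF bdry_vert, of i] unfolding boundary_data_def out by simp
  have "half_edges_of w y (bdry G i) e = - y (bdry G i)"
    using edgeD(3)[OF e'(1)] e'(2) unfolding yi
    by (simp add: half_edges_of_def geometric_signature_sign vertex_sign_def)
  also have "y (bdry G i) = boundary_measurement_row G w r - axis i 1"
  proof (rule vec_eq_iff[THEN iffD2], rule allI)
    fix k
    define c where "c V = poly_value w (N (bdry G i) V) / poly_value w D" for V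
    have "y (bdry G i) $ k = (\<Sum>V\<in>verts (dg G). c V * boundary_data (\<lambda>j. axis j 1) V $ k)"
      using y[unfolded sol[OF w], rule_format, OF bdry_vert, of i] by (simp add: c_def)
    also have "\<dots> = (\<Sum>V\<in>verts (dg G). if V = bdry G k then (if k \<in> sources G then 0 else c V) else 0)"
    proof (rule sum.cong)
      fix V assume V: "V \<in> verts (dg G)"
      show "c V * boundary_data (\<lambda>j. axis j 1) V $ k = (if V = bdry G k then (if k \<in> sources G then 0 else c V) else 0)"
        using V
      proof (cases V rule: vert_cases)
        case 1
        then show ?thesis using internal_out_arcs[OF 1] by (auto simp: boundary_data_def)
      next
        case (2 j)
        then show ?thesis
          using source_iff[of j] by (auto simp: boundary_data_def axis_def bdry_eq_iff simp del: in_out_arcs_conv)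
      qed
    qed simp
    also have "\<dots> = (if k \<in> sources G then 0 else c (bdry G k))"
      using finite_verts bdry_vert[of k] by simp
    also have "\<dots> = (boundary_measurement_row G w r - axis i 1) $ k"
    proof (cases "k \<in> sources G")
      case True
      then show ?thesis by (simp add: boundary_measurement_row_def axis_def i_def)
    next
      case False
      have "boundary_measurement G w i k = (-1) ^ sigma G i k * c (bdry G k)"
        using boundary_measurement_eq[OF w N _ i False] D[OF w] by (simp add: c_def)
      then have "(-1) ^ sigma G i k * boundary_measurement G w i k = ((-1) ^ sigma G i k * (-1) ^ sigma G i k) * c (bdry G k)"
        by simp
      then have "(-1) ^ sigma G i k * boundary_measurement G w i k = c (bdry G k)"
        by (simp flip: power_mult_distrib)
      moreover have "k \<noteq> i" using False i by auto
      ultimately show ?thesis using False by (simp add: boundary_measurement_row_def axis_def i_def)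
    qed
    finally show "y (bdry G i) $ k = (boundary_measurement_row G w r - axis i 1) $ k" .
  qed
  finally show ?thesis by (simp add: i_def)
qed

end

theorem mainTheorem2:
  fixes G :: "'n::{finite,linorder} plabic"
    and l :: complex
    and w :: "complex \<times> complex \<Rightarrow> real"
    and \<epsilon> :: "complex \<times> complex \<Rightarrow> nat"
    and z :: "complex \<Rightarrow> complex \<times> complex \<Rightarrow> real ^ 'n::{finite,linorder}"
  assumes "plabic_graph G"
    and "gauge_direction G l"
    and "\<forall>e\<in>edges G. 0 < w e"
    and "\<epsilon> = geometric_signature G l"
    and "z = half_edge_vectors G l w (edge_vectors G l w)"
  shows
    "(lam_system G w \<epsilon> z \<and> sink_values G (\<lambda>j. axis j 1) z \<and>
      (\<forall>F. edge_vector_system G l w F \<longleftrightarrow> lam_system G w \<epsilon> (half_edge_vectors G l w F))) \<and>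
     (\<forall>w'. (\<forall>e\<in>edges G. 0 < w' e) \<longrightarrow> full_rank G w' \<epsilon>) \<and>
     (\<forall>z'. lam_system G w \<epsilon> z' \<and> sink_values G (\<lambda>j. axis j 1) z' \<longrightarrow>
        (\<forall>r\<in>{1..card (sources G)}. \<forall>e\<in>edges_at G (bdry G (nth_source G r)).
           z' (bdry G (nth_source G r)) e
             = axis (nth_source G r) 1 - boundary_measurement_row G w r)) \<and>
     (\<forall>\<epsilon>' \<eta>. is_signature G \<epsilon>' \<and> equivalent_via G \<epsilon> \<epsilon>' \<eta> \<longrightarrow>
        (\<forall>z'. lam_system G w \<epsilon>' z' \<and> sink_values G (\<lambda>j. axis j 1) z' \<longleftrightarrow>
           (\<forall>U\<in>verts (dg G). \<forall>e\<in>edges_at G U.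
              z' U e = (if U \<in> internal G then (-1) ^ \<eta> U *\<^sub>R z U e else z U e))))"
proof -
  interpret gauged_plabic_graph G l using assms(1,2) by (simp add: gauged_plabic_graph_def gauged_plabic_graph_axioms_def)
  note w = assms(3) and \<epsilon> = assms(4)
  have ev: "edge_vector_system G l w (edge_vectors G l w)"
    by (rule edge_vector_system_edge_vectors[OF w])
  have zlam: "lam_system G w \<epsilon> z" and zsink: "sink_values G (\<lambda>j. axis j 1) z"
    using ev sink_values_half_edge_vectors unfolding edge_vector_system_iff_lam[OF w] \<epsilon> assms(5) by auto
  obtain y :: "complex \<Rightarrow> (real, 'n) vec" where y: "vertex_system w (boundary_data (\<lambda>j. axis j 1)) y"
    and lam': "\<And>z. lam_system G w (geometric_signature G l) z \<and> sink_values G (\<lambda>j. axis j 1) z \<longleftrightarrow>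
       (\<forall>U\<in>verts (dg G). \<forall>e\<in>edges_at G U. z U e = half_edges_of w y U e)"
    by (rule lam_solution[OF w]) (rule that)
  note lam = lam'[folded \<epsilon>]
  have zy: "z U e = half_edges_of w y U e" if "U \<in> verts (dg G)" "e \<in> edges_at G U" for U e
    using lam[of z] zlam zsink that by blast
  have 1: "\<forall>F. edge_vector_system G l w F \<longleftrightarrow> lam_system G w \<epsilon> (half_edge_vectors G l w F)"
    unfolding \<epsilon> using edge_vector_system_iff_lam[OF w] by blast
  have 2: "\<forall>w'. (\<forall>e\<in>edges G. 0 < w' e) \<longrightarrow> full_rank G w' \<epsilon>"
    unfolding \<epsilon> using full_rank_signature by blast
  have 3: "z' (bdry G (nth_source G r)) e = axis (nth_source G r) 1 - boundary_measurement_row G w r"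
    if "lam_system G w \<epsilon> z' \<and> sink_values G (\<lambda>j. axis j 1) z'" "r \<in> {1..card (sources G)}"
      "e \<in> edges_at G (bdry G (nth_source G r))" for z' r e
    using that(1)[unfolded lam] bdry_vert that(3) boundary_solution[OF w y that(2,3)] by simp
  have 4: "lam_system G w \<epsilon>' z' \<and> sink_values G (\<lambda>j. axis j 1) z' \<longleftrightarrow>
      (\<forall>U\<in>verts (dg G). \<forall>e\<in>edges_at G U. z' U e = (if U \<in> internal G then (-1) ^ \<eta> U *\<^sub>R z U e else z U e))"
    if eq: "equivalent_via G \<epsilon> \<epsilon>' \<eta>" for \<epsilon>' \<eta> z'
  proof -
    define g where "g U = (if U \<in> internal G then (-1 :: real) ^ \<eta> U else 1)" for U
    have g2: "g U * g U = 1" for U by (simp add: g_def flip: power_mult_distrib)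
    \<comment> \<open>\<open>g U\<close> is its own inverse, so the factor can be moved from
      \<open>z'\<close> to the known solution.\<close>
    have swap: "g U *\<^sub>R a = b \<longleftrightarrow> a = g U *\<^sub>R b" for U and a b :: "(real, 'n) vec"
      using g2[of U] by (metis scaleR_scaleR scaleR_one)
    have "lam_system G w \<epsilon>' z' \<and> sink_values G (\<lambda>j. axis j 1) z' \<longleftrightarrow>
        (\<forall>U\<in>verts (dg G). \<forall>e\<in>edges_at G U. g U *\<^sub>R z' U e = half_edges_of w y U e)"
      unfolding equivalent_signature_lam[OF eq] g_def[symmetric] by (rule lam)
    also have "\<dots> \<longleftrightarrow> (\<forall>U\<in>verts (dg G). \<forall>e\<in>edges_at G U. z' U e = g U *\<^sub>R z U e)"
      unfolding swap by (intro ball_cong refl) (simp only: zy)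
    also have "\<dots> \<longleftrightarrow> (\<forall>U\<in>verts (dg G). \<forall>e\<in>edges_at G U.
        z' U e = (if U \<in> internal G then (-1) ^ \<eta> U *\<^sub>R z U e else z U e))"
      by (intro ball_cong refl) (simp add: g_def)
    finally show ?thesis .
  qed
  show ?thesis using zlam zsink 1 2 3 4 by blast
qed

end
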